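(* For every integer $n>0$ there are $(F,\mathrm{Frob})\in\mathcal{S}$, an element $a_n\in F$ and a tuple $b_n$ from $F$ such that $a_n$ belongs to the definable closure of $b_n$ in $(F,\mathrm{Frob})$ (in the language $\mathcal{L}_\sigma$), but $\deg_\sigma(a_n/b_n)=n$.
   Context: $\mathbb{P}$ = primes, $\mathrm{Frob}_p:x\mapsto x^p$, $\mathcal{L}_\sigma$ = language of rings plus unary $\sigma$. For a parameter-free $\mathcal{L}_\sigma$-formula $\varphi$ and prime $p$, $\varphi_p$ replaces each $\sigma(t)$ by $t^p$. For each ring formula $\psi(x,y)$, $|x|=n$, fix $C_\psi>0$ and finite $D_\psi\subseteq\{0,..,n\}\times\mathbb{R}^{>0}$ such that for all finite fields $\mathbb{F}_q$ and $a$ with $\psi(\mathbb{F}_q^n,a)\ne\emptyset$ some $(d,\mu)\in D_\psi$ has $\big||\psi(\mathbb{F}_q^n,a)|-\mu q^d\big|\le C_\psi q^{d-1/2}$; $E_\psi=\{\mu:(d,\mu)\in D_\psi\}$; $N^p_\varphi=\max\{\mu,1/\mu,2\log_p(2C_{\varphi_p}/\mu):\mu\in E_{\varphi_p}\}$; $f(\ell,p)=\max\{N^p_\varphi:|\varphi|\le\ell\}$. $\mathcal{S}$ = ultraproducts $\prod_{p}(\mathbb{F}_{p^{k_p}},\mathrm{Frob}_p)/\mathcal{U}$, $\mathcal{U}$ non-principal on $\mathbb{P}$, $k_p\ge f(p,p)$. In a difference field, for a difference subfield $E$ and tuple $a$, $\deg_\sigma(a/E)$ is the transcendence degree over $E$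 of the smallest difference field containing $E\cup a$ closed under $\sigma,\sigma^{-1}$; $\deg_\sigma(a/b)$ means $\deg_\sigma(a/E)$ for $E$ the difference field generated by $b$. *)

theory Defs
  imports "HOL-Algebra.Subrings" "HOL-Computational_Algebra.Primes"
begin

datatype trm = TVar nat | TZero | TOne | TAdd trm trm | TNeg trm | TMul trm trm | TSig trm

datatype fml = FEq trm trm | FNot fml | FAnd fml fml | FEx nat fml

fun tfv :: "trm \<Rightarrow> nat set" where
  "tfv (TVar i) = {i}"
| "tfv TZero = {}"
| "tfv TOne = {}"
| "tfv (TAdd s t) = tfv s \<union> tfv t"
| "tfv (TNeg t) = tfv t"
| "tfv (TMul s t) = tfv s \<union> tfv t"
| "tfv (TSig t) = tfv t"

fun ffv :: "fml \<Rightarrow> nat set" where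
  "ffv (FEq s t) = tfv s \<union> tfv t"
| "ffv (FNot f) = ffv f"
| "ffv (FAnd f g) = ffv f \<union> ffv g"
| "ffv (FEx k f) = ffv f - {k}"

fun tnosig :: "trm \<Rightarrow> bool" where
  "tnosig (TVar i) = True"
| "tnosig TZero = True"
| "tnosig TOne = True"
| "tnosig (TAdd s t) = (tnosig s \<and> tnosig t)"
| "tnosig (TNeg t) = tnosig t"
| "tnosig (TMul s t) = (tnosig s \<and> tnosig t)"
| "tnosig (TSig t) = False"

fun ring_fml :: "fml \<Rightarrow> bool" where
  "ring_fml (FEq s t) = (tnosig s \<and> tnosig t)"
| "ring_fml (FNot f) = ring_fml f"
| "ring_fml (FAnd f g) = (ring_fml f \<and> ring_fml g)"
| "ring_fml (FEx k f) = ring_fml f"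

text \<open>Length of a formula; a variable with index i is written with i+1 symbols,
  so there are only finitely many formulas of bounded length.\<close>
fun tlen :: "trm \<Rightarrow> nat" where
  "tlen (TVar i) = i + 1"
| "tlen TZero = 1"
| "tlen TOne = 1"
| "tlen (TAdd s t) = 1 + tlen s + tlen t"
| "tlen (TNeg t) = 1 + tlen t"
| "tlen (TMul s t) = 1 + tlen s + tlen t"
| "tlen (TSig t) = 1 + tlen t"

fun flen :: "fml \<Rightarrow> nat" where
  "flen (FEq s t) = 1 + tlen s + tlen t"
| "flen (FNot f) = 1 + flen f"
| "flen (FAnd f g) = 1 + flen f + flen g"
| "flen (FEx k f) = k + 2 + flen f"

fun tpow :: "trm \<Rightarrow> nat \<Rightarrow> trm" where
  "tpow t 0 = TOne"
| "tpow t (Suc k) = TMul t (tpow t k)"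

fun tsubp :: "nat \<Rightarrow> trm \<Rightarrow> trm" where
  "tsubp p (TVar i) = TVar i"
| "tsubp p TZero = TZero"
| "tsubp p TOne = TOne"
| "tsubp p (TAdd s t) = TAdd (tsubp p s) (tsubp p t)"
| "tsubp p (TNeg t) = TNeg (tsubp p t)"
| "tsubp p (TMul s t) = TMul (tsubp p s) (tsubp p t)"
| "tsubp p (TSig t) = tpow (tsubp p t) p"

fun fsubp :: "nat \<Rightarrow> fml \<Rightarrow> fml" where
  "fsubp p (FEq s t) = FEq (tsubp p s) (tsubp p t)"
| "fsubp p (FNot f) = FNot (fsubp p f)"
| "fsubp p (FAnd f g) = FAnd (fsubp p f) (fsubp p g)"
| "fsubp p (FEx k f) = FEx k (fsubp p f)"

fun teval :: "('b, 'm) ring_scheme \<Rightarrow> ('b \<Rightarrow> 'b) \<Rightarrow> (nat \<Rightarrow> 'b) \<Rightarrow> trm \<Rightarrow> 'b" where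
  "teval R s e (TVar i) = e i"
| "teval R s e TZero = \<zero>\<^bsub>R\<^esub>"
| "teval R s e TOne = \<one>\<^bsub>R\<^esub>"
| "teval R s e (TAdd t u) = teval R s e t \<oplus>\<^bsub>R\<^esub> teval R s e u"
| "teval R s e (TNeg t) = \<ominus>\<^bsub>R\<^esub> teval R s e t"
| "teval R s e (TMul t u) = teval R s e t \<otimes>\<^bsub>R\<^esub> teval R s e u"
| "teval R s e (TSig t) = s (teval R s e t)"

fun sat :: "('b, 'm) ring_scheme \<Rightarrow> ('b \<Rightarrow> 'b) \<Rightarrow> (nat \<Rightarrow> 'b) \<Rightarrow> fml \<Rightarrow> bool" where
  "sat R s e (FEq t u) = (teval R s e t = teval R s e u)"
| "sat R s e (FNot f) = (\<not> sat R s e f)"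
| "sat R s e (FAnd f g) = (sat R s e f \<and> sat R s e g)"
| "sat R s e (FEx k f) = (\<exists>v\<in>carrier R. sat R s (e(k := v)) f)"

text \<open>For a ring formula psi, a finite set V of variables (the tuple x, |x| = card V;
  the remaining variables are the parameters y), the set psi(F^V, a).\<close>
definition solset :: "nat ring \<Rightarrow> fml \<Rightarrow> nat set \<Rightarrow> (nat \<Rightarrow> nat) \<Rightarrow> (nat \<Rightarrow> nat) set" where
  "solset R psi V e = {v \<in> PiE V (\<lambda>_. carrier R). sat R id (\<lambda>i. if i \<in> V then v i else e i) psi}"

definition good_counting ::
  "(fml \<Rightarrow> nat set \<Rightarrow> real) \<Rightarrow> (fml \<Rightarrow> nat set \<Rightarrow> (nat \<times> real) set) \<Rightarrow> bool" where
  "good_counting C D \<longleftrightarrow>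
    (\<forall>psi V. ring_fml psi \<and> finite V \<longrightarrow>
       C psi V > 0 \<and> finite (D psi V) \<and>
       (\<forall>(d, mu) \<in> D psi V. d \<le> card V \<and> mu > 0) \<and>
       (\<forall>(R :: nat ring) e. field R \<and> finite (carrier R) \<and> range e \<subseteq> carrier R \<and>
            solset R psi V e \<noteq> {} \<longrightarrow>
          (\<exists>(d, mu) \<in> D psi V.
             \<bar>real (card (solset R psi V e)) - mu * real (card (carrier R)) ^ d\<bar>
               \<le> C psi V * real (card (carrier R)) powr (real d - 1/2))))"

definition Eset :: "(fml \<Rightarrow> nat set \<Rightarrow> (nat \<times> real) set) \<Rightarrow> fml \<Rightarrow> nat set \<Rightarrow> real set" where
  "Eset D psi V = snd ` D psi V"

text \<open>The values whose maximum is N^p_phi (phi parameter-free; x = its free variables).\<close>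
definition Nvals :: "(fml \<Rightarrow> nat set \<Rightarrow> real) \<Rightarrow> (fml \<Rightarrow> nat set \<Rightarrow> (nat \<times> real) set) \<Rightarrow>
    nat \<Rightarrow> fml \<Rightarrow> real set" where
  "Nvals C D p phi =
     (\<Union>mu \<in> Eset D (fsubp p phi) (ffv phi).
        {mu, 1 / mu, 2 * log (real p) (2 * C (fsubp p phi) (ffv phi) / mu)})"

definition fbound :: "(fml \<Rightarrow> nat set \<Rightarrow> real) \<Rightarrow> (fml \<Rightarrow> nat set \<Rightarrow> (nat \<times> real) set) \<Rightarrow>
    nat \<Rightarrow> nat \<Rightarrow> real" where
  "fbound C D l p = Max (insert 0 (\<Union>phi \<in> {phi. flen phi \<le> l}. Nvals C D p phi))"

definition nonprincipal_ultrafilter_on :: "nat set \<Rightarrow> nat set set \<Rightarrow> bool" where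
  "nonprincipal_ultrafilter_on P U \<longleftrightarrow>
     U \<subseteq> Pow P \<and> P \<in> U \<and> {} \<notin> U \<and>
     (\<forall>A B. A \<in> U \<and> A \<subseteq> B \<and> B \<subseteq> P \<longrightarrow> B \<in> U) \<and>
     (\<forall>A B. A \<in> U \<and> B \<in> U \<longrightarrow> A \<inter> B \<in> U) \<and>
     (\<forall>A. A \<subseteq> P \<longrightarrow> A \<in> U \<or> P - A \<in> U) \<and>
     (\<forall>p. {p} \<notin> U)"

abbreviation Primes :: "nat set" where "Primes \<equiv> {p::nat. Factorial_Ring.prime p}"

definition urep_set :: "(nat \<Rightarrow> nat ring) \<Rightarrow> (nat \<Rightarrow> nat) set" where
  "urep_set K = PiE Primes (\<lambda>p. carrier (K p))"

definition uclass :: "(nat \<Rightarrow> nat ring) \<Rightarrow> nat set set \<Rightarrow> (nat \<Rightarrow> nat) \<Rightarrow> (nat \<Rightarrow> nat) set" where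
  "uclass K U g = {h \<in> urep_set K. {p \<in> Primes. g p = h p} \<in> U}"

definition urep :: "(nat \<Rightarrow> nat) set \<Rightarrow> nat \<Rightarrow> nat" where
  "urep V = (SOME g. g \<in> V)"

definition ultraprod :: "(nat \<Rightarrow> nat ring) \<Rightarrow> nat set set \<Rightarrow> (nat \<Rightarrow> nat) set ring" where
  "ultraprod K U =
    \<lparr>partial_object.carrier = uclass K U ` urep_set K,
     monoid.mult = (\<lambda>V Y. uclass K U (\<lambda>p\<in>Primes. urep V p \<otimes>\<^bsub>K p\<^esub> urep Y p)),
     monoid.one = uclass K U (\<lambda>p\<in>Primes. \<one>\<^bsub>K p\<^esub>),
     ring.zero = uclass K U (\<lambda>p\<in>Primes. \<zero>\<^bsub>K p\<^esub>),
     ring.add = (\<lambda>V Y. uclass K U (\<lambda>p\<in>Primes. urep V p \<oplus>\<^bsub>K p\<^esub> urep Y p))\<rparr>"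

definition ufrob :: "(nat \<Rightarrow> nat ring) \<Rightarrow> nat set set \<Rightarrow> (nat \<Rightarrow> nat) set \<Rightarrow> (nat \<Rightarrow> nat) set" where
  "ufrob K U V = uclass K U (\<lambda>p\<in>Primes. urep V p [^]\<^bsub>K p\<^esub> p)"

definition dcl_mem :: "('b, 'm) ring_scheme \<Rightarrow> ('b \<Rightarrow> 'b) \<Rightarrow> 'b list \<Rightarrow> 'b \<Rightarrow> bool" where
  "dcl_mem R s bs a \<longleftrightarrow>
     (\<exists>phi. ffv phi \<subseteq> {..length bs} \<and>
        {x \<in> carrier R. sat R s (\<lambda>i. if i = 0 then x else bs ! (i - 1)) phi} = {a})"

definition sigma_closed :: "('b, 'm) ring_scheme \<Rightarrow> ('b \<Rightarrow> 'b) \<Rightarrow> 'b set \<Rightarrow> bool" where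
  "sigma_closed R s E \<longleftrightarrow> (\<forall>y \<in> carrier R. s y \<in> E \<longleftrightarrow> y \<in> E)"

definition dfield_gen :: "('b, 'm) ring_scheme \<Rightarrow> ('b \<Rightarrow> 'b) \<Rightarrow> 'b set \<Rightarrow> 'b set" where
  "dfield_gen R s S = \<Inter> {E. subfield E R \<and> S \<subseteq> E \<and> sigma_closed R s E}"

definition monomial :: "('b, 'm) ring_scheme \<Rightarrow> nat list \<Rightarrow> 'b list \<Rightarrow> 'b" where
  "monomial R \<alpha> xs = finprod R (\<lambda>i. xs ! i [^]\<^bsub>R\<^esub> (\<alpha> ! i)) {..<length xs}"

definition alg_indep :: "('b, 'm) ring_scheme \<Rightarrow> 'b set \<Rightarrow> 'b list \<Rightarrow> bool" where
  "alg_indep R E xs \<longleftrightarrow> distinct xs \<and> set xs \<subseteq> carrier R \<and>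
     (\<forall>M c. finite M \<and> (\<forall>\<alpha>\<in>M. length \<alpha> = length xs) \<and> c \<in> M \<rightarrow> E \<and>
        finsum R (\<lambda>\<alpha>. c \<alpha> \<otimes>\<^bsub>R\<^esub> monomial R \<alpha> xs) M = \<zero>\<^bsub>R\<^esub>
        \<longrightarrow> (\<forall>\<alpha>\<in>M. c \<alpha> = \<zero>\<^bsub>R\<^esub>))"

definition trdeg_eq :: "('b, 'm) ring_scheme \<Rightarrow> 'b set \<Rightarrow> 'b set \<Rightarrow> nat \<Rightarrow> bool" where
  "trdeg_eq R E E' n \<longleftrightarrow>
     (\<exists>xs. set xs \<subseteq> E' \<and> length xs = n \<and> alg_indep R E xs) \<and>
     \<not> (\<exists>xs. set xs \<subseteq> E' \<and> length xs = Suc n \<and> alg_indep R E xs)"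

definition deg_sigma_eq :: "('b, 'm) ring_scheme \<Rightarrow> ('b \<Rightarrow> 'b) \<Rightarrow> 'b \<Rightarrow> 'b list \<Rightarrow> nat \<Rightarrow> bool" where
  "deg_sigma_eq R s a bs n \<longleftrightarrow>
     (let E = dfield_gen R s (set bs) in trdeg_eq R E (dfield_gen R s (insert a E)) n)"

end

(*
  Let q = p^k with k = 1 modulo 2n and p odd.  The additive map x |-> x^(p^n) + x is injective on F_q:
  if z^(p^n) = -z, then z is fixed by the 2n-th power of Frobenius, hence by Frobenius itself,
  so z = -z = 0.  Thus in the ultraproduct a is definable from b = sigma^n(a) + a.

  Choose a to be represented by generators of the fields F_q over F_p, with k growing so fast that
  the sigma-translates of a are algebraically independent.  The difference field generated by a over
  that of b is E(a, sigma a, ..., sigma^(n-1) a), because b lets one solve for sigma^n a and for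
  sigma^(-1) a linearly; and these n elements stay independent over E, since the translates of b
  together with them arise from the translates of a by a unitriangular linear substitution.
*)
theory Submission
  imports Defs "HOL-Algebra.Algebraic_Closure" "HOL-Algebra.Generated_Rings"
    "HOL-Number_Theory.Residues" "HOL-Computational_Algebra.Polynomial"
begin

section \<open>Evaluation of integer polynomials and the Frobenius map\<close>

text \<open>The ultraproduct has characteristic 0 although every factor has characteristic p, so a
  relation between translates of \<open>a\<close> is a family of relations, one for each prime. At p
  it becomes an integer polynomial in a single generator of F_q, of degree at most D * p^M with D
  and M independent of p, while no nonzero polynomial over F_p of degree below k vanishes at that
  generator. Hence k must eventually exceed every D * p^M, and p^p does; adding the prescribed lower
  bound for k and passing to 2 n m + 1 only enlarges the exponent. The difference field also
  contains the inverse translates, and at p the inverse of Frobenius is the power with exponent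
  p^(k-1), far too large for this degree count. The way out is to rewrite a finite window of
  translates from its lowest member, which is again a generator; independence is therefore proved
  for windows, one new element at a time at either end. The upper bound for the transcendence degree
  is a separate matter: more than n fractions in n generators are dependent because of a comparison
  of dimensions.\<close>

definition type_hom :: "('b, 'm) ring_scheme \<Rightarrow> ('c::comm_ring_1 \<Rightarrow> 'b) \<Rightarrow> bool" where
  "type_hom R h \<longleftrightarrow> (\<forall>c. h c \<in> carrier R) \<and> h 0 = \<zero>\<^bsub>R\<^esub> \<and> h 1 = \<one>\<^bsub>R\<^esub> \<and>
     (\<forall>c d. h (c + d) = h c \<oplus>\<^bsub>R\<^esub> h d) \<and> (\<forall>c d. h (c * d) = h c \<otimes>\<^bsub>R\<^esub> h d)"

text \<open>Polynomials live on a type while the rings have carriers; the coefficient map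
  \<open>h\<close> bridges the two. Since an evaluation is again a \<open>type_hom\<close>,
  evaluations can be nested, which handles polynomials in two variables.\<close>

definition hom_eval :: "('b, 'm) ring_scheme \<Rightarrow> ('c::comm_ring_1 \<Rightarrow> 'b) \<Rightarrow> 'b \<Rightarrow> 'c poly \<Rightarrow> 'b" where
  "hom_eval R h x P = fold_coeffs (\<lambda>c y. h c \<oplus>\<^bsub>R\<^esub> x \<otimes>\<^bsub>R\<^esub> y) P \<zero>\<^bsub>R\<^esub>"

text \<open>The canonical map from the integers. The equation
  \<open>int_emb R (int p) = \<zero>\<close> expresses throughout that the characteristic of
  \<open>R\<close> divides \<open>p\<close>.\<close>

definition int_emb :: "('b, 'm) ring_scheme \<Rightarrow> int \<Rightarrow> 'b" where
  "int_emb R k = [k] \<cdot>\<^bsub>R\<^esub> \<one>\<^bsub>R\<^esub>"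

lemma type_homD:
  assumes "type_hom R h"
  shows "h c \<in> carrier R" "h 0 = \<zero>\<^bsub>R\<^esub>" "h 1 = \<one>\<^bsub>R\<^esub>" "h (c + d) = h c \<oplus>\<^bsub>R\<^esub> h d" "h (c * d) = h c \<otimes>\<^bsub>R\<^esub> h d"
  using assms by (auto simp: type_hom_def)

context cring begin

lemma int_emb_hom: "type_hom R (int_emb R)"
proof -
  have a: "[(k+l::int)] \<cdot> \<one> = [k] \<cdot> \<one> \<oplus> [l] \<cdot> \<one>" for k l
    by (simp add: add.int_pow_mult)
  have m: "[(k*l::int)] \<cdot> \<one> = [k] \<cdot> \<one> \<otimes> [l] \<cdot> \<one>" for k l
    by (metis add.int_pow_closed add.int_pow_pow add_pow_ldistr_int l_one mult.commute one_closed)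
  have "[(1::int)] \<cdot> \<one> = \<one>" by (simp add: add_pow_int_ge)
  then show ?thesis
    unfolding type_hom_def int_emb_def using a m by (auto simp: add_pow_int_ge)
qed

lemma type_hom_uminus: "type_hom R h \<Longrightarrow> h (- c) = \<ominus> h c"
  by (metis add.inv_equality type_homD(1,2,4) add.left_inverse)

lemma type_hom_power: "type_hom R h \<Longrightarrow> h (c ^ n) = h c [^] (n::nat)"
  by (induct n) (simp_all add: type_homD m_comm)


lemma hom_eval_0: "type_hom R h \<Longrightarrow> hom_eval R h x 0 = \<zero>"
  by (simp add: hom_eval_def)

lemma hom_eval_pCons:
  assumes "type_hom R h" "x \<in> carrier R"
  shows "hom_eval R h x (pCons c P) = h c \<oplus> x \<otimes> hom_eval R h x P"
  using assms by (auto simp: hom_eval_def type_homD cCons_def fold_coeffs_def)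

lemma hom_eval_closed:
  assumes "type_hom R h" "x \<in> carrier R"
  shows "hom_eval R h x P \<in> carrier R"
proof (induct P)
  case 0 then show ?case using assms by (simp add: hom_eval_0)
next
  case (pCons a p)
  then show ?case using assms by (simp add: hom_eval_pCons type_homD)
qed

lemma hom_eval_add:
  assumes "type_hom R h" "x \<in> carrier R"
  shows "hom_eval R h x (P + Q) = hom_eval R h x P \<oplus> hom_eval R h x Q"
proof (induct P Q rule: poly_induct2)
  case 0 then show ?case using assms by (simp add: hom_eval_0)
next
  case (pCons a p b q)
  have c: "h a \<in> carrier R" "h b \<in> carrier R" "hom_eval R h x p \<in> carrier R" "hom_eval R h x q \<in> carrier R"
    using assms by (auto simp: type_homD hom_eval_closed)
  show ?case using assms c
    by (simp add: hom_eval_pCons type_homD(4)[OF assms(1)] pCons r_distr add.m_ac)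
qed

lemma hom_eval_smult:
  assumes "type_hom R h" "x \<in> carrier R"
  shows "hom_eval R h x (smult c P) = h c \<otimes> hom_eval R h x P"
proof (induct P)
  case 0 then show ?case using assms by (simp add: hom_eval_0 type_homD)
next
  case (pCons a p)
  have c: "h a \<in> carrier R" "h c \<in> carrier R" "hom_eval R h x p \<in> carrier R"
    using assms by (auto simp: type_homD hom_eval_closed)
  show ?case using assms c
    by (simp add: hom_eval_pCons type_homD(5)[OF assms(1)] pCons r_distr m_ac)
qed

lemma hom_eval_mult:
  assumes "type_hom R h" "x \<in> carrier R"
  shows "hom_eval R h x (P * Q) = hom_eval R h x P \<otimes> hom_eval R h x Q"
proof (induct P)
  case 0 then show ?case using assms by (simp add: hom_eval_0 type_homD hom_eval_closed)
next
  case (pCons a p)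
  have c: "h a \<in> carrier R" "hom_eval R h x p \<in> carrier R" "hom_eval R h x Q \<in> carrier R"
    using assms by (auto simp: type_homD hom_eval_closed)
  show ?case using assms c
    by (simp add: hom_eval_pCons hom_eval_add hom_eval_smult type_homD(2)[OF assms(1)] pCons l_distr m_assoc)
qed

lemma hom_eval_const: "type_hom R h \<Longrightarrow> x \<in> carrier R \<Longrightarrow> hom_eval R h x [:c:] = h c"
  by (simp add: hom_eval_pCons hom_eval_0 type_homD)

lemma hom_eval_hom:
  assumes "type_hom R h" "x \<in> carrier R"
  shows "type_hom R (hom_eval R h x)"
proof -
  have "hom_eval R h x 1 = \<one>"
    using hom_eval_const[OF assms, of 1] assms by (simp add: one_pCons type_homD)
  then show ?thesis
    unfolding type_hom_def using assms by (auto simp: hom_eval_closed hom_eval_0 hom_eval_add hom_eval_mult)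
qed

lemma hom_eval_X: "type_hom R h \<Longrightarrow> x \<in> carrier R \<Longrightarrow> hom_eval R h x [:0,1:] = x"
  by (simp add: hom_eval_pCons hom_eval_0 type_homD)

end

text \<open>Applied to a power of Frobenius, which fixes the image of the integers, this compares
  the values of one integer polynomial at an element and at a power of it.\<close>

lemma (in ring_hom_cring) hom_eval_image:
  assumes "type_hom R k" "x \<in> carrier R"
  shows "h (hom_eval R k x P) = hom_eval S (h \<circ> k) (h x) P"
proof -
  have t: "type_hom S (h \<circ> k)"
    using assms(1) by (auto simp: type_hom_def)
  show ?thesis
  proof (induct P)
    case 0 show ?case unfolding R.hom_eval_0[OF assms(1)] S.hom_eval_0[OF t] by simp
  next
    case (pCons a p)
    have "hom_eval R k x p \<in> carrier R" "k a \<in> carrier R"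
      using assms by (auto simp: R.hom_eval_closed type_homD)
    then show ?case
      unfolding R.hom_eval_pCons[OF assms] S.hom_eval_pCons[OF t hom_closed[OF assms(2)]] pCons(2)[symmetric]
      using assms by simp
  qed
qed

text \<open>Carries the hypothesis on the characteristic along homomorphisms, and back along
  injective ones.\<close>

lemma (in ring_hom_cring) hom_int_emb: "h (int_emb R k) = int_emb S k"
proof -
  have n: "h ([n] \<cdot>\<^bsub>R\<^esub> \<one>\<^bsub>R\<^esub>) = [n] \<cdot>\<^bsub>S\<^esub> \<one>\<^bsub>S\<^esub>" for n::nat
    by (induct n) auto
  show ?thesis
    by (cases "k \<ge> 0") (auto simp: int_emb_def add_pow_int_ge add_pow_int_lt n)
qed

section \<open>Additivity of Frobenius in characteristic p\<close>

text \<open>The inner binomial coefficients are divisible by \<open>p\<close>. The quotient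
  \<open>Q\<close> is an element of the same ring, so the identity survives any homomorphism out of
  that ring.\<close>

lemma prime_power_binomial:
  fixes a b :: "'a::comm_ring_1"
  assumes "Factorial_Ring.prime p"
  shows "\<exists>Q. (a + b) ^ p = a ^ p + b ^ p + of_nat p * Q"
proof -
  have p: "p > 0" using assms prime_gt_0_nat by blast
  have "(a + b) ^ p = (\<Sum>k\<le>p. of_nat (p choose k) * a ^ k * b ^ (p - k))"
    by (rule binomial_ring)
  also have "{..p} = insert 0 (insert p {0<..<p})" using p by auto
  also have "(\<Sum>k\<in>insert 0 (insert p {0<..<p}). of_nat (p choose k) * a ^ k * b ^ (p - k))
    = b ^ p + a ^ p + (\<Sum>k\<in>{0<..<p}. of_nat (p choose k) * a ^ k * b ^ (p - k))"
    using p by (simp add: add.assoc)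
  also have "(\<Sum>k\<in>{0<..<p}. of_nat (p choose k) * a ^ k * b ^ (p - k))
     = (\<Sum>k\<in>{0<..<p}. of_nat p * (of_nat ((p choose k) div p) * a ^ k * b ^ (p - k)))"
  proof (rule sum.cong)
    fix k assume k: "k \<in> {0<..<p}"
    then have "p dvd (p choose k)" using assms by (intro dvd_choose_prime) auto
    then have "(of_nat (p choose k) :: 'a) = of_nat p * of_nat ((p choose k) div p)"
      by (metis dvd_mult_div_cancel of_nat_mult)
    then show "of_nat (p choose k) * a ^ k * b ^ (p - k) = of_nat p * (of_nat ((p choose k) div p) * a ^ k * b ^ (p - k))"
      by (simp add: mult.assoc)
  qed simp
  finally show ?thesis by (auto simp: sum_distrib_left[symmetric] add.commute)
qed

text \<open>The identity holds modulo \<open>p\<close> in \<open>\<int>[X][Y]\<close> and is transported by two evaluations.\<close>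

lemma (in cring) frobenius_add:
  assumes p: "Factorial_Ring.prime p" and ch: "int_emb R (int p) = \<zero>"
    and xy: "x \<in> carrier R" "y \<in> carrier R"
  shows "(x \<oplus> y) [^] p = x [^] p \<oplus> y [^] p"
proof -
  let ?h = "hom_eval R (int_emb R) x"
  let ?g = "hom_eval R ?h y"
  have h: "type_hom R ?h" using int_emb_hom xy by (simp add: hom_eval_hom)
  have g: "type_hom R ?g" using h xy by (simp add: hom_eval_hom)
  define A :: "int poly poly" where "A = [:[:0,1:]:]"
  define B :: "int poly poly" where "B = [:0,1:]"
  have A: "?g A = x" unfolding A_def using h xy int_emb_hom by (simp add: hom_eval_const hom_eval_X)
  have B: "?g B = y" unfolding B_def using h xy by (simp add: hom_eval_X)
  obtain Q where Q: "(A + B) ^ p = A ^ p + B ^ p + of_nat p * Q"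
    using prime_power_binomial[OF p] by blast
  have "of_nat p = [:[:int p:]:]"
    by (metis of_nat_poly of_nat_id)
  then have P: "?g (of_nat p) = \<zero>"
    using h xy int_emb_hom ch by (simp add: hom_eval_const)
  have "(x \<oplus> y) [^] p = ?g ((A + B) ^ p)"
    using g by (simp add: type_hom_power type_homD(4)[OF g] A B)
  also have "\<dots> = x [^] p \<oplus> y [^] p"
    unfolding Q using g xy by (simp add: type_hom_power type_homD(4,5)[OF g] A B P type_homD(1)[OF g])
  finally show ?thesis .
qed

lemma (in cring) frobenius_pow_add:
  assumes p: "Factorial_Ring.prime p" and ch: "int_emb R (int p) = \<zero>"
    and xy: "x \<in> carrier R" "y \<in> carrier R"
  shows "(x \<oplus> y) [^] (p ^ k) = x [^] (p ^ k) \<oplus> y [^] (p ^ k)"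
proof (induct k)
  case 0 then show ?case using xy by simp
next
  case (Suc k)
  have e: "z [^] (p ^ Suc k) = (z [^] (p ^ k)) [^] p" if "z \<in> carrier R" for z
    using that by (simp add: nat_pow_pow mult.commute)
  show ?case unfolding e[OF xy(1)] e[OF xy(2)] e[OF a_closed[OF xy]] Suc
    using xy by (simp add: frobenius_add[OF p ch])
qed

text \<open>Additivity of the power map, applied to \<open>\<ominus> x\<close> and \<open>x\<close>,
  settles all primes at once, with no separate case for \<open>p = 2\<close>.\<close>

lemma (in cring) frobenius_pow_minus:
  assumes p: "Factorial_Ring.prime p" and ch: "int_emb R (int p) = \<zero>"
    and x: "x \<in> carrier R"
  shows "(\<ominus> x) [^] (p ^ k) = \<ominus> (x [^] (p ^ k))"
proof -
  have "p ^ k > 0" using p prime_gt_0_nat by simp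
  then have "\<zero> [^] (p ^ k) = \<zero>" by (simp add: nat_pow_zero)
  then have "(\<ominus> x) [^] (p ^ k) \<oplus> x [^] (p ^ k) = \<zero>"
    using frobenius_pow_add[OF p ch, of "\<ominus> x" x k] x by (simp add: l_neg)
  then show ?thesis using x by (simp add: minus_equality)
qed

section \<open>Finite fields\<close>

lemma ring_hom_cring_of_hom:
  "cring R \<Longrightarrow> cring S \<Longrightarrow> h \<in> ring_hom R S \<Longrightarrow> ring_hom_cring R S h"
  by (simp add: ring_hom_cring_def ring_hom_cring_axioms_def)

text \<open>With X^q for \<open>a\<close>, X for \<open>b\<close> and a constant fixed by the q-th
  power for \<open>c\<close>, this identifies Y^q - Y with X^q - X, where Y = X - c.\<close>

lemma (in cring) diff_translate:
  assumes "a \<in> carrier R" "b \<in> carrier R" "c \<in> carrier R"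
  shows "(a \<ominus> c) \<ominus> (b \<oplus> \<ominus> c) = a \<ominus> b"
  using assms by algebra

text \<open>With Y for \<open>a\<close> and Y^r for \<open>b\<close>, this splits off one factor Y
  from Y^(r+2) - Y; the cofactor takes the value -1 wherever Y vanishes.\<close>

lemma (in cring) mult_diff_one:
  assumes "a \<in> carrier R" "b \<in> carrier R"
  shows "a \<otimes> (a \<otimes> b \<ominus> \<one>) = b \<otimes> a \<otimes> a \<ominus> a"
  using assms by algebra

text \<open>With \<open>Y = X - a\<close> for a root \<open>a\<close>, the polynomial \<open>X^q - X\<close> equals \<open>Y^q - Y\<close>, which \<open>Y^2\<close> does not divide:
  all roots are simple.\<close>

lemma (in field) card_frobenius_fixed:
  assumes p: "Factorial_Ring.prime p" and ch: "int_emb R (int p) = \<zero>" and k: "k > 0"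
    and split: "\<And>P. P \<in> carrier (poly_ring R) \<Longrightarrow> splitted P"
  shows "card {x \<in> carrier R. x [^] (p ^ k) = x} = p ^ k"
proof -
  define q where "q = p ^ k"
  have p2: "p \<ge> 2" using p prime_ge_2_nat by blast
  have "p ^ 1 \<le> p ^ k" using p2 k by (intro power_increasing) auto
  then have "q \<ge> 2" using p2 unfolding q_def by simp
  then have "q = Suc (Suc (q - 2))" by linarith
  \<comment> \<open>Writing \<open>q\<close> as \<open>r + 2\<close> exposes the factor of Y^q - Y
    that is cancelled below.\<close>
  then obtain r where r: "q = Suc (Suc r)" ..
  note sub = carrier_is_subring
  interpret UP: domain "poly_ring R"
    using univ_poly_is_domain[OF sub] .
  have C0: "ring_hom_ring R (poly_ring R) poly_of_const"
    using canonical_embedding_ring_hom[OF sub] by simp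
  then have C: "ring_hom_cring R (poly_ring R) poly_of_const"
    using ring_hom_cring_of_hom is_cring UP.is_cring ring_hom_ring.homh by blast
  have chU: "int_emb (poly_ring R) (int p) = \<zero>\<^bsub>poly_ring R\<^esub>"
    unfolding ring_hom_cring.hom_int_emb[OF C, symmetric] ch by (rule ring_hom_cring.hom_zero[OF C])
  have X: "X \<in> carrier (poly_ring R)" using var_closed(1)[OF sub] .
  define P where "P = X [^]\<^bsub>poly_ring R\<^esub> q \<ominus>\<^bsub>poly_ring R\<^esub> X"
  have P: "P \<in> carrier (poly_ring R)" unfolding P_def using X by simp
  have eval_P: "eval P x = x [^] q \<ominus> x" if x: "x \<in> carrier R" for x
  proof -
    note E = eval_cring_hom[OF sub x] and H = eval_is_hom[OF sub x]
    show ?thesis unfolding P_def a_minus_def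
      using X x ring_hom_add[OF H] ring_hom_cring.hom_a_inv[OF E] ring_hom_cring.hom_pow[OF E]
      by (simp add: eval_var)
  qed
  have len: "length P = Suc q"
  proof -
    have 1: "X [^]\<^bsub>poly_ring R\<^esub> q = \<one> # replicate q \<zero>"
      using unitary_monom_eq_var_pow[OF sub, of q] by (simp add: monom_def)
    have 2: "length (\<ominus>\<^bsub>poly_ring R\<^esub> X) = 2"
      using univ_poly_a_inv_length[OF sub X] by (simp add: var_def)
    have "polynomial (carrier R) (X [^]\<^bsub>poly_ring R\<^esub> q)" "polynomial (carrier R) (\<ominus>\<^bsub>poly_ring R\<^esub> X)"
      using X UP.a_inv_closed UP.nat_pow_closed by (auto simp: univ_poly_carrier)
    then have "length (poly_add (X [^]\<^bsub>poly_ring R\<^esub> q) (\<ominus>\<^bsub>poly_ring R\<^esub> X)) = max (Suc q) 2"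
      using poly_add_length_eq[OF sub, of "X [^]\<^bsub>poly_ring R\<^esub> q" "\<ominus>\<^bsub>poly_ring R\<^esub> X"] 1 2 r by simp
    then show ?thesis unfolding P_def a_minus_def using r by (simp add: univ_poly_add)
  qed
  have ne: "P \<noteq> []" using len by auto
  have mult: "alg_mult P a \<le> 1" if a: "a \<in> carrier R" "a [^] q = a" for a
  proof (rule ccontr)
    assume "\<not> alg_mult P a \<le> 1"
    then have "2 \<le> alg_mult P a" by simp
    then have d: "([ \<one>, \<ominus> a ] [^]\<^bsub>poly_ring R\<^esub> (2::nat)) pdivides P"
      using le_alg_mult_imp_pdivides[OF a(1) P] by blast
    define Y where "Y = [ \<one>, \<ominus> a ]"
    define c where "c = poly_of_const a"
    have c: "c \<in> carrier (poly_ring R)" unfolding c_def by (rule ring_hom_closed[OF ring_hom_ring.homh[OF C0] a(1)])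
    have Y: "Y \<in> carrier (poly_ring R)"
      unfolding Y_def using a by (simp add: univ_poly_carrier[symmetric] polynomial_def)
    have "X = Y \<oplus>\<^bsub>poly_ring R\<^esub> c"
      unfolding Y_def c_def var_def univ_poly_add poly_of_const_def using a by (auto simp: l_neg)
    then have XY: "Y = X \<oplus>\<^bsub>poly_ring R\<^esub> (\<ominus>\<^bsub>poly_ring R\<^esub> c)"
      using X Y c by (simp add: UP.a_assoc UP.r_neg)
    have cq: "c [^]\<^bsub>poly_ring R\<^esub> q = c"
      unfolding c_def using ring_hom_cring.hom_pow[OF C a(1), of q] a(2) by simp
    have "Y [^]\<^bsub>poly_ring R\<^esub> q = X [^]\<^bsub>poly_ring R\<^esub> q \<ominus>\<^bsub>poly_ring R\<^esub> c"
      unfolding XY q_def using UP.frobenius_pow_add[OF p chU X, of "\<ominus>\<^bsub>poly_ring R\<^esub> c" k]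
        UP.frobenius_pow_minus[OF p chU c, of k] c cq[unfolded q_def] by (simp add: a_minus_def)
    then have PY: "P = Y [^]\<^bsub>poly_ring R\<^esub> q \<ominus>\<^bsub>poly_ring R\<^esub> Y"
      unfolding P_def using UP.diff_translate[OF UP.nat_pow_closed[OF X, of q] X c] XY by simp
    obtain Z where Z: "Z \<in> carrier (poly_ring R)" "P = (Y [^]\<^bsub>poly_ring R\<^esub> (2::nat)) \<otimes>\<^bsub>poly_ring R\<^esub> Z"
      using d unfolding pdivides_def factor_def Y_def by auto
    note E = eval_cring_hom[OF sub a(1)] and H = eval_is_hom[OF sub a(1)]
    have e0: "eval Y a = \<zero>" unfolding Y_def using a by (simp add: r_neg)
    have Yr: "Y [^]\<^bsub>poly_ring R\<^esub> r \<in> carrier (poly_ring R)" using Y by simp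
    have "Y \<otimes>\<^bsub>poly_ring R\<^esub> (Y \<otimes>\<^bsub>poly_ring R\<^esub> Y [^]\<^bsub>poly_ring R\<^esub> r \<ominus>\<^bsub>poly_ring R\<^esub> \<one>\<^bsub>poly_ring R\<^esub>) = P"
      unfolding PY r using UP.mult_diff_one[OF Y Yr] by simp
    also have "P = Y \<otimes>\<^bsub>poly_ring R\<^esub> (Y \<otimes>\<^bsub>poly_ring R\<^esub> Z)"
      unfolding Z(2) using Y Z(1) by (simp add: numeral_2_eq_2 UP.m_assoc)
    finally have eq: "Y \<otimes>\<^bsub>poly_ring R\<^esub> Y [^]\<^bsub>poly_ring R\<^esub> r \<ominus>\<^bsub>poly_ring R\<^esub> \<one>\<^bsub>poly_ring R\<^esub> = Y \<otimes>\<^bsub>poly_ring R\<^esub> Z"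
    proof (subst (asm) UP.m_lcancel)
      show "Y \<noteq> \<zero>\<^bsub>poly_ring R\<^esub>" by (simp add: Y_def univ_poly_zero)
    qed (use Y Yr Z in auto)
    \<comment> \<open>At the root \<open>a\<close> of \<open>Y\<close> the two sides take the values
      -1 and 0.\<close>
    from arg_cong[OF eq, of "\<lambda>p. eval p a"] show False
      using Y Yr Z(1) e0 a(1) ring_hom_add[OF H] ring_hom_cring.hom_a_inv[OF E]
        ring_hom_mult[OF H] ring_hom_one[OF H] ring_hom_closed[OF H]
      by (simp add: a_minus_def)
  qed
  have root: "set_mset (roots P) = {x \<in> carrier R. x [^] q = x}"
  proof (rule Set.set_eqI)
    fix x show "x \<in># roots P \<longleftrightarrow> x \<in> {x \<in> carrier R. x [^] q = x}"
      unfolding roots_mem_iff_is_root[OF P] is_root_def using ne eval_P by auto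
  qed
  \<comment> \<open>A split polynomial has as many roots, counted with multiplicity, as its degree;
    since all multiplicities are one, the roots are \<open>q\<close> distinct elements.\<close>
  have "size (roots P) = q" using split[OF P] len unfolding splitted_def by simp
  also have "size (roots P) = (\<Sum>x\<in>set_mset (roots P). count (roots P) x)"
    by (rule size_multiset_overloaded_eq)
  also have "\<dots> = (\<Sum>x\<in>set_mset (roots P). 1)"
  proof (rule sum.cong)
    fix x assume x: "x \<in># roots P"
    then have "count (roots P) x > 0" by simp
    moreover have "count (roots P) x \<le> 1"
      using mult[of x] x unfolding alg_mult_eq_count_roots[OF P] root by simp
    ultimately show "count (roots P) x = 1" by linarith
  qed simp
  finally show ?thesis unfolding root q_def by simp
qed

text \<open>The subfield is the fixed field of the \<open>p ^ k\<close>-th power map. It is renamed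
  along a bijection onto an initial segment of the natural numbers, because the factors of the
  ultraproduct are rings on \<open>nat\<close>.\<close>

lemma (in algebraically_closed) finite_subfield_copy:
  assumes p: "Factorial_Ring.prime p" and ch: "int_emb L (int p) = \<zero>" and k: "k > 0"
  shows "\<exists>K :: nat ring. field K \<and> card (carrier K) = p ^ k \<and> int_emb K (int p) = \<zero>\<^bsub>K\<^esub>"
proof -
  define S where "S = {x \<in> carrier L. x [^]\<^bsub>L\<^esub> (p ^ k) = x}"
  have card: "card S = p ^ k" unfolding S_def by (rule card_frobenius_fixed[OF p ch k roots_over_carrier])
  have pk: "p ^ k > 0" using p prime_gt_0_nat by simp
  have sub: "subfield S L"
  proof (rule subfieldI')
    show "subring S L"
      by (rule subringI) (use frobenius_pow_add[OF p ch] frobenius_pow_minus[OF p ch]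
          in \<open>auto simp: S_def nat_pow_distrib\<close>)
  next
    fix x assume x: "x \<in> S - {\<zero>\<^bsub>L\<^esub>}"
    then have u: "x \<in> Units L" using field_Units by (auto simp: S_def)
    have c: "x \<in> carrier L" "inv x \<in> carrier L" "x [^] (p ^ k) = x" "x \<otimes> inv x = \<one>"
      using x u by (auto simp: S_def)
    then have "x \<otimes> (inv x) [^] (p ^ k) = \<one>"
      using nat_pow_distrib[of x "inv x" "p ^ k"] by simp
    then have "inv x = (inv x) [^] (p ^ k)" using c by (intro comm_inv_char) auto
    then show "inv x \<in> S" using c by (simp add: S_def)
  qed
  let ?S = "L\<lparr>carrier := S\<rparr>"
  interpret S: field ?S using subfield_iff(2)[OF sub] .
  obtain f where f: "bij_betw f S {0..<card S}"
    using ex_bij_betw_finite_nat[of S] card pk card_ge_0_finite[of S] by auto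
  then have inj: "inj_on f (carrier ?S)" by (simp add: bij_betw_def)
  let ?K = "image_ring f ?S"
  have fK: "field ?K" using S.inj_imp_image_ring_is_field[OF inj] .
  interpret K: field ?K by fact
  have "f \<in> ring_hom ?S ?K" using inj_imp_image_ring_iso[OF inj] by (simp add: ring_iso_def)
  then interpret F: ring_hom_cring ?S ?K f
    by (intro ring_hom_cring_of_hom S.is_cring K.is_cring)
  interpret I: ring_hom_cring ?S L id
    by (rule ring_hom_cring_of_hom[OF S.is_cring is_cring]) (use subfieldE(3)[OF sub] in \<open>auto simp: ring_hom_def\<close>)
  have "int_emb ?S (int p) = \<zero>\<^bsub>?S\<^esub>" using I.hom_int_emb[of "int p"] ch by simp
  then have "int_emb ?K (int p) = \<zero>\<^bsub>?K\<^esub>"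
    using F.hom_int_emb[of "int p"] F.hom_zero by simp
  moreover have "card (carrier ?K) = p ^ k"
    using card_image[OF inj] card by (simp add: image_ring_carrier)
  ultimately show ?thesis using fK by blast
qed

lemma (in algebraic_closure) is_algebraically_closed: "algebraically_closed L"
  by unfold_locales

text \<open>The ambient algebraically closed field is an algebraic closure of the integers modulo
  \<open>p\<close>.\<close>

lemma finite_field_exists:
  assumes p: "Factorial_Ring.prime p" and k: "k > 0"
  shows "\<exists>K :: nat ring. field K \<and> card (carrier K) = p ^ k \<and> int_emb K (int p) = \<zero>\<^bsub>K\<^esub>"
proof -
  interpret Z: residues_prime p "residue_ring (int p)"
    using p by unfold_locales simp_all
  have chZ: "int_emb (residue_ring (int p)) (int p) = \<zero>\<^bsub>residue_ring (int p)\<^esub>"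
  proof -
    have "[n] \<cdot>\<^bsub>residue_ring (int p)\<^esub> \<one>\<^bsub>residue_ring (int p)\<^esub> = int n mod int p" for n::nat
      by (induct n) (auto simp: Z.res_zero_eq Z.res_one_eq Z.res_add_eq mod_simps add.commute)
    then show ?thesis by (simp add: int_emb_def add_pow_int_ge Z.res_zero_eq)
  qed
  let ?R = "residue_ring (int p)"
  let ?L = "field.alg_closure ?R"
  have L: "algebraic_closure ?L (ring.indexed_const ?R ` carrier ?R)"
    and hom: "ring.indexed_const ?R \<in> ring_hom ?R ?L"
    using field.alg_closureE[OF Z.is_field] by blast+
  have fL: "field ?L" by (rule algebraic_closure.axioms(1)[OF L])
  then have "cring ?L" by (intro domain.axioms(1) field.axioms(1))
  then have H: "ring_hom_cring ?R ?L (ring.indexed_const ?R)"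
    using hom Z.cring by (intro ring_hom_cring_of_hom)
  have "int_emb ?L (int p) = \<zero>\<^bsub>?L\<^esub>"
    unfolding ring_hom_cring.hom_int_emb[OF H, symmetric] chZ
    using ring_hom_cring.hom_zero[OF H] .
  then show ?thesis using algebraically_closed.finite_subfield_copy[OF algebraic_closure.is_algebraically_closed[OF L] p _ k] by blast
qed

section \<open>Generators of finite fields over the prime field\<close>

text \<open>In a field of characteristic \<open>p\<close> this says that no nonzero polynomial of
  degree below \<open>k\<close> over the prime field vanishes at \<open>g\<close>. Integer
  polynomials stand for polynomials over F_p, so that their type does not change with
  \<open>p\<close>; being zero modulo \<open>p\<close> becomes divisibility of all
  coefficients.\<close>

definition generic_elt :: "('b, 'm) ring_scheme \<Rightarrow> nat \<Rightarrow> nat \<Rightarrow> 'b \<Rightarrow> bool" where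
  "generic_elt R p k g \<longleftrightarrow> g \<in> carrier R \<and>
     (\<forall>P :: int poly. Polynomial.degree P < k \<and> hom_eval R (int_emb R) g P = \<zero>\<^bsub>R\<^esub>
        \<longrightarrow> (\<forall>i. int p dvd Polynomial.coeff P i))"

lemma (in cring) hom_eval_cong_mod:
  assumes ch: "int_emb R (int p) = \<zero>" and x: "x \<in> carrier R"
    and d: "\<And>i. int p dvd Polynomial.coeff A i - Polynomial.coeff B i"
  shows "hom_eval R (int_emb R) x A = hom_eval R (int_emb R) x B"
proof -
  have "[:int p:] dvd A - B" using d by (simp add: const_poly_dvd_iff)
  then obtain S where "A - B = [:int p:] * S" by (elim dvdE)
  then have A: "A = B + [:int p:] * S" by (simp add: algebra_simps)
  show ?thesis unfolding A
    using x ch by (simp add: hom_eval_add hom_eval_mult hom_eval_smult hom_eval_closed int_emb_hom)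
qed

text \<open>A generator of the multiplicative group works: a relation of degree \<open>d < k\<close> would bound the number of
  its powers by \<open>p ^ d\<close>.\<close>

lemma (in field) finite_field_generic_elt:
  assumes p: "Factorial_Ring.prime p" and ch: "int_emb R (int p) = \<zero>" and card: "card (carrier R) = p ^ k"
  shows "\<exists>g. generic_elt R p k g"
proof -
  have p0: "p > 1" using p prime_gt_1_nat by blast
  have "card (carrier R) > 0" unfolding card using p0 by simp
  then have fin: "finite (carrier R)" using card_ge_0_finite by blast
  obtain g where g: "g \<in> carrier R - {\<zero>}" "carrier R - {\<zero>} = {g [^] i | i::nat. i \<in> UNIV}"
    using finite_field_mult_group_has_gen[OF fin] by (auto simp: nat_pow_mult_of)
  have gc: "g \<in> carrier R" using g(1) by blast
  let ?ev = "hom_eval R (int_emb R) g"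
  note h = int_emb_hom
  note ev = hom_eval_hom[OF h gc]
  have False if P: "Polynomial.degree P < k" "?ev P = \<zero>" "\<not> int p dvd Polynomial.coeff P i0" for P i0
  proof -
    define D where "D = {i. \<not> int p dvd Polynomial.coeff P i}"
    have "D \<subseteq> {..Polynomial.degree P}"
      by (auto simp: D_def) (metis coeff_eq_0 dvd_0_right not_le)
    then have finD: "finite D" and Dk: "i \<in> D \<Longrightarrow> i < k" for i
      using P(1) by (auto intro: finite_subset)
    \<comment> \<open>The degree of \<open>P\<close> modulo \<open>p\<close>; coefficients of
      \<open>P\<close> above \<open>d\<close> are multiples of \<open>p\<close> but need not be
      zero.\<close>
    define d where "d = Max D"
    have "i0 \<in> D" using P(3) by (simp add: D_def)
    then have dD: "d \<in> D" unfolding d_def using finD by (intro Max_in) auto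
    have above: "int p dvd Polynomial.coeff P i" if "i > d" for i
    proof (rule ccontr)
      assume "\<not> int p dvd Polynomial.coeff P i"
      then have "i \<le> Max D" by (intro Max_ge[OF finD]) (simp add: D_def)
      then show False using that unfolding d_def by simp
    qed
    have "coprime (Polynomial.coeff P d) (int p)"
      using dD prime_imp_coprime[of "int p" "Polynomial.coeff P d"] p by (simp add: D_def coprime_commute)
    then obtain c where c: "[Polynomial.coeff P d * c = 1] (mod int p)"
      using cong_solve_coprime_int by blast
    \<comment> \<open>Since \<open>c\<close> inverts the coefficient at \<open>d\<close> modulo
      \<open>p\<close>, \<open>T\<close> is a monic polynomial of degree \<open>d\<close> congruent
      to \<open>smult c P\<close>.\<close>
    define T where "T = poly_cutoff d (smult c P) + Polynomial.monom 1 d"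
    have Tc: "Polynomial.coeff T i = (if i < d then c * Polynomial.coeff P i else if i = d then 1 else 0)" for i
      unfolding T_def by (simp add: coeff_poly_cutoff)
    have evT: "?ev T = \<zero>"
    proof -
      have "int p dvd Polynomial.coeff T i - Polynomial.coeff (smult c P) i" for i
      proof (cases "i = d")
        case True
        have "int p dvd 1 - Polynomial.coeff P d * c"
          using c by (metis cong_iff_dvd_diff cong_sym)
        then show ?thesis using True by (simp add: Tc mult.commute)
      next
        case False then show ?thesis using above[of i] by (auto simp: Tc)
      qed
      from hom_eval_cong_mod[OF ch gc this] have "?ev T = ?ev (smult c P)" .
      also have "\<dots> = \<zero>" using P(2) by (simp add: hom_eval_smult[OF h gc] type_homD(1)[OF h])
      finally show ?thesis .
    qed
    \<comment> \<open>Division with remainder by the monic \<open>T\<close>: prepending a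
      coefficient to a remainder raises its degree to at most \<open>d\<close>, and a multiple of
      \<open>T\<close> removes the term at \<open>d\<close>.\<close>
    have red: "\<exists>Q'. (\<forall>i\<ge>d. Polynomial.coeff Q' i = 0) \<and> ?ev Q' = ?ev Q" for Q
    proof (induct Q)
      case 0 show ?case by (rule exI[of _ 0]) simp
    next
      case (pCons a Q)
      then obtain Q' where Q': "\<forall>i\<ge>d. Polynomial.coeff Q' i = 0" "?ev Q' = ?ev Q" by blast
      define A where "A = pCons a Q'"
      have A: "Polynomial.coeff A i = 0" if "i > d" for i
        using that Q'(1) unfolding A_def by (cases i) auto
      have eA: "?ev A = ?ev (pCons a Q)" unfolding A_def by (simp add: hom_eval_pCons[OF h gc] Q')
      let ?Q = "A + smult (- Polynomial.coeff A d) T"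
      have "\<forall>i\<ge>d. Polynomial.coeff ?Q i = 0"
        using A by (auto simp: Tc)
      moreover have "?ev ?Q = ?ev A"
        using evT by (simp only: hom_eval_add[OF h gc] hom_eval_smult[OF h gc]) (simp add: type_homD(1)[OF h] hom_eval_closed[OF h gc])
      ultimately show ?case using eA by metis
    qed
    \<comment> \<open>The reduced representatives of the polynomials of degree below
      \<open>d\<close> over F_p; there are at most \<open>p ^ d\<close> of them.\<close>
    define W where "W = {Q :: int poly. (\<forall>i. Polynomial.coeff Q i \<in> {0..<int p}) \<and> (\<forall>i\<ge>d. Polynomial.coeff Q i = 0)}"
    have inW: "?ev Q \<in> ?ev ` W" for Q
    proof -
      obtain Q' where Q': "\<forall>i\<ge>d. Polynomial.coeff Q' i = 0" "?ev Q' = ?ev Q" using red by blast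
      define B where "B = map_poly (\<lambda>c. c mod int p) Q'"
      have B: "Polynomial.coeff B i = Polynomial.coeff Q' i mod int p" for i
        unfolding B_def by (simp add: coeff_map_poly)
      have "B \<in> W" using Q'(1) p0 by (auto simp: W_def B)
      moreover have "?ev B = ?ev Q'" by (rule hom_eval_cong_mod[OF ch gc]) (simp add: B mod_eq_dvd_iff[symmetric])
      ultimately show ?thesis using Q'(2) by (metis imageI)
    qed
    have "carrier R \<subseteq> ?ev ` W"
    proof (rule subsetI)
      fix x assume x: "x \<in> carrier R"
      show "x \<in> ?ev ` W"
      proof (cases "x = \<zero>")
        case True then show ?thesis using inW[of 0] by (simp add: type_homD(2)[OF ev])
      next
        case False
        then obtain i :: nat where "x = g [^] i" using g(2) x by blast
        also have "\<dots> = ?ev ([:0,1:] ^ i)" by (simp only: type_hom_power[OF ev] hom_eval_X[OF h gc])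
        finally have "x = ?ev ([:0,1:] ^ i)" .
        then show ?thesis using inW[of "[:0,1:] ^ i"] by simp
      qed
    qed
    then have sub: "carrier R \<subseteq> ?ev ` W" .
    have W: "finite W \<and> card W \<le> p ^ d"
    proof -
      let ?f = "\<lambda>Q :: int poly. restrict (Polynomial.coeff Q) {..<d}"
      have inj: "inj_on ?f W"
      proof (rule inj_onI)
        fix A B assume AB: "A \<in> W" "B \<in> W" "?f A = ?f B"
        show "A = B"
        proof (rule poly_eqI)
          fix i show "Polynomial.coeff A i = Polynomial.coeff B i"
            using AB(1,2) arg_cong[OF AB(3), of "\<lambda>f. f i"] by (cases "i < d") (simp_all add: W_def)
        qed
      qed
      have sub: "?f ` W \<subseteq> PiE {..<d} (\<lambda>_. {0..<int p})"
        by (intro image_subsetI restrict_PiE_iff[THEN iffD2]) (simp add: W_def)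
      have fin: "finite (PiE {..<d} (\<lambda>_. {0..<int p}))" by (intro finite_PiE) auto
      have "card (PiE {..<d} (\<lambda>_. {0..<int p})) = p ^ d" by (simp add: card_PiE)
      then show ?thesis using inj sub fin card_inj_on_le[OF inj sub fin] inj_on_finite[OF inj sub fin] by simp
    qed
    have "card (carrier R) \<le> card (?ev ` W)" using W sub by (intro card_mono) auto
    also have "\<dots> \<le> card W" using W by (intro card_image_le) auto
    also have "\<dots> \<le> p ^ d" using W by simp
    finally have "card (carrier R) \<le> p ^ d" .
    then have "k \<le> d" unfolding card by (rule power_le_imp_le_exp[OF p0])
    then show False using Dk[OF dD] by simp
  qed
  then have "generic_elt R p k g" using gc unfolding generic_elt_def by blast
  then show ?thesis ..
qed

section \<open>Algebraic dependence of fractions\<close>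

text \<open>The same generator may be used repeatedly, so closure under sums and products follows by
  rule induction, without collecting coefficients.\<close>

inductive_set lin_span :: "('b, 'm) ring_scheme \<Rightarrow> 'b set \<Rightarrow> 'b set \<Rightarrow> 'b set"
  for R E G where
  zero: "\<zero>\<^bsub>R\<^esub> \<in> lin_span R E G"
| step: "c \<in> E \<Longrightarrow> g \<in> G \<Longrightarrow> v \<in> lin_span R E G \<Longrightarrow> c \<otimes>\<^bsub>R\<^esub> g \<oplus>\<^bsub>R\<^esub> v \<in> lin_span R E G"

text \<open>The fractions over \<open>A\<close>, formed inside the field \<open>R\<close>. Clearing
  the denominator by a multiplication keeps inverses out of the definition.\<close>

definition frac_ring :: "('b, 'm) ring_scheme \<Rightarrow> 'b set \<Rightarrow> 'b set" where
  "frac_ring R A = {y \<in> carrier R. \<exists>q\<in>A. q \<noteq> \<zero>\<^bsub>R\<^esub> \<and> q \<otimes>\<^bsub>R\<^esub> y \<in> A}"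

lemma lin_span_mono: "G \<subseteq> H \<Longrightarrow> lin_span R E G \<subseteq> lin_span R E H"
proof
  fix x assume "G \<subseteq> H" "x \<in> lin_span R E G"
  from this(2,1) show "x \<in> lin_span R E H" by induct (auto intro: lin_span.intros)
qed

context field begin

lemma lin_span_closed:
  assumes "E \<subseteq> carrier R" "G \<subseteq> carrier R" "v \<in> lin_span R E G"
  shows "v \<in> carrier R"
  using assms(3) by induct (use assms in auto)

lemma lin_span_add:
  assumes E: "E \<subseteq> carrier R" "G \<subseteq> carrier R" and "u \<in> lin_span R E G" and v: "v \<in> lin_span R E G"
  shows "u \<oplus> v \<in> lin_span R E G"
  using assms(3)
proof induct
  case zero then show ?case using v lin_span_closed[OF E v] by simp
next
  case (step c g w)
  have "c \<otimes> g \<oplus> w \<oplus> v = c \<otimes> g \<oplus> (w \<oplus> v)"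
    using step E v lin_span_closed[OF E] by (intro a_assoc) auto
  then show ?case using step lin_span.step by metis
qed

lemma lin_span_smult:
  assumes E: "subring E R" "G \<subseteq> carrier R" and c: "c \<in> E" and "v \<in> lin_span R E G"
  shows "c \<otimes> v \<in> lin_span R E G"
  using assms(4)
proof induct
  case zero show ?case using c subringE(1)[OF E(1)] by (simp add: subset_iff lin_span.zero)
next
  case (step d g w)
  have "c \<otimes> (d \<otimes> g \<oplus> w) = (c \<otimes> d) \<otimes> g \<oplus> c \<otimes> w"
    using step E c subringE(1)[OF E(1)] lin_span_closed[OF subringE(1)[OF E(1)] E(2) step(3)]
    by (simp add: r_distr subset_iff m_assoc)
  then show ?case using step subringE(6)[OF E(1) c step(1)] lin_span.step by metis
qed

lemma lin_span_incl:
  assumes E: "subring E R" "G \<subseteq> carrier R" and "g \<in> G"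
  shows "g \<in> lin_span R E G"
proof -
  have "g \<in> carrier R" using assms by auto
  moreover have "\<one> \<otimes> g \<oplus> \<zero> \<in> lin_span R E G"
    using assms subringE(3)[OF E(1)] by (intro lin_span.intros)
  ultimately show ?thesis by simp
qed

text \<open>By bilinearity only products of generators have to be examined. For spans of monomials
  these are monomials with added exponents.\<close>

lemma lin_span_mult:
  assumes E: "subring E R" and G: "G \<subseteq> carrier R" "H \<subseteq> carrier R" "K \<subseteq> carrier R"
    and GH: "\<And>g h. g \<in> G \<Longrightarrow> h \<in> H \<Longrightarrow> g \<otimes> h \<in> lin_span R E K"
    and u: "u \<in> lin_span R E G" and v: "v \<in> lin_span R E H"
  shows "u \<otimes> v \<in> lin_span R E K"
proof -
  note Ec = subringE(1)[OF E]
  have gv: "g \<otimes> v \<in> lin_span R E K" if g: "g \<in> G" for g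
    using v
  proof induct
    case zero show ?case using g G by (simp add: subset_iff lin_span.zero)
  next
    case (step d h w)
    have "g \<otimes> (d \<otimes> h \<oplus> w) = d \<otimes> (g \<otimes> h) \<oplus> g \<otimes> w"
      using step G g Ec lin_span_closed[OF Ec G(2) step(3)] by (simp add: r_distr subset_iff m_lcomm)
    then show ?case
      using lin_span_add[OF Ec G(3)] lin_span_smult[OF E G(3) step(1) GH[OF g step(2)]] step by simp
  qed
  have vc: "v \<in> carrier R" by (rule lin_span_closed[OF Ec G(2) v])
  show ?thesis using u
  proof induct
    case zero show ?case using vc by (auto intro: lin_span.zero)
  next
    case (step d g w)
    have "(d \<otimes> g \<oplus> w) \<otimes> v = d \<otimes> (g \<otimes> v) \<oplus> w \<otimes> v"
      using step G vc Ec lin_span_closed[OF Ec G(1) step(3)] by (simp add: l_distr subset_iff m_assoc)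
    then show ?case
      using lin_span_add[OF Ec G(3)] lin_span_smult[OF E G(3) step(1) gv[OF step(2)]] step by simp
  qed
qed

lemma lin_span_insertE:
  assumes E: "subring E R" "insert g G \<subseteq> carrier R" and "v \<in> lin_span R E (insert g G)"
  shows "\<exists>c\<in>E. \<exists>w\<in>lin_span R E G. v = c \<otimes> g \<oplus> w"
  using assms(3)
proof induct
  case zero
  have "\<zero> = \<zero> \<otimes> g \<oplus> \<zero>" using E by simp
  then show ?case using subringE(2)[OF E(1)] lin_span.zero by metis
next
  case (step d h v)
  note Ec = subringE(1)[OF E(1)]
  from step obtain c w where cw: "c \<in> E" "w \<in> lin_span R E G" "v = c \<otimes> g \<oplus> w" by blast
  have wc: "w \<in> carrier R" using lin_span_closed[OF Ec _ cw(2)] E by auto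
  have gc: "g \<in> carrier R" "h \<in> carrier R" "c \<in> carrier R" "d \<in> carrier R" using E step cw Ec by auto
  show ?case
  proof (cases "h = g")
    case True
    have "d \<otimes> h \<oplus> v = (d \<oplus> c) \<otimes> g \<oplus> w"
      unfolding True cw(3) using gc wc by algebra
    then show ?thesis using subringE(7)[OF E(1) step(1) cw(1)] cw(2) by blast
  next
    case False
    then have "d \<otimes> h \<oplus> w \<in> lin_span R E G" using step(1,2) cw(2) by (intro lin_span.step) auto
    moreover have "d \<otimes> h \<oplus> v = c \<otimes> g \<oplus> (d \<otimes> h \<oplus> w)"
      unfolding cw(3) using gc wc by algebra
    ultimately show ?thesis using cw(1) by blast
  qed
qed

lemma finsum_mult_add:
  assumes "finite J" "l \<in> J \<rightarrow> carrier R" "a \<in> J \<rightarrow> carrier R" "b \<in> J \<rightarrow> carrier R"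
  shows "(\<Oplus>j\<in>J. l j \<otimes> (a j \<oplus> b j)) = (\<Oplus>j\<in>J. l j \<otimes> a j) \<oplus> (\<Oplus>j\<in>J. l j \<otimes> b j)"
proof -
  have "(\<Oplus>j\<in>J. l j \<otimes> (a j \<oplus> b j)) = (\<Oplus>j\<in>J. l j \<otimes> a j \<oplus> l j \<otimes> b j)"
    using assms by (intro finsum_cong') (auto simp: r_distr Pi_iff)
  also have "\<dots> = (\<Oplus>j\<in>J. l j \<otimes> a j) \<oplus> (\<Oplus>j\<in>J. l j \<otimes> b j)"
    using assms by (intro finsum_addf) auto
  finally show ?thesis .
qed

text \<open>Gaussian elimination by induction on the generators. The vectors form an indexed family
  and not a set, because different exponents may yield the same vector.\<close>

lemma lin_span_dependent:
  assumes E: "subfield E R" and "finite G" "G \<subseteq> carrier R" "finite J" "card G < card J"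
    and "v \<in> J \<rightarrow> lin_span R E G"
  shows "\<exists>l. l \<in> J \<rightarrow> E \<and> (\<exists>j\<in>J. l j \<noteq> \<zero>) \<and> (\<Oplus>j\<in>J. l j \<otimes> v j) = \<zero>"
  using assms(2-)
proof (induct G arbitrary: J v rule: finite_induct)
  case empty
  have Er: "subring E R" using subfieldE(1)[OF E] .
  have z: "v j = \<zero>" if "j \<in> J" for j
    using empty(4) that by (auto simp: Pi_iff elim: lin_span.cases)
  have "(\<Oplus>j\<in>J. \<one> \<otimes> v j) = (\<Oplus>j\<in>J. \<zero>)" using z by (intro finsum_cong') auto
  then have "(\<Oplus>j\<in>J. \<one> \<otimes> v j) = \<zero>" by simp
  moreover have "\<exists>j\<in>J. \<one> \<noteq> \<zero>" using empty(3) by (metis card.empty ex_in_conv less_irrefl one_not_zero)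
  ultimately show ?case using subringE(3)[OF Er] by (intro exI[of _ "\<lambda>_. \<one>"]) auto
next
  case (insert g G)
  have Er: "subring E R" using subfieldE(1)[OF E] .
  note Ec = subringE(1)[OF Er]
  have gG: "g \<in> carrier R" "G \<subseteq> carrier R" using insert by auto
  have "\<forall>j\<in>J. \<exists>c w. c \<in> E \<and> w \<in> lin_span R E G \<and> v j = c \<otimes> g \<oplus> w"
  proof
    fix j assume "j \<in> J"
    then have "v j \<in> lin_span R E (insert g G)" using insert(7) by auto
    from lin_span_insertE[OF Er insert(4) this]
    show "\<exists>c w. c \<in> E \<and> w \<in> lin_span R E G \<and> v j = c \<otimes> g \<oplus> w" by blast
  qed
  from bchoice[OF this] obtain c where "\<forall>j\<in>J. \<exists>w. c j \<in> E \<and> w \<in> lin_span R E G \<and> v j = c j \<otimes> g \<oplus> w" by blast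
  from bchoice[OF this] obtain w where cw: "\<And>j. j \<in> J \<Longrightarrow> c j \<in> E \<and> w j \<in> lin_span R E G \<and> v j = c j \<otimes> g \<oplus> w j" by blast
  show ?case
  proof (cases "\<forall>j\<in>J. c j = \<zero>")
    case True
    have "v \<in> J \<rightarrow> lin_span R E G"
    proof
      fix j assume j: "j \<in> J"
      then have "v j = w j" using cw[OF j] True gG lin_span_closed[OF Ec gG(2)] by auto
      then show "v j \<in> lin_span R E G" using cw[OF j] by simp
    qed
    moreover have "card G < card J" using insert(1,2,6) by simp
    ultimately show ?thesis using insert(3)[OF gG(2) insert(5)] by blast
  next
    case False
    \<comment> \<open>The vector \<open>v i\<close> serves as pivot for the generator
      \<open>g\<close>.\<close>
    then obtain i where i: "i \<in> J" "c i \<noteq> \<zero>" by blast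
    define J' where "J' = J - {i}"
    have J: "J = insert i J'" "i \<notin> J'" "finite J'" using i insert(5) by (auto simp: J'_def)
    have ciE: "c i \<in> E - {\<zero>}" using cw i by blast
    have inv: "inv (c i) \<in> E" "inv (c i) \<otimes> c i = \<one>"
      using subfield_m_inv[OF E ciE] by auto
    define r where "r j = c j \<otimes> inv (c i)" for j
    have r: "r j \<in> E" if "j \<in> J'" for j
      unfolding r_def using cw that inv(1) subringE(6)[OF Er] J(1) by auto
    \<comment> \<open>Subtracting this multiple of the pivot cancels the component along
      \<open>g\<close>.\<close>
    define v' where "v' j = v j \<oplus> (\<ominus> r j) \<otimes> v i" for j
    have cl: "v i \<in> carrier R" "w i \<in> carrier R" "c i \<in> carrier R" "inv (c i) \<in> carrier R"
      using cw[OF i(1)] lin_span_closed[OF Ec gG(2)] gG Ec inv by auto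
    have clj: "v j \<in> carrier R" "w j \<in> carrier R" "c j \<in> carrier R" "r j \<in> carrier R" if "j \<in> J'" for j
      using cw[of j] that J lin_span_closed[OF Ec gG(2)] gG Ec r[OF that] by auto
    have v'c: "v' j \<in> lin_span R E G" if j: "j \<in> J'" for j
    proof -
      have rc: "r j \<otimes> c i = c j"
        unfolding r_def using clj[OF j] cl inv(2) by (simp add: m_assoc)
      have "v' j = c j \<otimes> g \<oplus> w j \<oplus> (\<ominus> r j) \<otimes> (c i \<otimes> g \<oplus> w i)"
        unfolding v'_def using cw i j J by simp
      also have "\<dots> = c j \<otimes> g \<oplus> w j \<oplus> (\<ominus> ((r j \<otimes> c i) \<otimes> g)) \<oplus> (\<ominus> r j) \<otimes> w i"
        using clj[OF j] cl gG by algebra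
      also have "\<dots> = w j \<oplus> (\<ominus> r j) \<otimes> w i"
        unfolding rc using clj[OF j] cl gG by algebra
      finally have "v' j = w j \<oplus> (\<ominus> r j) \<otimes> w i" .
      moreover have "(\<ominus> r j) \<otimes> w i \<in> lin_span R E G"
        using lin_span_smult[OF Er gG(2) subringE(5)[OF Er r[OF j]]] cw[OF i(1)] by blast
      ultimately show ?thesis using lin_span_add[OF Ec gG(2)] cw[of j] j J by simp
    qed
    have "card G < card J'" using insert(1,2,6) J by simp
    then obtain l where l: "l \<in> J' \<rightarrow> E" "\<exists>j\<in>J'. l j \<noteq> \<zero>" "(\<Oplus>j\<in>J'. l j \<otimes> v' j) = \<zero>"
      using insert(3)[OF gG(2) J(3), of v'] v'c by blast
    \<comment> \<open>The coefficient that falls to the pivot when a relation among the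
      \<open>v' j\<close> is rewritten in terms of the \<open>v j\<close>.\<close>
    define s where "s = (\<Oplus>j\<in>J'. l j \<otimes> (\<ominus> r j))"
    have lc: "l \<in> J' \<rightarrow> carrier R" using l Ec by auto
    have rc: "(\<lambda>j. \<ominus> r j) \<in> J' \<rightarrow> carrier R" using clj by auto
    have vc: "v \<in> J' \<rightarrow> carrier R" using clj by auto
    have lrc: "(\<lambda>j. l j \<otimes> \<ominus> r j) \<in> J' \<rightarrow> carrier R" using lc rc by auto
    have sE: "finite K \<Longrightarrow> K \<subseteq> J' \<Longrightarrow> (\<Oplus>j\<in>K. l j \<otimes> (\<ominus> r j)) \<in> E" for K
    proof (induct K rule: finite_induct)
      case empty then show ?case using subringE(2)[OF Er] by simp
    next
      case (insert x K)
      have "l x \<otimes> (\<ominus> r x) \<in> E" using insert(4) Pi_mem[OF l(1)] r subringE(5,6)[OF Er] by auto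
      moreover have "(\<lambda>j. l j \<otimes> \<ominus> r j) \<in> K \<rightarrow> carrier R" "l x \<otimes> \<ominus> r x \<in> carrier R" using lrc insert by auto
      ultimately show ?case using insert subringE(7)[OF Er] by simp
    qed
    have "(\<Oplus>j\<in>J'. l j \<otimes> v' j) = (\<Oplus>j\<in>J'. l j \<otimes> v j) \<oplus> (\<Oplus>j\<in>J'. l j \<otimes> (\<ominus> r j \<otimes> v i))"
      unfolding v'_def using J(3) lc vc rc cl by (intro finsum_mult_add) auto
    also have "(\<Oplus>j\<in>J'. l j \<otimes> (\<ominus> r j \<otimes> v i)) = (\<Oplus>j\<in>J'. l j \<otimes> (\<ominus> r j) \<otimes> v i)"
      using lc rc cl by (intro finsum_cong') (auto simp: m_assoc Pi_iff)
    also have "\<dots> = s \<otimes> v i"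
      unfolding s_def using J(3) lrc cl by (intro finsum_ldistr[symmetric]) auto
    finally have eq: "(\<Oplus>j\<in>J'. l j \<otimes> v j) \<oplus> s \<otimes> v i = \<zero>" using l(3) by simp
    define m where "m = l(i := s)"
    have mJ': "(\<Oplus>j\<in>J'. m j \<otimes> v j) = (\<Oplus>j\<in>J'. l j \<otimes> v j)"
      using J(2) lc vc by (intro finsum_cong') (auto simp: m_def)
    have sE': "s \<in> E" unfolding s_def using sE[OF J(3)] by simp
    have "(\<Oplus>j\<in>J. m j \<otimes> v j) = m i \<otimes> v i \<oplus> (\<Oplus>j\<in>J'. m j \<otimes> v j)"
      unfolding J(1) using J(2,3) lc vc cl sE' Ec by (intro finsum_insert) (auto simp: m_def Pi_iff)
    also have "\<dots> = \<zero>"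
    proof -
      have "(\<Oplus>j\<in>J'. l j \<otimes> v j) \<in> carrier R" using lc vc by (intro finsum_closed) auto
      moreover have "s \<in> carrier R" using sE' Ec by blast
      ultimately show ?thesis unfolding mJ' using eq cl(1) by (simp add: m_def a_comm)
    qed
    finally have "(\<Oplus>j\<in>J. m j \<otimes> v j) = \<zero>" .
    moreover have "m \<in> J \<rightarrow> E" using l(1) sE' by (auto simp: m_def J(1))
    moreover have "\<exists>j\<in>J. m j \<noteq> \<zero>" using l(2) J by (auto simp: m_def)
    ultimately show ?thesis by blast
  qed
qed

section \<open>Monomials and polynomial values of bounded degree\<close>

text \<open>The predicate may depend on the number of factors multiplied so far, as needed when
  degree bounds add up along a product.\<close>

lemma finprod_nat_mem:
  assumes "\<And>i. i < n \<Longrightarrow> f i \<in> carrier R" and "P 0 \<one>"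
    and "\<And>i x. i < n \<Longrightarrow> x \<in> carrier R \<Longrightarrow> P i x \<Longrightarrow> P (Suc i) (f i \<otimes> x)"
  shows "P n (finprod R f {..<n})"
  using assms
proof (induct n)
  case 0 then show ?case by simp
next
  case (Suc n)
  have "P n (finprod R f {..<n})" using Suc by auto
  moreover have "finprod R f {..<Suc n} = f n \<otimes> finprod R f {..<n}"
    using Suc(2) by (simp add: lessThan_Suc Pi_iff)
  moreover have "finprod R f {..<n} \<in> carrier R" using Suc(2) by (auto intro: finprod_closed)
  ultimately show ?case using Suc(4)[of n] by simp
qed

lemma monomial_closed: "set xs \<subseteq> carrier R \<Longrightarrow> monomial R \<alpha> xs \<in> carrier R"
  unfolding monomial_def by (intro finprod_closed) (auto simp: subset_iff)

lemma monomial_mult: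
  assumes "set xs \<subseteq> carrier R" "length \<alpha> = length xs" "length \<beta> = length xs"
  shows "monomial R \<alpha> xs \<otimes> monomial R \<beta> xs = monomial R (map2 (+) \<alpha> \<beta>) xs"
proof -
  have "monomial R \<alpha> xs \<otimes> monomial R \<beta> xs = finprod R (\<lambda>i. xs ! i [^] (\<alpha> ! i) \<otimes> xs ! i [^] (\<beta> ! i)) {..<length xs}"
    unfolding monomial_def using assms(1) by (intro finprod_multf[symmetric]) (auto simp: subset_iff)
  also have "\<dots> = monomial R (map2 (+) \<alpha> \<beta>) xs"
    unfolding monomial_def using assms by (intro finprod_cong') (auto simp: subset_iff nat_pow_mult)
  finally show ?thesis .
qed

lemma monomial_zero:
  assumes "set xs \<subseteq> carrier R" shows "monomial R (replicate (length xs) 0) xs = \<one>"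
  unfolding monomial_def by (intro finprod_one_eqI) simp

lemma monomial_unit:
  assumes "set xs \<subseteq> carrier R" "i < length xs"
  shows "monomial R ((replicate (length xs) 0)[i := 1]) xs = xs ! i"
proof -
  have "monomial R ((replicate (length xs) 0)[i := 1]) xs = finprod R (\<lambda>j. if i = j then xs ! j else \<one>) {..<length xs}"
    unfolding monomial_def using assms by (intro finprod_cong') (auto simp: subset_iff nth_list_update)
  also have "\<dots> = xs ! i" using assms by (intro finprod_singleton) (auto simp: subset_iff)
  finally show ?thesis .
qed

end

text \<open>Bounding each exponent separately, and not the total degree, makes the number of
  exponent vectors the plain power \<open>(d + 1) ^ n\<close>.\<close>

definition bounded_exps :: "nat \<Rightarrow> nat \<Rightarrow> nat list set" where
  "bounded_exps n d = {\<alpha>. set \<alpha> \<subseteq> {..d} \<and> length \<alpha> = n}"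

lemma finite_bounded_exps: "finite (bounded_exps n d)"
  and card_bounded_exps: "card (bounded_exps n d) = (d + 1) ^ n"
  unfolding bounded_exps_def by (simp_all add: finite_lists_length_eq card_lists_length_eq)

definition poly_span :: "('b, 'm) ring_scheme \<Rightarrow> 'b set \<Rightarrow> 'b list \<Rightarrow> nat \<Rightarrow> 'b set" where
  "poly_span R E xs d = lin_span R E ((\<lambda>\<alpha>. monomial R \<alpha> xs) ` bounded_exps (length xs) d)"

lemma (in domain) nat_pow_eq_zero_imp:
  "x \<in> carrier R \<Longrightarrow> x [^] (n::nat) = \<zero> \<Longrightarrow> x = \<zero>"
  by (induct n) (auto simp: integral_iff)

text \<open>The product of the individual denominators works, and it is nonzero in a domain.\<close>

lemma (in domain) common_denominator:
  assumes A: "subring A R" and "set ys \<subseteq> frac_ring R A"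
  shows "\<exists>q\<in>A. q \<noteq> \<zero> \<and> (\<forall>y\<in>set ys. q \<otimes> y \<in> A)"
  using assms(2)
proof (induct ys)
  case Nil show ?case using subringE(3)[OF A] by (intro bexI[of _ "\<one>"]) auto
next
  case (Cons y ys)
  then obtain q where q: "q \<in> A" "q \<noteq> \<zero>" "\<forall>y\<in>set ys. q \<otimes> y \<in> A" by auto
  obtain r where r: "r \<in> A" "r \<noteq> \<zero>" "r \<otimes> y \<in> A" "y \<in> carrier R"
    using Cons by (auto simp: frac_ring_def)
  have c: "q \<in> carrier R" "r \<in> carrier R" using q r subringE(1)[OF A] by auto
  have ys: "set ys \<subseteq> carrier R" using Cons(2) by (auto simp: frac_ring_def)
  have "q \<otimes> r \<noteq> \<zero>" using c q(2) r(2) integral by blast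
  moreover have "q \<otimes> r \<in> A" using q r subringE(6)[OF A] by blast
  moreover have "q \<otimes> r \<otimes> y \<in> A" using subringE(6)[OF A q(1) r(3)] c r(4) by (simp add: m_assoc)
  moreover have "q \<otimes> r \<otimes> z \<in> A" if z: "z \<in> set ys" for z
  proof -
    have "q \<otimes> r \<otimes> z = r \<otimes> (q \<otimes> z)" using z ys c by (simp add: m_ac subset_iff)
    then show ?thesis using subringE(6)[OF A r(1)] q(3) z by simp
  qed
  ultimately show ?case by auto
qed

locale field_over = field R for R (structure) and E +
  assumes E: "subfield E R"
begin

lemma E_subring: "subring E R" using subfieldE(1)[OF E] .
lemma E_carrier: "E \<subseteq> carrier R" using subringE(1)[OF E_subring] .

context
  fixes xs assumes xs: "set xs \<subseteq> carrier R"
begin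

lemma mons_closed: "(\<lambda>\<alpha>. monomial R \<alpha> xs) ` A \<subseteq> carrier R"
  using monomial_closed[OF xs] by auto

lemma poly_span_closed: "poly_span R E xs d \<subseteq> carrier R"
  unfolding poly_span_def using lin_span_closed[OF E_carrier mons_closed] by auto

lemma poly_span_mono: "d \<le> e \<Longrightarrow> poly_span R E xs d \<subseteq> poly_span R E xs e"
  unfolding poly_span_def by (intro lin_span_mono image_mono) (auto simp: bounded_exps_def)

lemma poly_span_add: "u \<in> poly_span R E xs d \<Longrightarrow> v \<in> poly_span R E xs d \<Longrightarrow> u \<oplus> v \<in> poly_span R E xs d"
  unfolding poly_span_def by (intro lin_span_add[OF E_carrier mons_closed])

lemma poly_span_smult: "c \<in> E \<Longrightarrow> v \<in> poly_span R E xs d \<Longrightarrow> c \<otimes> v \<in> poly_span R E xs d"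
  unfolding poly_span_def by (intro lin_span_smult[OF E_subring mons_closed])

lemma poly_span_mult:
  assumes "u \<in> poly_span R E xs d" "v \<in> poly_span R E xs e"
  shows "u \<otimes> v \<in> poly_span R E xs (d + e)"
  using assms unfolding poly_span_def
proof (elim lin_span_mult[OF E_subring mons_closed mons_closed mons_closed, rotated])
  fix g h assume "g \<in> (\<lambda>\<alpha>. monomial R \<alpha> xs) ` bounded_exps (length xs) d"
    "h \<in> (\<lambda>\<alpha>. monomial R \<alpha> xs) ` bounded_exps (length xs) e"
  then obtain \<alpha> \<beta> where ab: "\<alpha> \<in> bounded_exps (length xs) d" "\<beta> \<in> bounded_exps (length xs) e"
    "g = monomial R \<alpha> xs" "h = monomial R \<beta> xs" by blast
  have "set (map2 (+) \<alpha> \<beta>) \<subseteq> {..d + e}"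
  proof
    fix x assume "x \<in> set (map2 (+) \<alpha> \<beta>)"
    then obtain a b where x: "(a, b) \<in> set (zip \<alpha> \<beta>)" "x = a + b" by auto
    then have "a \<in> set \<alpha>" "b \<in> set \<beta>" by (auto dest: set_zip_leftD set_zip_rightD)
    then show "x \<in> {..d + e}" using ab x(2) by (auto simp: bounded_exps_def intro!: add_mono)
  qed
  then have "map2 (+) \<alpha> \<beta> \<in> bounded_exps (length xs) (d + e)"
    using ab by (simp add: bounded_exps_def)
  moreover have "g \<otimes> h = monomial R (map2 (+) \<alpha> \<beta>) xs"
    using ab by (simp add: monomial_mult[OF xs] bounded_exps_def)
  ultimately show "g \<otimes> h \<in> lin_span R E ((\<lambda>\<alpha>. monomial R \<alpha> xs) ` bounded_exps (length xs) (d + e))"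
    by (intro lin_span_incl[OF E_subring mons_closed]) auto
qed

lemma poly_span_one: "\<one> \<in> poly_span R E xs 0"
  unfolding poly_span_def
proof (intro lin_span_incl[OF E_subring mons_closed] image_eqI)
  show "\<one> = monomial R (replicate (length xs) 0) xs" using monomial_zero[OF xs] by simp
qed (auto simp: bounded_exps_def)

lemma poly_span_const: "c \<in> E \<Longrightarrow> c \<in> poly_span R E xs 0"
  using poly_span_smult[OF _ poly_span_one, of c] E_carrier by auto

lemma poly_span_var: "x \<in> set xs \<Longrightarrow> x \<in> poly_span R E xs 1"
proof -
  assume "x \<in> set xs"
  then obtain i where i: "i < length xs" "x = xs ! i" by (auto simp: in_set_conv_nth)
  show ?thesis unfolding poly_span_def
  proof (intro lin_span_incl[OF E_subring mons_closed] image_eqI)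
    show "x = monomial R ((replicate (length xs) 0)[i := 1]) xs" using monomial_unit[OF xs i(1)] i by simp
  qed (auto simp: bounded_exps_def dest!: set_update_subset_insert[THEN subsetD])
qed

lemma poly_span_power: "x \<in> poly_span R E xs d \<Longrightarrow> x [^] (m::nat) \<in> poly_span R E xs (m * d)"
proof (induct m)
  case 0 then show ?case using poly_span_one by simp
next
  case (Suc m)
  then show ?case using poly_span_mult[of "x [^] m" "m * d" x d] by (simp add: add.commute)
qed

lemma generate_ring_poly_span:
  assumes "y \<in> generate_ring R (E \<union> set xs)"
  shows "\<exists>d. y \<in> poly_span R E xs d"
  using assms
proof induct
  case one then show ?case using poly_span_one by blast
next
  case (incl h) then show ?case using poly_span_const poly_span_var by blast
next
  case (a_inv h)
  then obtain d where d: "h \<in> poly_span R E xs d" by blast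
  then have "(\<ominus> \<one>) \<otimes> h \<in> poly_span R E xs d"
    using poly_span_smult subringE(3,5)[OF E_subring] by blast
  moreover have "h \<in> carrier R" using d poly_span_closed by blast
  ultimately show ?case by (auto simp: l_minus)
next
  case (eng_add h1 h2)
  then obtain d e where "h1 \<in> poly_span R E xs d" "h2 \<in> poly_span R E xs e" by blast
  then have "h1 \<in> poly_span R E xs (max d e)" "h2 \<in> poly_span R E xs (max d e)"
    using poly_span_mono[of d "max d e"] poly_span_mono[of e "max d e"] by auto
  then show ?case using poly_span_add by blast
next
  case (eng_mult h1 h2) then show ?case using poly_span_mult by blast
qed

text \<open>The products of powers of more than \<open>n\<close> fractions, cleared of denominators, live in a space
  of polynomials in \<open>n\<close> variables whose dimension grows strictly slower than their number.\<close>

lemma frac_not_alg_indep: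
  assumes ys: "length xs < length ys" "set ys \<subseteq> frac_ring R (generate_ring R (E \<union> set xs))"
  shows "\<not> alg_indep R E ys"
proof -
  let ?A = "generate_ring R (E \<union> set xs)"
  have A: "subring ?A R" using E_carrier xs by (intro generate_ring_is_subring) auto
  have ysc: "set ys \<subseteq> carrier R" using ys(2) by (auto simp: frac_ring_def)
  obtain q where q: "q \<in> ?A" "q \<noteq> \<zero>" "\<forall>y\<in>set ys. q \<otimes> y \<in> ?A"
    using common_denominator[OF A ys(2)] by blast
  have qc: "q \<in> carrier R" using q(1) subringE(1)[OF A] by blast
  have "\<exists>d. \<forall>z\<in>Z. z \<in> poly_span R E xs d" if "finite Z" "Z \<subseteq> ?A" for Z
    using that
  proof (induct Z rule: finite_induct)
    case empty then show ?case by simp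
  next
    case (insert z Z)
    then obtain d where d: "\<forall>z\<in>Z. z \<in> poly_span R E xs d" by auto
    obtain e where e: "z \<in> poly_span R E xs e" using generate_ring_poly_span[of z] insert(4) by blast
    show ?case
      using d e poly_span_mono[of d "max d e"] poly_span_mono[of e "max d e"]
      by (intro exI[of _ "max d e"]) auto
  qed
  \<comment> \<open>One degree bound for the denominator and all numerators.\<close>
  from this[of "insert q ((\<lambda>y. q \<otimes> y) ` set ys)"] q
  obtain d where d: "q \<in> poly_span R E xs d" "\<And>y. y \<in> set ys \<Longrightarrow> q \<otimes> y \<in> poly_span R E xs d"
    by auto
  define N where "N = length ys"
  \<comment> \<open>The dimension bound below is at most \<open>(M + 1) ^ length xs\<close> times
    \<open>(N * d + 1) ^ length xs\<close>. Taking the latter constant for \<open>M\<close> itself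
    makes one extra factor \<open>M + 1\<close> larger than it.\<close>
  define M where "M = (N * d + 1) ^ length xs"
  define J where "J = bounded_exps N M"
  define G where "G = (\<lambda>\<alpha>. monomial R \<alpha> xs) ` bounded_exps (length xs) (N * (M * d))"
  \<comment> \<open>Each of the \<open>N\<close> fractions occurs with exponent at most
    \<open>M\<close>, so \<open>q [^] (N * M)\<close> clears every denominator.\<close>
  define v where "v \<alpha> = q [^] (N * M) \<otimes> monomial R \<alpha> ys" for \<alpha>
  have "card G \<le> (N * (M * d) + 1) ^ length xs"
    unfolding G_def using card_image_le[OF finite_bounded_exps] card_bounded_exps by metis
  also have "\<dots> \<le> ((M + 1) * (N * d + 1)) ^ length xs"
    by (intro power_mono) (auto simp: algebra_simps)
  also have "\<dots> = (M + 1) ^ length xs * M" by (simp only: power_mult_distrib M_def)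
  also have "\<dots> < (M + 1) ^ length xs * (M + 1)" by simp
  also have "\<dots> = (M + 1) ^ Suc (length xs)" by simp
  also have "\<dots> \<le> (M + 1) ^ N" using ys(1) by (intro power_increasing) (auto simp: N_def)
  also have "\<dots> = card J" unfolding J_def by (simp add: card_bounded_exps)
  finally have card: "card G < card J" .
  have v: "v \<alpha> \<in> lin_span R E G" if \<alpha>: "\<alpha> \<in> J" for \<alpha>
  proof -
    have le: "\<alpha> ! i \<le> M" if "i < N" for i
      using \<alpha> that unfolding J_def bounded_exps_def by (metis (mono_tags, lifting) atMost_iff mem_Collect_eq nth_mem subset_iff)
    have yi: "ys ! i \<in> carrier R" "ys ! i \<in> set ys" if "i < N" for i
      using that ysc unfolding N_def by auto
    define f where "f i = q [^] M \<otimes> (ys ! i) [^] (\<alpha> ! i)" for i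
    have fc: "f i \<in> carrier R" if "i < N" for i unfolding f_def using yi[OF that] qc by simp
    have f: "f i \<in> poly_span R E xs (M * d)" if i: "i < N" for i
    proof -
      \<comment> \<open>Of the \<open>M\<close> factors \<open>q\<close>, as many as the exponent
        are paired with copies of the fraction and turn them into numerators; every resulting factor
        has degree bound \<open>d\<close>.\<close>
      have "q [^] M = q [^] (M - \<alpha> ! i) \<otimes> q [^] (\<alpha> ! i)"
        using qc le[OF i] by (simp add: nat_pow_mult)
      then have "f i = q [^] (M - \<alpha> ! i) \<otimes> (q \<otimes> ys ! i) [^] (\<alpha> ! i)"
        unfolding f_def using qc yi[OF i] by (simp add: nat_pow_distrib m_assoc)
      moreover have "\<dots> \<in> poly_span R E xs ((M - \<alpha> ! i) * d + \<alpha> ! i * d)"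
        using d yi[OF i] by (intro poly_span_mult poly_span_power) auto
      moreover have "(M - \<alpha> ! i) * d + \<alpha> ! i * d = M * d"
        using le[OF i] by (metis add_mult_distrib le_add_diff_inverse2)
      ultimately show ?thesis by simp
    qed
    have "finprod R f {..<N} \<in> poly_span R E xs (N * (M * d))"
      using fc
    proof (rule finprod_nat_mem[where P = "\<lambda>n x. x \<in> poly_span R E xs (n * (M * d))"])
      fix i x assume "i < N" "x \<in> poly_span R E xs (i * (M * d))"
      from poly_span_mult[OF f[OF this(1)] this(2)]
      show "f i \<otimes> x \<in> poly_span R E xs (Suc i * (M * d))" by simp
    next
      show "\<one> \<in> poly_span R E xs (0 * (M * d))" using poly_span_one by (metis mult_0)
    qed
    also have "finprod R f {..<N} = finprod R (\<lambda>i. q [^] M) {..<N} \<otimes> finprod R (\<lambda>i. (ys ! i) [^] (\<alpha> ! i)) {..<N}"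
      unfolding f_def using qc yi by (intro finprod_multf) auto
    also have "\<dots> = v \<alpha>"
      unfolding v_def monomial_def N_def using qc by (simp add: finprod_const nat_pow_pow mult.commute)
    finally show ?thesis unfolding poly_span_def G_def .
  qed
  have Gc: "finite G" "G \<subseteq> carrier R" "finite J"
    unfolding G_def J_def using mons_closed finite_bounded_exps by auto
  \<comment> \<open>All terms of the relation share the nonzero factor \<open>q [^] (N * M)\<close>,
    which is cancelled afterwards.\<close>
  obtain l where l: "l \<in> J \<rightarrow> E" "\<exists>j\<in>J. l j \<noteq> \<zero>" "(\<Oplus>j\<in>J. l j \<otimes> v j) = \<zero>"
    using lin_span_dependent[OF E Gc card, of v] v by blast
  have lc: "l \<in> J \<rightarrow> carrier R" using l E_carrier by auto
  have mc: "monomial R \<alpha> ys \<in> carrier R" for \<alpha> using monomial_closed[OF ysc] .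
  have "(\<Oplus>j\<in>J. l j \<otimes> v j) = (\<Oplus>j\<in>J. q [^] (N * M) \<otimes> (l j \<otimes> monomial R j ys))"
    unfolding v_def using lc mc qc by (intro finsum_cong') (auto simp: m_lcomm Pi_iff)
  also have "\<dots> = q [^] (N * M) \<otimes> (\<Oplus>j\<in>J. l j \<otimes> monomial R j ys)"
    using Gc lc mc qc by (intro finsum_rdistr[symmetric]) auto
  finally have "q [^] (N * M) \<otimes> (\<Oplus>j\<in>J. l j \<otimes> monomial R j ys) = \<zero>" using l(3) by simp
  moreover have "q [^] (N * M) \<noteq> \<zero>" using q(2) qc by (metis nat_pow_eq_zero_imp)
  moreover have "(\<Oplus>j\<in>J. l j \<otimes> monomial R j ys) \<in> carrier R"
    using lc mc by (intro finsum_closed) auto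
  ultimately have "(\<Oplus>j\<in>J. l j \<otimes> monomial R j ys) = \<zero>" using qc integral[of "q [^] (N * M)"] by blast
  moreover have "\<forall>\<alpha>\<in>J. length \<alpha> = length ys" by (simp add: J_def bounded_exps_def N_def)
  ultimately show ?thesis using l(1,2) Gc(3) unfolding alg_indep_def by blast
qed

end
end

section \<open>Transcendence over subrings\<close>

text \<open>\<open>horner R A x d c v\<close> says that \<open>v\<close> is a value at \<open>x\<close> of a polynomial over \<open>A\<close> of formal degree \<open>d\<close>
  with coefficient \<open>c\<close> (possibly zero) at \<open>x^d\<close>.\<close>

inductive horner :: "('b, 'm) ring_scheme \<Rightarrow> 'b set \<Rightarrow> 'b \<Rightarrow> nat \<Rightarrow> 'b \<Rightarrow> 'b \<Rightarrow> bool"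
  for R A x where
  base: "c \<in> A \<Longrightarrow> horner R A x 0 c c"
| step: "horner R A x d c v \<Longrightarrow> a \<in> A \<Longrightarrow> horner R A x (Suc d) c (x \<otimes>\<^bsub>R\<^esub> v \<oplus>\<^bsub>R\<^esub> a)"

text \<open>Only the formal top coefficient is required to vanish. Once it is zero the relation can
  be rewritten in lower formal degree, so the other coefficients vanish in turn.\<close>

definition transc :: "('b, 'm) ring_scheme \<Rightarrow> 'b set \<Rightarrow> 'b \<Rightarrow> bool" where
  "transc R A x \<longleftrightarrow> (\<forall>d c. horner R A x d c \<zero>\<^bsub>R\<^esub> \<longrightarrow> c = \<zero>\<^bsub>R\<^esub>)"

lemma horner_mono: "horner R A x d c v \<Longrightarrow> A \<subseteq> B \<Longrightarrow> horner R B x d c v"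
  by (induct rule: horner.induct) (auto intro: horner.intros)

lemma alg_indepD:
  assumes "alg_indep R A xs" "finite M" "\<forall>\<alpha>\<in>M. length \<alpha> = length xs" "c \<in> M \<rightarrow> A"
    and "finsum R (\<lambda>\<alpha>. c \<alpha> \<otimes>\<^bsub>R\<^esub> monomial R \<alpha> xs) M = \<zero>\<^bsub>R\<^esub>"
  shows "\<forall>\<alpha>\<in>M. c \<alpha> = \<zero>\<^bsub>R\<^esub>"
  using assms unfolding alg_indep_def by metis

lemma alg_indepI:
  assumes "distinct xs" "set xs \<subseteq> carrier R"
    and "\<And>M c. finite M \<Longrightarrow> \<forall>\<alpha>\<in>M. length \<alpha> = length xs \<Longrightarrow> c \<in> M \<rightarrow> A \<Longrightarrow>
      finsum R (\<lambda>\<alpha>. c \<alpha> \<otimes>\<^bsub>R\<^esub> monomial R \<alpha> xs) M = \<zero>\<^bsub>R\<^esub> \<Longrightarrow> \<forall>\<alpha>\<in>M. c \<alpha> = \<zero>\<^bsub>R\<^esub>"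
  shows "alg_indep R A xs"
  unfolding alg_indep_def
proof (intro conjI assms(1,2) allI impI)
  fix M c
  assume "finite M \<and> (\<forall>\<alpha>\<in>M. length \<alpha> = length xs) \<and> c \<in> M \<rightarrow> A \<and>
      finsum R (\<lambda>\<alpha>. c \<alpha> \<otimes>\<^bsub>R\<^esub> monomial R \<alpha> xs) M = \<zero>\<^bsub>R\<^esub>"
  then show "\<forall>\<alpha>\<in>M. c \<alpha> = \<zero>\<^bsub>R\<^esub>" by (elim conjE) (rule assms(3))
qed

lemma alg_indep_mono: "alg_indep R B xs \<Longrightarrow> A \<subseteq> B \<Longrightarrow> alg_indep R A xs"
  unfolding alg_indep_def by (metis (no_types, lifting) Pi_mono subset_iff)

context field begin

lemma horner_closed:
  assumes A: "subring A R" and x: "x \<in> carrier R" and "horner R A x d c v"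
  shows "c \<in> A" "v \<in> carrier R"
  using assms(3) by (induct) (use subringE(1)[OF A] x in auto)

lemma horner_add:
  assumes A: "subring A R" and x: "x \<in> carrier R"
  shows "horner R A x d c v \<Longrightarrow> horner R A x d c' v' \<Longrightarrow> horner R A x d (c \<oplus> c') (v \<oplus> v')"
proof (induct d c v arbitrary: c' v' rule: horner.induct)
  case (base c)
  from base(2) have "v' = c'" "c' \<in> A" by (auto elim: horner.cases)
  then show ?case using base subringE(7)[OF A] by (auto intro: horner.base)
next
  case (step d c v a)
  from step(4) obtain w b where w: "v' = x \<otimes> w \<oplus> b" "horner R A x d c' w" "b \<in> A"
    by (auto elim: horner.cases)
  have cl: "v \<in> carrier R" "w \<in> carrier R" "a \<in> carrier R" "b \<in> carrier R"
    using horner_closed[OF A x] step w subringE(1)[OF A] by auto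
  have "horner R A x (Suc d) (c \<oplus> c') (x \<otimes> (v \<oplus> w) \<oplus> (a \<oplus> b))"
    using step w subringE(7)[OF A] by (intro horner.step) auto
  moreover have "x \<otimes> (v \<oplus> w) \<oplus> (a \<oplus> b) = (x \<otimes> v \<oplus> a) \<oplus> v'"
    unfolding w using cl x by algebra
  ultimately show ?case by simp
qed

lemma horner_smult:
  assumes A: "subring A R" and x: "x \<in> carrier R" and y: "y \<in> A"
  shows "horner R A x d c v \<Longrightarrow> horner R A x d (y \<otimes> c) (y \<otimes> v)"
proof (induct d c v rule: horner.induct)
  case (base c) then show ?case using subringE(6)[OF A y] by (auto intro: horner.base)
next
  case (step d c v a)
  have cl: "v \<in> carrier R" "a \<in> carrier R" "y \<in> carrier R"
    using horner_closed[OF A x] step y subringE(1)[OF A] by auto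
  have "horner R A x (Suc d) (y \<otimes> c) (x \<otimes> (y \<otimes> v) \<oplus> y \<otimes> a)"
    using step subringE(6)[OF A y] by (intro horner.step) auto
  moreover have "x \<otimes> (y \<otimes> v) \<oplus> y \<otimes> a = y \<otimes> (x \<otimes> v \<oplus> a)" using cl x by algebra
  ultimately show ?case by simp
qed

text \<open>Padding with a zero top coefficient brings polynomials to a common formal degree, as
  \<open>horner_add\<close> demands.\<close>

lemma horner_raise:
  assumes A: "subring A R" and x: "x \<in> carrier R"
  shows "horner R A x d c v \<Longrightarrow> horner R A x (Suc d) \<zero> v"
proof (induct d c v rule: horner.induct)
  case (base c)
  have "horner R A x (Suc 0) \<zero> (x \<otimes> \<zero> \<oplus> c)"
    using base subringE(2)[OF A] by (intro horner.intros)
  then show ?case using base x subringE(1)[OF A] by auto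
next
  case (step d c v a) then show ?case by (intro horner.step)
qed

text \<open>The converse of padding: a zero top coefficient can be forgotten, and some new top
  coefficient \<open>l\<close> appears one degree lower.\<close>

lemma horner_drop:
  assumes A: "subring A R" and x: "x \<in> carrier R"
  shows "horner R A x d' c v \<Longrightarrow> c = \<zero> \<Longrightarrow> d' = Suc d \<Longrightarrow> \<exists>l. horner R A x d l v"
proof (induct d' c v arbitrary: d rule: horner.induct)
  case (base c) then show ?case by simp
next
  case (step d' c v a)
  show ?case
  proof (cases d')
    case 0
    then have "v = \<zero>" using step by (auto elim: horner.cases)
    then show ?thesis using step 0 x subringE(1)[OF A] by (auto intro!: horner.base exI)
  next
    case (Suc e)
    then obtain l where "horner R A x e l v" using step by blast
    then have "horner R A x (Suc e) l (x \<otimes> v \<oplus> a)" using step by (intro horner.step)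
    then show ?thesis using step Suc by auto
  qed
qed

text \<open>The hypothesis is a vanishing polynomial of formal degree \<open>d + 1\<close>, so its
  top coefficient is zero and \<open>v\<close> has a representation of lower degree; the descent
  ends with a constant \<open>v\<close>. This peels a relation into its constant term and its
  quotient by \<open>x\<close>.\<close>

lemma transc_zero:
  assumes A: "subring A R" and x: "x \<in> carrier R" and t: "transc R A x"
  shows "horner R A x d c v \<Longrightarrow> b \<in> A \<Longrightarrow> x \<otimes> v \<oplus> b = \<zero> \<Longrightarrow> v = \<zero> \<and> b = \<zero>"
proof (induct d arbitrary: c)
  case 0
  then have v: "v = c" by (auto elim: horner.cases)
  have "horner R A x (Suc 0) c (x \<otimes> v \<oplus> b)" using 0 by (intro horner.step)
  then have "c = \<zero>" using 0 t unfolding transc_def by metis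
  then show ?case using v 0 x subringE(1)[OF A] by auto
next
  case (Suc d)
  have "horner R A x (Suc (Suc d)) c (x \<otimes> v \<oplus> b)" using Suc by (intro horner.step)
  then have "c = \<zero>" using Suc t unfolding transc_def by metis
  then obtain l where "horner R A x d l v" using horner_drop[OF A x Suc(2)] by blast
  then show ?case using Suc by blast
qed

text \<open>A polynomial in \<open>x \<oplus> y\<close> with \<open>y\<close> among the coefficients
  is a polynomial in \<open>x\<close> of the same formal degree with the same top
  coefficient.\<close>

lemma transc_translate:
  assumes A: "subring A R" and x: "x \<in> carrier R" and y: "y \<in> A" and t: "transc R A x"
  shows "transc R A (x \<oplus> y)"
proof -
  have yc: "y \<in> carrier R" using y subringE(1)[OF A] by auto
  have "horner R A x d c v" if "horner R A (x \<oplus> y) d c v" for d c v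
    using that
  proof (induct d c v rule: horner.induct)
    case (base c) then show ?case by (rule horner.base)
  next
    case (step d c v a)
    have cl: "v \<in> carrier R" "a \<in> carrier R" "c \<in> carrier R"
      using horner_closed[OF A x step(2)] step subringE(1)[OF A] by auto
    have "horner R A x (Suc d) (c \<oplus> \<zero>) ((x \<otimes> v \<oplus> a) \<oplus> y \<otimes> v)"
      using step(2,3) horner_raise[OF A x horner_smult[OF A x y step(2)]]
      by (intro horner_add[OF A x] horner.step)
    moreover have "(x \<otimes> v \<oplus> a) \<oplus> y \<otimes> v = (x \<oplus> y) \<otimes> v \<oplus> a" using cl x yc by algebra
    ultimately show ?case using cl by simp
  qed
  then show ?thesis using t unfolding transc_def by blast
qed

lemma horner_le:
  assumes A: "subring A R" and x: "x \<in> carrier R" and h: "horner R A x d c v" and "d \<le> e"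
  shows "\<exists>l. horner R A x e l v"
  using assms(4)
proof (induct e rule: dec_induct)
  case base then show ?case using h by blast
next
  case (step e) then show ?case using horner_raise[OF A x] by blast
qed

lemma horner_poly_add:
  assumes A: "subring A R" and x: "x \<in> carrier R"
    and "\<exists>d l. horner R A x d l v" "\<exists>d l. horner R A x d l w"
  shows "\<exists>d l. horner R A x d l (v \<oplus> w)"
proof -
  obtain d l e m where h: "horner R A x d l v" "horner R A x e m w" using assms by blast
  obtain l' m' where "horner R A x (max d e) l' v" "horner R A x (max d e) m' w"
    using horner_le[OF A x h(1), of "max d e"] horner_le[OF A x h(2), of "max d e"] by auto
  then show ?thesis using horner_add[OF A x] by blast
qed

lemma horner_poly_mult:
  assumes A: "subring A R" and x: "x \<in> carrier R"
    and w: "\<exists>d l. horner R A x d l w"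
  shows "horner R A x d l v \<Longrightarrow> \<exists>d l. horner R A x d l (v \<otimes> w)"
proof (induct d l v rule: horner.induct)
  case (base c) then show ?case using w horner_smult[OF A x] by blast
next
  case (step d c v a)
  have wc: "w \<in> carrier R" using w horner_closed[OF A x] by blast
  have cl: "v \<in> carrier R" "a \<in> carrier R"
    using horner_closed[OF A x step(1)] step subringE(1)[OF A] by auto
  obtain e m where "horner R A x e m (v \<otimes> w)" using step by blast
  then have "horner R A x (Suc e) m (x \<otimes> (v \<otimes> w) \<oplus> \<zero>)"
    using subringE(2)[OF A] by (intro horner.step)
  moreover have "\<exists>d l. horner R A x d l (a \<otimes> w)" using w horner_smult[OF A x step(3)] by blast
  ultimately have "\<exists>d l. horner R A x d l ((x \<otimes> (v \<otimes> w) \<oplus> \<zero>) \<oplus> a \<otimes> w)"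
    using horner_poly_add[OF A x] by blast
  moreover have "(x \<otimes> (v \<otimes> w) \<oplus> \<zero>) \<oplus> a \<otimes> w = (x \<otimes> v \<oplus> a) \<otimes> w" using cl x wc by algebra
  ultimately show ?case by simp
qed

lemma generate_ring_horner:
  assumes A: "subring A R" and x: "x \<in> carrier R"
    and "v \<in> generate_ring R (insert x A)"
  shows "\<exists>d l. horner R A x d l v"
  using assms(3)
proof induct
  case one show ?case by (intro exI, rule horner.base, rule subringE(3)[OF A])
next
  case (incl h)
  show ?case
  proof (cases "h \<in> A")
    case True then show ?thesis by (blast intro: horner.base)
  next
    case False
    then have h: "h = x" using incl by simp
    have "horner R A x (Suc 0) \<one> (x \<otimes> \<one> \<oplus> \<zero>)"
      using subringE(2,3)[OF A] by (intro horner.intros)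
    then show ?thesis using x h by auto
  qed
next
  case (a_inv h)
  then obtain d l where h: "horner R A x d l h" by blast
  have "h \<in> carrier R" using horner_closed[OF A x h] by simp
  then have "\<ominus> \<one> \<otimes> h = \<ominus> h" by (simp add: l_minus)
  then show ?case using horner_smult[OF A x subringE(5)[OF A subringE(3)[OF A]] h] by auto
next
  case (eng_add h1 h2) then show ?case using horner_poly_add[OF A x] by blast
next
  case (eng_mult h1 h2) then show ?case using horner_poly_mult[OF A x] by blast
qed

section \<open>Independence and the adjunction of a transcendental element\<close>

lemma subring_finsum:
  assumes A: "subring A R" and "finite M" "f \<in> M \<rightarrow> A"
  shows "finsum R f M \<in> A"
  using assms(2,3)
proof (induct M rule: finite_induct)
  case empty then show ?case using subringE(2)[OF A] by simp
next
  case (insert m M)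
  then have "finsum R f (insert m M) = f m \<oplus> finsum R f M"
    using subringE(1)[OF A] by (intro finsum_insert) auto
  then show ?case using insert subringE(7)[OF A] by auto
qed

lemma subring_pow: "subring A R \<Longrightarrow> a \<in> A \<Longrightarrow> a [^] (k::nat) \<in> A"
  by (induct k) (auto simp: subringE)

lemma monomial_Cons:
  assumes "y \<in> carrier R" "set xs \<subseteq> carrier R"
  shows "monomial R (h # t) (y # xs) = y [^] h \<otimes> monomial R t xs"
proof -
  have "monomial R (h # t) (y # xs) = finprod R (\<lambda>i. (y # xs) ! i [^] ((h # t) ! i)) (insert 0 (Suc ` {..<length xs}))"
    unfolding monomial_def by (simp add: lessThan_Suc_eq_insert_0)
  also have "\<dots> = y [^] h \<otimes> finprod R (\<lambda>i. (y # xs) ! i [^] ((h # t) ! i)) (Suc ` {..<length xs})"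
    using assms by (subst finprod_insert) (auto simp: subset_iff)
  also have "finprod R (\<lambda>i. (y # xs) ! i [^] ((h # t) ! i)) (Suc ` {..<length xs})
     = finprod R (\<lambda>i. (y # xs) ! (Suc i) [^] ((h # t) ! (Suc i))) {..<length xs}"
    using assms by (intro finprod_reindex) (auto simp: subset_iff)
  finally show ?thesis by (simp add: monomial_def)
qed

lemma subring_monomial:
  assumes A: "subring A R" and "set xs \<subseteq> A" "length \<alpha> = length xs"
  shows "monomial R \<alpha> xs \<in> A"
  using assms(2,3)
proof (induct xs arbitrary: \<alpha>)
  case Nil then show ?case using subringE(3)[OF A] by (simp add: monomial_def)
next
  case (Cons x xs)
  then obtain h t where "\<alpha> = h # t" "length t = length xs" by (cases \<alpha>) auto
  then show ?case using Cons subringE(1,6)[OF A] subring_pow[OF A]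
    by (auto simp: monomial_Cons subset_iff)
qed

text \<open>A relation with coefficients in A[y] is a polynomial in \<open>y\<close> whose
  coefficients are relations over \<open>A\<close>, with values in \<open>B\<close>. As
  \<open>y\<close> is transcendental over \<open>B\<close>, each of these relations holds on its
  own.\<close>

lemma alg_indep_adjoin_coeff:
  assumes A: "subring A R" and y: "y \<in> carrier R"
    and B: "subring B R" "A \<subseteq> B" "set xs \<subseteq> B"
    and ind: "alg_indep R A xs" and t: "transc R B y"
  shows "alg_indep R (generate_ring R (insert y A)) xs"
proof -
  have xsc: "set xs \<subseteq> carrier R" "distinct xs" using ind by (auto simp: alg_indep_def)
  note mc = monomial_closed[OF xsc(1)]
  \<comment> \<open>Induction on a common formal degree in \<open>y\<close> of the coefficients. The
    first conjunct, that the whole sum is a polynomial in \<open>y\<close> over \<open>B\<close>, is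
    what \<open>transc_zero\<close> needs in order to split the sum.\<close>
  have main: "(\<forall>\<alpha>\<in>M. \<exists>l. horner R A y d l (c \<alpha>)) \<Longrightarrow>
      (\<exists>l. horner R B y d l (finsum R (\<lambda>\<alpha>. c \<alpha> \<otimes> monomial R \<alpha> xs) M)) \<and>
      (finsum R (\<lambda>\<alpha>. c \<alpha> \<otimes> monomial R \<alpha> xs) M = \<zero> \<longrightarrow> (\<forall>\<alpha>\<in>M. c \<alpha> = \<zero>))"
    if M: "finite M" "\<forall>\<alpha>\<in>M. length \<alpha> = length xs" for M d c
  proof (induct d arbitrary: c)
    case 0
    then have c: "c \<in> M \<rightarrow> A" by (auto elim: horner.cases)
    have "finsum R (\<lambda>\<alpha>. c \<alpha> \<otimes> monomial R \<alpha> xs) M \<in> B"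
    proof (rule subring_finsum[OF B(1) M(1)], rule Pi_I)
      fix \<alpha> assume \<alpha>: "\<alpha> \<in> M"
      have "c \<alpha> \<in> B" using \<alpha> c B(2) by auto
      moreover have "monomial R \<alpha> xs \<in> B" using subring_monomial[OF B(1,3)] M(2) \<alpha> by auto
      ultimately show "c \<alpha> \<otimes> monomial R \<alpha> xs \<in> B" by (rule subringE(6)[OF B(1)])
    qed
    moreover have "finsum R (\<lambda>\<alpha>. c \<alpha> \<otimes> monomial R \<alpha> xs) M = \<zero> \<longrightarrow> (\<forall>\<alpha>\<in>M. c \<alpha> = \<zero>)"
      using alg_indepD[OF ind M c] by simp
    ultimately show ?case by (blast intro: horner.base)
  next
    case (Suc d)
    have "\<forall>\<alpha>\<in>M. \<exists>v. \<exists>a. a \<in> A \<and> (\<exists>l. horner R A y d l v) \<and> c \<alpha> = y \<otimes> v \<oplus> a"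
    proof
      fix \<alpha> assume "\<alpha> \<in> M"
      then obtain l where "horner R A y (Suc d) l (c \<alpha>)" using Suc(2) by blast
      then show "\<exists>v a. a \<in> A \<and> (\<exists>l. horner R A y d l v) \<and> c \<alpha> = y \<otimes> v \<oplus> a"
        by (cases rule: horner.cases) blast
    qed
    from bchoice[OF this] obtain v where "\<forall>\<alpha>\<in>M. \<exists>a. a \<in> A \<and> (\<exists>l. horner R A y d l (v \<alpha>)) \<and> c \<alpha> = y \<otimes> v \<alpha> \<oplus> a" ..
    from bchoice[OF this] obtain a where va: "\<And>\<alpha>. \<alpha> \<in> M \<Longrightarrow> a \<alpha> \<in> A \<and> (\<exists>l. horner R A y d l (v \<alpha>)) \<and> c \<alpha> = y \<otimes> v \<alpha> \<oplus> a \<alpha>" by blast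
    have cl: "v \<alpha> \<in> carrier R" "a \<alpha> \<in> carrier R" if "\<alpha> \<in> M" for \<alpha>
      using va[OF that] horner_closed[OF A y] subringE(1)[OF A] by auto
    let ?V = "finsum R (\<lambda>\<alpha>. v \<alpha> \<otimes> monomial R \<alpha> xs) M"
    let ?W = "finsum R (\<lambda>\<alpha>. a \<alpha> \<otimes> monomial R \<alpha> xs) M"
    have V: "\<exists>l. horner R B y d l ?V" "?V = \<zero> \<longrightarrow> (\<forall>\<alpha>\<in>M. v \<alpha> = \<zero>)"
      using Suc(1)[of v] va by auto
    have W: "?W \<in> B"
    proof (rule subring_finsum[OF B(1) M(1)], rule Pi_I)
      fix \<alpha> assume \<alpha>: "\<alpha> \<in> M"
      have "a \<alpha> \<in> B" using \<alpha> va B(2) by auto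
      moreover have "monomial R \<alpha> xs \<in> B" using subring_monomial[OF B(1,3)] M(2) \<alpha> by auto
      ultimately show "a \<alpha> \<otimes> monomial R \<alpha> xs \<in> B" by (rule subringE(6)[OF B(1)])
    qed
    have "finsum R (\<lambda>\<alpha>. c \<alpha> \<otimes> monomial R \<alpha> xs) M
      = finsum R (\<lambda>\<alpha>. y \<otimes> (v \<alpha> \<otimes> monomial R \<alpha> xs) \<oplus> a \<alpha> \<otimes> monomial R \<alpha> xs) M"
      using va cl mc y by (intro finsum_cong') (auto simp: l_distr m_assoc)
    also have "\<dots> = finsum R (\<lambda>\<alpha>. y \<otimes> (v \<alpha> \<otimes> monomial R \<alpha> xs)) M \<oplus> ?W"
      using cl mc y by (intro finsum_addf) auto
    also have "finsum R (\<lambda>\<alpha>. y \<otimes> (v \<alpha> \<otimes> monomial R \<alpha> xs)) M = y \<otimes> ?V"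
      using cl mc y M(1) by (intro finsum_rdistr[symmetric]) auto
    finally have eq: "finsum R (\<lambda>\<alpha>. c \<alpha> \<otimes> monomial R \<alpha> xs) M = y \<otimes> ?V \<oplus> ?W" .
    have "\<forall>\<alpha>\<in>M. c \<alpha> = \<zero>" if z: "y \<otimes> ?V \<oplus> ?W = \<zero>"
    proof -
      have z0: "?V = \<zero>" "?W = \<zero>" using transc_zero[OF B(1) y t _ W z] V(1) by blast+
      have "a \<in> M \<rightarrow> A" using va by auto
      then have "\<forall>\<alpha>\<in>M. a \<alpha> = \<zero>" by (rule alg_indepD[OF ind M _ z0(2)])
      then show ?thesis using va V(2) z0(1) y by auto
    qed
    moreover obtain l where "horner R B y d l ?V" using V(1) by blast
    ultimately show ?case unfolding eq using horner.step[OF _ W] by blast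
  qed
  show ?thesis
  proof (rule alg_indepI[OF xsc(2,1)])
    fix M c
    assume *: "finite M" "\<forall>\<alpha>\<in>M. length \<alpha> = length xs" "c \<in> M \<rightarrow> generate_ring R (insert y A)"
      "finsum R (\<lambda>\<alpha>. c \<alpha> \<otimes> monomial R \<alpha> xs) M = \<zero>"
    \<comment> \<open>Finitely many coefficients are padded to a common formal degree, as
      \<open>main\<close> requires.\<close>
    have "\<exists>d. \<forall>\<alpha>\<in>N. \<exists>l. horner R A y d l (c \<alpha>)" if "finite N" "N \<subseteq> M" for N
      using that
    proof (induct N rule: finite_induct)
      case empty then show ?case by simp
    next
      case (insert \<alpha> N)
      then obtain d where d: "\<forall>\<alpha>\<in>N. \<exists>l. horner R A y d l (c \<alpha>)" by auto
      have "c \<alpha> \<in> generate_ring R (insert y A)" using insert * by auto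
      then obtain e l where e: "horner R A y e l (c \<alpha>)" using generate_ring_horner[OF A y] by blast
      show ?case
      proof (rule exI, rule ballI)
        fix \<beta> assume "\<beta> \<in> insert \<alpha> N"
        then show "\<exists>l. horner R A y (max d e) l (c \<beta>)"
          using d e horner_le[OF A y, of _ _ _ "max d e"] by (metis insert_iff max.cobounded1 max.cobounded2)
      qed
    qed
    from this[OF *(1) subset_refl] obtain d where "\<forall>\<alpha>\<in>M. \<exists>l. horner R A y d l (c \<alpha>)" by blast
    from main[OF *(1,2) this] show "\<forall>\<alpha>\<in>M. c \<alpha> = \<zero>" using *(4) by simp
  qed
qed

text \<open>Sorting a relation by powers of \<open>y\<close> gives coefficients in \<open>B\<close>,
  each of them a relation between the \<open>xs\<close> over \<open>A\<close>; all of these vanish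
  because \<open>y\<close> is transcendental over \<open>B\<close>.\<close>

lemma alg_indep_Cons:
  assumes A: "subring A R" and y: "y \<in> carrier R"
    and B: "subring B R" "A \<subseteq> B" "set xs \<subseteq> B"
    and ind: "alg_indep R A xs" and t: "transc R B y"
  shows "alg_indep R A (y # xs)"
proof -
  have xsc: "set xs \<subseteq> carrier R" "distinct xs" using ind by (auto simp: alg_indep_def)
  have Ac: "A \<subseteq> carrier R" using subringE(1)[OF A] .
  note mc = monomial_closed[OF xsc(1)]
  have ysc: "set (y # xs) \<subseteq> carrier R" using y xsc by simp
  note mc' = monomial_closed[OF ysc]
  \<comment> \<open>Otherwise \<open>y\<close> would be a root of the monic linear polynomial X - y
    over \<open>B\<close>.\<close>
  have "y \<notin> set xs"
  proof
    assume "y \<in> set xs"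
    then have "\<ominus> y \<in> B" using B(3) by (intro subringE(5)[OF B(1)]) auto
    then have "horner R B y (Suc 0) \<one> (y \<otimes> \<one> \<oplus> \<ominus> y)"
      using subringE(3)[OF B(1)] by (intro horner.intros)
    then have "horner R B y (Suc 0) \<one> \<zero>" using y by (simp add: r_neg)
    then show False using t unfolding transc_def by (metis one_not_zero)
  qed
  \<comment> \<open>Induction on a strict bound for the exponent of \<open>y\<close>, which is the
    head of each exponent list.\<close>
  have main: "(\<exists>d l. horner R B y d l (finsum R (\<lambda>\<alpha>. c \<alpha> \<otimes> monomial R \<alpha> (y # xs)) M)) \<and>
      (finsum R (\<lambda>\<alpha>. c \<alpha> \<otimes> monomial R \<alpha> (y # xs)) M = \<zero> \<longrightarrow> (\<forall>\<alpha>\<in>M. c \<alpha> = \<zero>))"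
    if "finite M" "\<forall>\<alpha>\<in>M. length \<alpha> = Suc (length xs)" "\<forall>\<alpha>\<in>M. hd \<alpha> < D" "c \<in> M \<rightarrow> A" for M c D
    using that
  proof (induct D arbitrary: M c)
    case 0
    then have "M = {}" by auto
    moreover have "horner R B y 0 \<zero> \<zero>" by (rule horner.base[OF subringE(2)[OF B(1)]])
    ultimately show ?case by (metis empty_iff finsum_empty)
  next
    case (Suc D)
    \<comment> \<open>The terms free of \<open>y\<close> are separated from those divisible by
      \<open>y\<close>; in the latter one factor \<open>y\<close> is taken out, so their exponents
      are lowered by one.\<close>
    define M0 where "M0 = {t. 0 # t \<in> M}"
    define M1 where "M1 = {\<alpha>. \<exists>h t. \<alpha> = h # t \<and> Suc h # t \<in> M}"
    define c0 where "c0 t = c (0 # t)" for t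
    define c1 where "c1 \<alpha> = c (Suc (hd \<alpha>) # tl \<alpha>)" for \<alpha>
    let ?s = "\<lambda>\<alpha>. Suc (hd \<alpha>) # tl \<alpha>"
    have M: "M = (#) 0 ` M0 \<union> ?s ` M1"
    proof (rule Set.set_eqI)
      fix \<alpha>
      show "\<alpha> \<in> M \<longleftrightarrow> \<alpha> \<in> (#) 0 ` M0 \<union> ?s ` M1"
      proof
        assume a: "\<alpha> \<in> M"
        then obtain h t where ht: "\<alpha> = h # t" using Suc(3) by (cases \<alpha>) auto
        show "\<alpha> \<in> (#) 0 ` M0 \<union> ?s ` M1"
        proof (cases h)
          case 0 then show ?thesis using a ht by (auto simp: M0_def)
        next
          case (Suc i)
          then have "i # t \<in> M1" using a ht by (auto simp: M1_def)
          moreover have "\<alpha> = ?s (i # t)" using Suc ht by simp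
          ultimately show ?thesis by blast
        qed
      qed (auto simp: M0_def M1_def)
    qed
    have inj0: "inj_on ((#) 0) M0" by simp
    have inj1: "inj_on ?s M1"
    proof (rule inj_onI)
      fix \<alpha> \<beta> assume "\<alpha> \<in> M1" "\<beta> \<in> M1" "?s \<alpha> = ?s \<beta>"
      then show "\<alpha> = \<beta>" by (auto simp: M1_def)
    qed
    have fin: "finite M0" "finite M1"
      using Suc(2) unfolding M by (auto dest: finite_imageD[OF _ inj0] finite_imageD[OF _ inj1])
    have len0: "\<forall>t\<in>M0. length t = length xs" using Suc(3) by (auto simp: M0_def)
    have len1: "\<forall>\<alpha>\<in>M1. length \<alpha> = Suc (length xs)" "\<forall>\<alpha>\<in>M1. hd \<alpha> < D"
      using Suc(3,4) by (fastforce simp: M1_def)+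
    have cc: "c0 \<in> M0 \<rightarrow> A" "c1 \<in> M1 \<rightarrow> A"
      using Suc(5) by (auto simp: M0_def M1_def c0_def c1_def)
    have ccl: "\<And>t. t \<in> M0 \<Longrightarrow> c0 t \<in> carrier R" "\<And>\<alpha>. \<alpha> \<in> M1 \<Longrightarrow> c1 \<alpha> \<in> carrier R" "\<And>\<alpha>. \<alpha> \<in> M \<Longrightarrow> c \<alpha> \<in> carrier R"
      using cc Suc(5) Ac by auto
    let ?W = "finsum R (\<lambda>t. c0 t \<otimes> monomial R t xs) M0"
    let ?V = "finsum R (\<lambda>\<alpha>. c1 \<alpha> \<otimes> monomial R \<alpha> (y # xs)) M1"
    have V: "\<exists>d l. horner R B y d l ?V" "?V = \<zero> \<longrightarrow> (\<forall>\<alpha>\<in>M1. c1 \<alpha> = \<zero>)"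
      using Suc(1)[OF fin(2) len1 cc(2)] by auto
    have W: "?W \<in> B"
    proof (rule subring_finsum[OF B(1) fin(1)], rule Pi_I)
      fix \<alpha> assume \<alpha>: "\<alpha> \<in> M0"
      have "c0 \<alpha> \<in> B" using \<alpha> cc B(2) by auto
      moreover have "monomial R \<alpha> xs \<in> B" using subring_monomial[OF B(1,3)] len0 \<alpha> by auto
      ultimately show "c0 \<alpha> \<otimes> monomial R \<alpha> xs \<in> B" by (rule subringE(6)[OF B(1)])
    qed
    let ?f = "\<lambda>\<alpha>. c \<alpha> \<otimes> monomial R \<alpha> (y # xs)"
    have fcl: "?f \<in> M \<rightarrow> carrier R" using ccl mc' by auto
    have "finsum R ?f M = finsum R ?f ((#) 0 ` M0) \<oplus> finsum R ?f (?s ` M1)"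
      unfolding M using fin fcl by (intro finsum_Un_disjoint) (auto simp: M)
    also have "finsum R ?f ((#) 0 ` M0) = finsum R (\<lambda>t. ?f (0 # t)) M0"
      using fcl inj0 by (intro finsum_reindex) (auto simp: M)
    also have "\<dots> = ?W"
      using ccl mc y xsc by (intro finsum_cong') (auto simp: c0_def monomial_Cons)
    also have "finsum R ?f (?s ` M1) = finsum R (\<lambda>\<alpha>. ?f (?s \<alpha>)) M1"
      using fcl inj1 by (intro finsum_reindex) (auto simp: M)
    also have "\<dots> = finsum R (\<lambda>\<alpha>. y \<otimes> (c1 \<alpha> \<otimes> monomial R \<alpha> (y # xs))) M1"
    proof (intro finsum_cong' Pi_I refl)
      fix \<alpha> assume \<alpha>: "\<alpha> \<in> M1"
      show "y \<otimes> (c1 \<alpha> \<otimes> monomial R \<alpha> (y # xs)) \<in> carrier R"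
        using ccl(2)[OF \<alpha>] mc' y by simp
      obtain h t where ht: "\<alpha> = h # t" using \<alpha> by (auto simp: M1_def)
      have "c1 \<alpha> \<in> carrier R" "monomial R t xs \<in> carrier R" "y [^] h \<in> carrier R"
        using ccl(2)[OF \<alpha>] mc y by auto
      then show "?f (?s \<alpha>) = y \<otimes> (c1 \<alpha> \<otimes> monomial R \<alpha> (y # xs))"
        using y xsc unfolding ht c1_def by (simp add: monomial_Cons m_ac)
    qed
    also have "\<dots> = y \<otimes> ?V"
      using ccl mc' y fin by (intro finsum_rdistr[symmetric]) auto
    finally have eq: "finsum R ?f M = ?W \<oplus> y \<otimes> ?V" .
    have Vc: "?V \<in> carrier R" using ccl mc' by (intro finsum_closed) auto
    have Wc: "?W \<in> carrier R" using W subringE(1)[OF B(1)] by auto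
    have eq: "finsum R ?f M = y \<otimes> ?V \<oplus> ?W" unfolding eq using Vc Wc y by (simp add: a_comm)
    have "\<forall>\<alpha>\<in>M. c \<alpha> = \<zero>" if z: "y \<otimes> ?V \<oplus> ?W = \<zero>"
    proof -
      have z0: "?V = \<zero>" "?W = \<zero>" using transc_zero[OF B(1) y t _ W z] V(1) by blast+
      have "\<forall>t\<in>M0. c0 t = \<zero>" by (rule alg_indepD[OF ind fin(1) len0 cc(1) z0(2)])
      moreover have "\<forall>\<alpha>\<in>M1. c1 \<alpha> = \<zero>" using V(2) z0 by blast
      ultimately show ?thesis unfolding M by (auto simp: c0_def c1_def)
    qed
    moreover obtain d l where "horner R B y d l ?V" using V(1) by blast
    ultimately show ?case unfolding eq using horner.step[OF _ W] by blast
  qed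
  show ?thesis
  proof (rule alg_indepI[OF _ ysc])
    show "distinct (y # xs)" using xsc \<open>y \<notin> set xs\<close> by simp
    fix M c
    assume *: "finite M" "\<forall>\<alpha>\<in>M. length \<alpha> = length (y # xs)" "c \<in> M \<rightarrow> A"
      "finsum R (\<lambda>\<alpha>. c \<alpha> \<otimes> monomial R \<alpha> (y # xs)) M = \<zero>"
    have "\<forall>\<alpha>\<in>M. hd \<alpha> < Suc (Max (hd ` M))"
      using *(1) by (simp add: less_Suc_eq_le)
    moreover have "\<forall>\<alpha>\<in>M. length \<alpha> = Suc (length xs)" using *(2) by simp
    ultimately show "\<forall>\<alpha>\<in>M. c \<alpha> = \<zero>" using main[of M _ c] *(1,3,4) by blast
  qed
qed

lemma alg_indep_Nil:
  assumes "A \<subseteq> carrier R" shows "alg_indep R A []"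
  unfolding alg_indep_def
proof (intro conjI allI impI ballI)
  fix M c \<alpha>
  assume *: "finite M \<and> (\<forall>\<alpha>\<in>M. length \<alpha> = length ([] :: 'a list)) \<and> c \<in> M \<rightarrow> A \<and>
      finsum R (\<lambda>\<alpha>. c \<alpha> \<otimes> monomial R \<alpha> []) M = \<zero>" and \<alpha>: "\<alpha> \<in> M"
  then have "M = {[]}" "\<alpha> = []" by auto
  moreover from this have "c [] \<in> carrier R" using * assms by auto
  ultimately show "c \<alpha> = \<zero>" using * by (simp add: monomial_def)
qed auto

end

section \<open>Difference fields generated by a generic orbit\<close>

context field begin

lemma add_diff_self:
  assumes "x \<in> carrier R" "y \<in> carrier R" shows "x \<oplus> y \<oplus> \<ominus> x = y"
  using assms by algebra

lemma frac_ring_incl: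
  assumes A: "subring A R" shows "A \<subseteq> frac_ring R A"
  using subringE(1,3)[OF A] by (auto simp: frac_ring_def intro!: bexI[of _ \<one>])

lemma frac_ring_subfield:
  assumes A: "subring A R"
  shows "subfield (frac_ring R A) R"
proof (rule subfieldI')
  note Ac = subringE(1)[OF A, THEN subsetD]
  show "subring (frac_ring R A) R"
  proof (rule subringI)
    show "frac_ring R A \<subseteq> carrier R" by (auto simp: frac_ring_def)
    show "\<one> \<in> frac_ring R A" using frac_ring_incl[OF A] subringE(3)[OF A] by blast
  next
    fix x assume "x \<in> frac_ring R A"
    then obtain q where q: "x \<in> carrier R" "q \<in> A" "q \<noteq> \<zero>" "q \<otimes> x \<in> A" by (auto simp: frac_ring_def)
    then have "q \<otimes> (\<ominus> x) \<in> A" using subringE(5)[OF A q(4)] Ac by (simp add: r_minus)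
    then show "\<ominus> x \<in> frac_ring R A" using q unfolding frac_ring_def by blast
  next
    fix x y assume "x \<in> frac_ring R A" "y \<in> frac_ring R A"
    then obtain q r where q: "x \<in> carrier R" "q \<in> A" "q \<noteq> \<zero>" "q \<otimes> x \<in> A"
      and r: "y \<in> carrier R" "r \<in> A" "r \<noteq> \<zero>" "r \<otimes> y \<in> A" by (auto simp: frac_ring_def)
    have qr: "q \<otimes> r \<in> A" "q \<otimes> r \<noteq> \<zero>"
      using subringE(6)[OF A q(2) r(2)] q r Ac integral by blast+
    have "(q \<otimes> r) \<otimes> (x \<otimes> y) = (q \<otimes> x) \<otimes> (r \<otimes> y)" using q r Ac[OF q(2)] Ac[OF r(2)] by (simp add: m_ac)
    then have "(q \<otimes> r) \<otimes> (x \<otimes> y) \<in> A" using subringE(6)[OF A q(4) r(4)] by simp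
    then show "x \<otimes> y \<in> frac_ring R A" using qr q(1) r(1) unfolding frac_ring_def by blast
    have "(q \<otimes> r) \<otimes> (x \<oplus> y) = r \<otimes> (q \<otimes> x) \<oplus> q \<otimes> (r \<otimes> y)"
      using q(1) r(1) Ac[OF q(2)] Ac[OF r(2)] by algebra
    then have "(q \<otimes> r) \<otimes> (x \<oplus> y) \<in> A"
      using subringE(7)[OF A subringE(6)[OF A r(2) q(4)] subringE(6)[OF A q(2) r(4)]] by simp
    then show "x \<oplus> y \<in> frac_ring R A" using qr q(1) r(1) unfolding frac_ring_def by blast
  qed
next
  note Ac = subringE(1)[OF A, THEN subsetD]
  fix x assume x: "x \<in> frac_ring R A - {\<zero>}"
  then obtain q where q: "x \<in> carrier R" "q \<in> A" "q \<noteq> \<zero>" "q \<otimes> x \<in> A" by (auto simp: frac_ring_def)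
  have u: "inv x \<in> carrier R" "x \<otimes> inv x = \<one>" using x q field_Units by auto
  have "(q \<otimes> x) \<otimes> inv x = q" using u q Ac[OF q(2)] by (simp add: m_assoc)
  moreover have "q \<otimes> x \<noteq> \<zero>" using q x Ac integral by blast
  ultimately show "inv x \<in> frac_ring R A" using q u unfolding frac_ring_def by auto
qed

text \<open>Multiplying a relation by a common denominator of its finitely many coefficients brings
  it back to \<open>A\<close>.\<close>

lemma alg_indep_frac_ring:
  assumes A: "subring A R" and ind: "alg_indep R A xs"
  shows "alg_indep R (frac_ring R A) xs"
proof (rule alg_indepI)
  have xsc: "distinct xs" "set xs \<subseteq> carrier R" using ind by (auto simp: alg_indep_def)
  show "distinct xs" "set xs \<subseteq> carrier R" by fact+
  note mc = monomial_closed[OF xsc(2)]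
  note Ac = subringE(1)[OF A, THEN subsetD]
  fix M c assume M: "finite M" "\<forall>\<alpha>\<in>M. length \<alpha> = length xs" "c \<in> M \<rightarrow> frac_ring R A"
    "finsum R (\<lambda>\<alpha>. c \<alpha> \<otimes> monomial R \<alpha> xs) M = \<zero>"
  obtain cs where cs: "set cs = c ` M" using M(1) finite_list[of "c ` M"] by auto
  then have "set cs \<subseteq> frac_ring R A" using M(3) by auto
  then obtain q where q: "q \<in> A" "q \<noteq> \<zero>" "\<forall>y\<in>set cs. q \<otimes> y \<in> A"
    using common_denominator[OF A] by blast
  have qc: "q \<in> carrier R" using q Ac by blast
  have cc: "c \<in> M \<rightarrow> carrier R" using M(3) by (auto simp: frac_ring_def)
  have "finsum R (\<lambda>\<alpha>. (q \<otimes> c \<alpha>) \<otimes> monomial R \<alpha> xs) M = finsum R (\<lambda>\<alpha>. q \<otimes> (c \<alpha> \<otimes> monomial R \<alpha> xs)) M"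
    using qc cc mc by (intro finsum_cong') (auto simp: m_assoc Pi_iff)
  also have "\<dots> = q \<otimes> finsum R (\<lambda>\<alpha>. c \<alpha> \<otimes> monomial R \<alpha> xs) M"
    using qc cc mc M(1) by (intro finsum_rdistr[symmetric]) auto
  also have "\<dots> = \<zero>" using M(4) qc by simp
  finally have z: "finsum R (\<lambda>\<alpha>. (q \<otimes> c \<alpha>) \<otimes> monomial R \<alpha> xs) M = \<zero>" .
  have "(\<lambda>\<alpha>. q \<otimes> c \<alpha>) \<in> M \<rightarrow> A" using q(3) cs by auto
  from alg_indepD[OF ind M(1,2) this z] have "\<forall>\<alpha>\<in>M. q \<otimes> c \<alpha> = \<zero>" .
  then show "\<forall>\<alpha>\<in>M. c \<alpha> = \<zero>" using q(2) qc cc integral by blast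
qed

end

section \<open>Difference subfields of an inversive difference field\<close>

locale difference_field = field R for R (structure) +
  fixes s
  assumes s_hom: "s \<in> ring_hom R R" and s_bij: "bij_betw s (carrier R) (carrier R)"
begin

lemma s_closed: "x \<in> carrier R \<Longrightarrow> s x \<in> carrier R" using ring_hom_closed[OF s_hom] .
lemma s_inj: "x \<in> carrier R \<Longrightarrow> y \<in> carrier R \<Longrightarrow> s x = s y \<Longrightarrow> x = y"
  using s_bij by (auto simp: bij_betw_def inj_on_def)
lemma s_surj: "y \<in> carrier R \<Longrightarrow> \<exists>x\<in>carrier R. s x = y"
  using s_bij by (metis bij_betw_imp_surj_on imageE)
lemma s_ring_hom_cring: "ring_hom_cring R R s"
  using ring_hom_cring_of_hom[OF is_cring is_cring s_hom] .
lemma s_zero: "s \<zero> = \<zero>" using ring_hom_cring.hom_zero[OF s_ring_hom_cring] .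
lemma s_minus: "x \<in> carrier R \<Longrightarrow> s (\<ominus> x) = \<ominus> s x"
  using ring_hom_cring.hom_a_inv[OF s_ring_hom_cring] .
lemmas s_add = ring_hom_add[OF s_hom]
lemmas s_mult = ring_hom_mult[OF s_hom]
lemmas s_one = ring_hom_one[OF s_hom]

text \<open>The equivalence in \<open>sigma_closed\<close> demands closure under the inverse too.
  Preimages inside the ring are built up from those of the generators, and injectivity of
  \<open>s\<close> makes them the only preimages.\<close>

lemma generate_ring_sigma_closed:
  assumes H: "H \<subseteq> carrier R" and f: "\<And>h. h \<in> H \<Longrightarrow> s h \<in> generate_ring R H"
    and b: "\<And>h. h \<in> H \<Longrightarrow> \<exists>h'\<in>generate_ring R H. s h' = h"
  shows "sigma_closed R s (generate_ring R H)"
  unfolding sigma_closed_def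
proof (intro ballI iffI)
  let ?A = "generate_ring R H"
  have A: "subring ?A R" by (rule generate_ring_is_subring[OF H])
  note Ac = subringE(1)[OF A, THEN subsetD]
  fix y assume y: "y \<in> carrier R"
  show "s y \<in> ?A" if "y \<in> ?A"
    using that
  proof induct
    case one then show ?case using s_one generate_ring.one by simp
  next
    case (incl h) then show ?case using f by simp
  next
    case (a_inv h) then show ?case using s_minus[OF Ac[OF a_inv(1)]] generate_ring.a_inv by simp
  next
    case (eng_add h1 h2)
    then show ?case using s_add[OF Ac[OF eng_add(1)] Ac[OF eng_add(3)]] generate_ring.eng_add by simp
  next
    case (eng_mult h1 h2)
    then show ?case using s_mult[OF Ac[OF eng_mult(1)] Ac[OF eng_mult(3)]] generate_ring.eng_mult by simp
  qed
  have "\<exists>x\<in>?A. s x = z" if "z \<in> ?A" for z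
    using that
  proof induct
    case one then show ?case using s_one generate_ring.one by blast
  next
    case (incl h) then show ?case using b by simp
  next
    case (a_inv h)
    then obtain x where x: "x \<in> ?A" "s x = h" by blast
    then show ?case using s_minus[OF Ac[OF x(1)]] generate_ring.a_inv[OF x(1)] by metis
  next
    case (eng_add h1 h2)
    then obtain x z where x: "x \<in> ?A" "s x = h1" "z \<in> ?A" "s z = h2" by blast
    then show ?case using s_add[OF Ac[OF x(1)] Ac[OF x(3)]] generate_ring.eng_add[OF x(1,3)] by metis
  next
    case (eng_mult h1 h2)
    then obtain x z where x: "x \<in> ?A" "s x = h1" "z \<in> ?A" "s z = h2" by blast
    then show ?case using s_mult[OF Ac[OF x(1)] Ac[OF x(3)]] generate_ring.eng_mult[OF x(1,3)] by metis
  qed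
  then show "y \<in> ?A" if "s y \<in> ?A" using that s_inj[OF _ y] Ac by metis
qed

text \<open>The map \<open>s\<close> acts on denominators in both directions: a denominator of
  \<open>s y\<close> pulls back to a denominator of \<open>y\<close> because \<open>A\<close> is
  closed under preimages.\<close>

lemma frac_ring_sigma_closed:
  assumes A: "subring A R" and sc: "sigma_closed R s A"
  shows "sigma_closed R s (frac_ring R A)"
  unfolding sigma_closed_def
proof (intro ballI iffI)
  note Ac = subringE(1)[OF A, THEN subsetD]
  fix y assume y: "y \<in> carrier R"
  show "s y \<in> frac_ring R A" if y': "y \<in> frac_ring R A"
  proof -
    obtain q where q: "q \<in> A" "q \<noteq> \<zero>" "q \<otimes> y \<in> A" using y' by (auto simp: frac_ring_def)
    have "s q \<in> A" "s (q \<otimes> y) \<in> A" using q sc Ac unfolding sigma_closed_def by blast+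
    moreover have "s q \<noteq> \<zero>" using q Ac s_inj[of q \<zero>] s_zero by auto
    moreover have "s (q \<otimes> y) = s q \<otimes> s y" using q Ac y s_mult by blast
    ultimately show ?thesis using y s_closed unfolding frac_ring_def by auto
  qed
  show "y \<in> frac_ring R A" if y': "s y \<in> frac_ring R A"
  proof -
    obtain q where q: "q \<in> A" "q \<noteq> \<zero>" "q \<otimes> s y \<in> A" using y' by (auto simp: frac_ring_def)
    obtain r where r: "r \<in> carrier R" "s r = q" using s_surj q(1) Ac by blast
    have rA: "r \<in> A" using r q(1) sc unfolding sigma_closed_def by auto
    have "s (r \<otimes> y) = q \<otimes> s y" using r y s_mult by simp
    then have "r \<otimes> y \<in> A" using q(3) r y sc unfolding sigma_closed_def by auto
    moreover have "r \<noteq> \<zero>" using r q(2) s_zero by auto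
    ultimately show ?thesis using y rA unfolding frac_ring_def by auto
  qed
qed

lemma dfield_gen_least: "subfield E R \<Longrightarrow> S \<subseteq> E \<Longrightarrow> sigma_closed R s E \<Longrightarrow> dfield_gen R s S \<subseteq> E"
  unfolding dfield_gen_def by blast

lemma dfield_gen_incl: "S \<subseteq> dfield_gen R s S"
  unfolding dfield_gen_def by blast

text \<open>The intersection runs over a nonempty family, since \<open>carrier R\<close> is itself a
  difference subfield.\<close>

lemma dfield_gen_props:
  assumes S: "S \<subseteq> carrier R"
  shows "subfield (dfield_gen R s S) R" "sigma_closed R s (dfield_gen R s S)"
proof -
  let ?F = "{E. subfield E R \<and> S \<subseteq> E \<and> sigma_closed R s E}"
  have car: "carrier R \<in> ?F"
    using S carrier_is_subfield s_closed by (auto simp: sigma_closed_def)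
  show "sigma_closed R s (dfield_gen R s S)"
    unfolding dfield_gen_def sigma_closed_def by (auto simp: sigma_closed_def)
  show "subfield (dfield_gen R s S) R"
    unfolding dfield_gen_def
  proof (rule subfieldI')
    show "subring (\<Inter>?F) R" using car subfieldE(1) by (intro subring_Inter) auto
    fix k assume k: "k \<in> \<Inter>?F - {\<zero>}"
    show "inv k \<in> \<Inter>?F"
    proof
      fix E assume "E \<in> ?F"
      then have "subfield E R" "k \<in> E - {\<zero>}" using k by auto
      then show "inv k \<in> E" using subfield_m_inv(1) by blast
    qed
  qed
qed

end

lemma trdeg_eq_intro:
  assumes "set xs \<subseteq> E'" "length xs = n" "alg_indep R E xs"
    and "\<And>ys. set ys \<subseteq> E' \<Longrightarrow> length ys = Suc n \<Longrightarrow> \<not> alg_indep R E ys"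
  shows "trdeg_eq R E E' n"
  using assms unfolding trdeg_eq_def by blast

section \<open>Two-sided orbits with independent translates\<close>

text \<open>Independence of the orbit is stated one element at a time: the next element at either
  end of a finite window is transcendental over the ring generated by the window. Empty windows are
  allowed, which covers transcendence over the prime ring.\<close>

locale generic_orbit = difference_field +
  fixes orb :: "int \<Rightarrow> 'a"
  assumes orb_closed: "orb i \<in> carrier R"
    and s_orb: "s (orb i) = orb (i + 1)"
    and transc_up: "l \<le> u \<Longrightarrow> transc R (generate_ring R (orb ` {l..<u})) (orb u)"
    and transc_down: "l \<le> u \<Longrightarrow> transc R (generate_ring R (orb ` {l..<u})) (orb (l - 1))"
begin

text \<open>The translates of the defining tuple: \<open>param n 0\<close> is the tuple itself and
  \<open>s\<close> raises the index by one.\<close>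

definition param :: "nat \<Rightarrow> int \<Rightarrow> 'a" where
  "param n i = orb (i + int n) \<oplus> orb i"

lemma param_closed: "param n i \<in> carrier R" by (simp add: param_def orb_closed)
lemma s_param: "s (param n i) = param n (i + 1)"
  by (simp add: param_def s_add orb_closed s_orb algebra_simps)

lemma window_subring: "subring (generate_ring R (orb ` I)) R"
  using orb_closed by (intro generate_ring_is_subring) auto

lemma orb_window: "i \<in> I \<Longrightarrow> orb i \<in> generate_ring R (orb ` I)"
  by (intro generate_ring.incl) auto

lemma param_subring: "subring (generate_ring R (param n ` I)) R"
  using param_closed by (intro generate_ring_is_subring) auto

lemma param_window:
  assumes "I \<subseteq> J" "(\<lambda>i. i + int n) ` I \<subseteq> J"
  shows "generate_ring R (param n ` I) \<subseteq> generate_ring R (orb ` J)"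
proof (rule generate_ring_min_subring1)
  show "param n ` I \<subseteq> carrier R" using param_closed by auto
  show "subring (generate_ring R (orb ` J)) R" by (rule window_subring)
  show "param n ` I \<subseteq> generate_ring R (orb ` J)"
    using assms by (auto simp: param_def image_subset_iff intro!: generate_ring.eng_add orb_window)
qed

definition start :: "nat \<Rightarrow> 'a list" where "start n = map (\<lambda>i. orb (int i)) [0..<n]"

text \<open>A list is extended at its head, so it is built from \<open>orb (n - 1)\<close>
  downwards, using transcendence at the lower end of the window.\<close>

lemma start_indep: "alg_indep R (generate_ring R {}) (start n)"
proof -
  have "j \<le> n \<Longrightarrow> alg_indep R (generate_ring R {}) (map (\<lambda>i. orb (int i)) [n - j..<n])" for j
  proof (induct j)
    case 0
    have "subring (generate_ring R {}) R" by (intro generate_ring_is_subring) auto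
    then show ?case using alg_indep_Nil[OF subringE(1)] by simp
  next
    case (Suc j)
    let ?B = "generate_ring R (orb ` {int (n - j)..<int n})"
    have "alg_indep R (generate_ring R {}) (orb (int (n - j) - 1) # map (\<lambda>i. orb (int i)) [n - j..<n])"
    proof (rule alg_indep_Cons)
      show "subring (generate_ring R {}) R" by (intro generate_ring_is_subring) auto
      show "subring ?B R" by (rule window_subring)
      show "generate_ring R {} \<subseteq> ?B" by (rule mono_generate_ring) (use orb_closed in auto)
      show "set (map (\<lambda>i. orb (int i)) [n - j..<n]) \<subseteq> ?B" using orb_window by auto
      show "alg_indep R (generate_ring R {}) (map (\<lambda>i. orb (int i)) [n - j..<n])" using Suc by simp
      show "transc R ?B (orb (int (n - j) - 1))" by (rule transc_down) simp
    qed (rule orb_closed)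
    moreover have "[n - Suc j..<n] = (n - Suc j) # [n - j..<n]"
      using Suc(2) by (metis Suc_diff_le Suc_le_eq diff_Suc_Suc diff_less_Suc upt_conv_Cons Suc_diff_Suc diff_less zero_less_Suc less_le_trans)
    moreover have "int (n - Suc j) = int (n - j) - 1" using Suc(2) by linarith
    ultimately show ?case by simp
  qed
  from this[of n] show ?thesis by (simp add: start_def)
qed

text \<open>Going outwards, each new \<open>param n i\<close> is an orbit element outside the current window plus one inside it.\<close>

lemma start_indep_window:
  assumes n: "n > 0"
  shows "alg_indep R (generate_ring R (param n ` {- int N..<int N})) (start n)"
proof (induct N)
  case 0 then show ?case using start_indep by simp
next
  case (Suc N)
  let ?A = "generate_ring R (param n ` {- int N..<int N})"
  let ?y = "param n (int N)"
  let ?A1 = "generate_ring R (insert ?y ?A)"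
  let ?z = "param n (- int N - 1)"
  let ?A2 = "generate_ring R (insert ?z ?A1)"
  \<comment> \<open>The parameters already in \<open>?A\<close> involve exactly the orbit elements
    of indices from -N to N + n - 1. The parameter \<open>?y\<close> brings in index N + n, which
    enlarges the window to \<open>?B1\<close>; then \<open>?z\<close> brings in index -N -
    1.\<close>
  let ?B = "generate_ring R (orb ` {- int N..<int N + int n})"
  let ?B1 = "generate_ring R (orb ` {- int N..<int N + int n + 1})"
  have A: "subring ?A R" by (rule param_subring)
  note Ac = subringE(1)[OF A]
  have A1: "subring ?A1 R" using Ac param_closed by (intro generate_ring_is_subring) auto
  note A1c = subringE(1)[OF A1]
  have sx: "set (start n) \<subseteq> ?B" "set (start n) \<subseteq> ?B1" using orb_window by (auto simp: start_def)
  have AB: "?A \<subseteq> ?B" by (rule param_window) auto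
  have BB1: "?B \<subseteq> ?B1" by (rule mono_generate_ring) (use orb_closed in auto)
  have y: "?y \<in> ?B1" unfolding param_def by (intro generate_ring.eng_add orb_window) auto
  have A1B: "?A1 \<subseteq> ?B1"
  proof (rule generate_ring_min_subring1[OF _ window_subring])
    show "insert ?y ?A \<subseteq> carrier R" using Ac param_closed by auto
    show "insert ?y ?A \<subseteq> ?B1" using y AB BB1 by auto
  qed
  have ty: "transc R ?B ?y"
    unfolding param_def
  proof (rule transc_translate[OF window_subring orb_closed])
    show "transc R ?B (orb (int N + int n))" by (rule transc_up) simp
    show "orb (int N) \<in> ?B" using n by (intro orb_window) auto
  qed
  have tz: "transc R ?B1 ?z"
  proof -
    have "transc R ?B1 (orb (- int N - 1) \<oplus> orb (- int N - 1 + int n))"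
    proof (rule transc_translate[OF window_subring orb_closed])
      show "transc R ?B1 (orb (- int N - 1))" by (rule transc_down) simp
      show "orb (- int N - 1 + int n) \<in> ?B1" using n by (intro orb_window) auto
    qed
    then show ?thesis unfolding param_def using orb_closed by (simp add: a_comm)
  qed
  have "alg_indep R ?A1 (start n)"
    by (rule alg_indep_adjoin_coeff[OF A param_closed window_subring AB sx(1) Suc ty])
  then have "alg_indep R ?A2 (start n)"
    by (rule alg_indep_adjoin_coeff[OF A1 param_closed window_subring A1B sx(2) _ tz])
  moreover have "generate_ring R (param n ` {- int (Suc N)..<int (Suc N)}) \<subseteq> ?A2"
  proof (rule generate_ring_min_subring1)
    show "param n ` {- int (Suc N)..<int (Suc N)} \<subseteq> carrier R" using param_closed by auto
    show "subring ?A2 R" using A1c param_closed by (intro generate_ring_is_subring) auto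
    show "param n ` {- int (Suc N)..<int (Suc N)} \<subseteq> ?A2"
    proof
      fix x assume "x \<in> param n ` {- int (Suc N)..<int (Suc N)}"
      then obtain i where i: "x = param n i" "- int N - 1 \<le> i" "i \<le> int N" by auto
      consider "i = - int N - 1" | "i = int N" | "i \<in> {- int N..<int N}" using i by force
      then show "x \<in> ?A2"
      proof cases
        case 1 then show ?thesis using i by (intro generate_ring.incl) auto
      next
        case 2
        then have "x \<in> ?A1" using i by (intro generate_ring.incl) auto
        then show ?thesis by (intro generate_ring.incl) auto
      next
        case 3
        then have "x \<in> ?A" using i by (intro generate_ring.incl) auto
        then have "x \<in> ?A1" by (intro generate_ring.incl) auto
        then show ?thesis by (intro generate_ring.incl) auto
      qed
    qed
  qed
  ultimately show ?case by (rule alg_indep_mono)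
qed

text \<open>Asking for all larger windows at once lets two bounds be combined by their maximum, with
  no separate monotonicity argument.\<close>

lemma param_range_window:
  assumes "v \<in> generate_ring R (range (param n))"
  shows "\<exists>N. \<forall>N'\<ge>N. v \<in> generate_ring R (param n ` {- int N'..<int N'})"
  using assms
proof induct
  case one then show ?case using generate_ring.one by blast
next
  case (incl h)
  then obtain i where i: "h = param n i" by blast
  show ?case
  proof (intro exI[of _ "nat \<bar>i\<bar> + 1"] allI impI)
    fix N' assume "nat \<bar>i\<bar> + 1 \<le> N'"
    then have "i \<in> {- int N'..<int N'}" by auto
    then show "h \<in> generate_ring R (param n ` {- int N'..<int N'})"
      unfolding i by (intro generate_ring.incl) auto
  qed
next
  case (a_inv h) then show ?case using generate_ring.a_inv by metis
next
  case (eng_add h1 h2)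
  then obtain N M where "\<forall>N'\<ge>N. h1 \<in> generate_ring R (param n ` {- int N'..<int N'})"
    "\<forall>N'\<ge>M. h2 \<in> generate_ring R (param n ` {- int N'..<int N'})" by blast
  then show ?case by (intro exI[of _ "max N M"]) (simp add: generate_ring.eng_add)
next
  case (eng_mult h1 h2)
  then obtain N M where "\<forall>N'\<ge>N. h1 \<in> generate_ring R (param n ` {- int N'..<int N'})"
    "\<forall>N'\<ge>M. h2 \<in> generate_ring R (param n ` {- int N'..<int N'})" by blast
  then show ?case by (intro exI[of _ "max N M"]) (simp add: generate_ring.eng_mult)
qed

text \<open>A relation has finitely many coefficients, so it already lives over a finite symmetric
  window.\<close>

lemma start_indep_range:
  assumes n: "n > 0"
  shows "alg_indep R (generate_ring R (range (param n))) (start n)"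
proof (rule alg_indepI)
  show "distinct (start n)" "set (start n) \<subseteq> carrier R"
    using start_indep_window[OF n, of 0] by (auto simp: alg_indep_def)
  fix M c
  assume M: "finite M" "\<forall>\<alpha>\<in>M. length \<alpha> = length (start n)" "c \<in> M \<rightarrow> generate_ring R (range (param n))"
    "finsum R (\<lambda>\<alpha>. c \<alpha> \<otimes> monomial R \<alpha> (start n)) M = \<zero>"
  have "\<exists>N. \<forall>\<alpha>\<in>L. \<forall>N'\<ge>N. c \<alpha> \<in> generate_ring R (param n ` {- int N'..<int N'})"
    if "finite L" "L \<subseteq> M" for L
    using that
  proof (induct L rule: finite_induct)
    case empty then show ?case by simp
  next
    case (insert \<alpha> L)
    then obtain N where N: "\<forall>\<alpha>\<in>L. \<forall>N'\<ge>N. c \<alpha> \<in> generate_ring R (param n ` {- int N'..<int N'})" by auto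
    have "c \<alpha> \<in> generate_ring R (range (param n))" using insert M(3) by auto
    from param_range_window[OF this] obtain K where
      "\<forall>N'\<ge>K. c \<alpha> \<in> generate_ring R (param n ` {- int N'..<int N'})" by blast
    then show ?case using N by (intro exI[of _ "max N K"]) simp
  qed
  from this[OF M(1) subset_refl] obtain N where
    "\<forall>\<alpha>\<in>M. \<forall>N'\<ge>N. c \<alpha> \<in> generate_ring R (param n ` {- int N'..<int N'})" by blast
  then have "c \<in> M \<rightarrow> generate_ring R (param n ` {- int N..<int N})" by auto
  from alg_indepD[OF start_indep_window[OF n] M(1,2) this M(4)] show "\<forall>\<alpha>\<in>M. c \<alpha> = \<zero>" .
qed

text \<open>For the lower bound, \<open>E\<close> lies in the fractions of the ring generated by all
  translates of the parameter, over which \<open>start n\<close> is independent. For the upper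
  bound, \<open>E'\<close> lies in the fractions of a ring generated over \<open>E\<close> by
  \<open>n\<close> elements.\<close>

theorem deg_sigma_orbit:
  assumes n: "n > 0"
  shows "deg_sigma_eq R s (orb 0) [param n 0] n"
proof -
  define E where "E = dfield_gen R s {param n 0}"
  define E' where "E' = dfield_gen R s (insert (orb 0) E)"
  let ?B = "generate_ring R (range (param n))"
  have bc: "{param n 0} \<subseteq> carrier R" using param_closed by simp
  have E: "subfield E R" "sigma_closed R s E"
    unfolding E_def using dfield_gen_props[OF bc] by auto
  have Ec: "E \<subseteq> carrier R" using subfieldE(3)[OF E(1)] .
  have aE: "insert (orb 0) E \<subseteq> carrier R" using Ec orb_closed by simp
  have E': "subfield E' R" "sigma_closed R s E'"
    unfolding E'_def using dfield_gen_props[OF aE] by auto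
  have B: "subring ?B R" by (rule param_subring)
  have "sigma_closed R s ?B"
  proof (rule generate_ring_sigma_closed)
    show "range (param n) \<subseteq> carrier R" using param_closed by auto
    fix h assume "h \<in> range (param n)"
    then obtain i where i: "h = param n i" by blast
    show "s h \<in> ?B" unfolding i s_param by (intro generate_ring.incl) auto
    have "param n (i - 1) \<in> ?B" by (intro generate_ring.incl) auto
    moreover have "s (param n (i - 1)) = h" unfolding i s_param by simp
    ultimately show "\<exists>h'\<in>?B. s h' = h" by blast
  qed
  then have EB: "E \<subseteq> frac_ring R ?B"
    unfolding E_def
  proof (intro dfield_gen_least frac_ring_subfield frac_ring_sigma_closed B)
    have "param n 0 \<in> ?B" by (intro generate_ring.incl) auto
    then show "{param n 0} \<subseteq> frac_ring R ?B" using frac_ring_incl[OF B] by auto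
  qed
  have ind: "alg_indep R E (start n)"
    by (rule alg_indep_mono[OF alg_indep_frac_ring[OF B start_indep_range[OF n]] EB])
  have orbE': "orb (int i) \<in> E'" for i
  proof (induct i)
    case 0 then show ?case unfolding E'_def using dfield_gen_incl by fastforce
  next
    case (Suc i)
    then have "s (orb (int i)) \<in> E'" using E'(2) orb_closed unfolding sigma_closed_def by blast
    then show ?case by (simp add: s_orb add.commute)
  qed
  let ?A = "generate_ring R (E \<union> set (start n))"
  have xc: "set (start n) \<subseteq> carrier R" using orb_closed by (auto simp: start_def)
  have EX: "E \<union> set (start n) \<subseteq> carrier R" using Ec xc by simp
  have A: "subring ?A R" by (rule generate_ring_is_subring[OF EX])
  have EA: "E \<subseteq> ?A" by (auto intro: generate_ring.incl)
  have xA: "orb (int i) \<in> ?A" if "i < n" for i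
    using that by (intro generate_ring.incl) (auto simp: start_def)
  have bE: "param n 0 \<in> E" unfolding E_def using dfield_gen_incl by fastforce
  \<comment> \<open>Closure of \<open>E\<close> under the inverse of \<open>s\<close> supplies the
    preimage of the parameter.\<close>
  have bE1: "param n (- 1) \<in> E"
  proof -
    have "s (param n (- 1)) \<in> E" using bE by (simp add: s_param)
    then show ?thesis using E(2) param_closed unfolding sigma_closed_def by blast
  qed
  have scA: "sigma_closed R s ?A"
  proof (rule generate_ring_sigma_closed[OF EX])
    fix h assume h: "h \<in> E \<union> set (start n)"
    show "s h \<in> ?A"
    proof (cases "h \<in> E")
      case True
      then have "s h \<in> E" using E(2) Ec unfolding sigma_closed_def by blast
      then show ?thesis using EA by blast
    next
      case False
      then obtain i where i: "i < n" "h = orb (int i)" using h by (auto simp: start_def)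
      then have sh: "s h = orb (int (Suc i))" by (simp add: s_orb add.commute)
      show ?thesis
      proof (cases "Suc i < n")
        case True then show ?thesis unfolding sh by (rule xA)
      next
        case False
        then have "int (Suc i) = int n" using i by simp
        then have sh: "s h = orb (int n)" using sh by simp
        \<comment> \<open>Only \<open>orb (n - 1)\<close> is moved out of the list by
          \<open>s\<close>; its image is the parameter minus \<open>orb 0\<close>.\<close>
        have "param n 0 \<oplus> \<ominus> orb 0 = orb (int n)" unfolding param_def using orb_closed
          by (simp add: a_assoc r_neg)
        moreover have "param n 0 \<oplus> \<ominus> orb 0 \<in> ?A"
          using bE EA xA[of 0] n by (intro subringE(5,7)[OF A]) auto
        ultimately show ?thesis unfolding sh by simp
      qed
    qed
    show "\<exists>h'\<in>?A. s h' = h"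
    proof (cases "h \<in> E")
      case True
      obtain x where x: "x \<in> carrier R" "s x = h" using s_surj True Ec by blast
      then have "x \<in> E" using True E(2) unfolding sigma_closed_def by blast
      then show ?thesis using x EA by blast
    next
      case False
      then obtain i where i: "i < n" "h = orb (int i)" using h by (auto simp: start_def)
      have s': "s (orb (int i - 1)) = h" using i by (simp add: s_orb)
      have "orb (int i - 1) \<in> ?A"
      proof (cases i)
        case 0
        \<comment> \<open>Only \<open>orb 0\<close> has its preimage outside the list. As
          \<open>param n (- 1)\<close> is \<open>orb (n - 1)\<close> plus \<open>orb (- 1)\<close>,
          subtraction yields that preimage.\<close>
        have eq: "- 1 + int n = int (n - 1)" using n by simp
        have "param n (- 1) \<oplus> \<ominus> orb (int (n - 1)) = orb (int i - 1)"
          using add_diff_self[OF orb_closed[of "int (n - 1)"] orb_closed[of "- 1"]]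
          unfolding param_def eq 0 by simp
        moreover have "param n (- 1) \<oplus> \<ominus> orb (int (n - 1)) \<in> ?A"
          using bE1 EA xA[of "n - 1"] n by (intro subringE(5,7)[OF A]) auto
        ultimately show ?thesis by simp
      next
        case (Suc j)
        then show ?thesis using xA[of j] i by simp
      qed
      then show ?thesis using s' by blast
    qed
  qed
  have E'A: "E' \<subseteq> frac_ring R ?A"
    unfolding E'_def
  proof (intro dfield_gen_least frac_ring_subfield frac_ring_sigma_closed A scA)
    have "orb 0 \<in> ?A" using xA[of 0] n by simp
    then show "insert (orb 0) E \<subseteq> frac_ring R ?A" using EA frac_ring_incl[OF A] by auto
  qed
  have F: "field_over R E" using E(1) field_axioms by (simp add: field_over_def field_over_axioms_def)
  have "trdeg_eq R E E' n"
  proof (rule trdeg_eq_intro[OF _ _ ind])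
    show "set (start n) \<subseteq> E'" using orbE' by (auto simp: start_def)
    show "length (start n) = n" by (simp add: start_def)
    fix ys assume "set ys \<subseteq> E'" "length ys = Suc n"
    then show "\<not> alg_indep R E ys"
      using E'A by (intro field_over.frac_not_alg_indep[OF F xc]) (auto simp: start_def)
  qed
  then show ?thesis unfolding deg_sigma_eq_def Let_def E'_def E_def by simp
qed

end

section \<open>Ultraproducts of fields\<close>

text \<open>Zorn's lemma is applied to the proper filters that contain every cofinite set; this
  condition keeps singletons out of a maximal one.\<close>

lemma nonprincipal_ultrafilter_exists:
  assumes inf: "infinite P"
  shows "\<exists>U. nonprincipal_ultrafilter_on P U"
proof -
  define \<F> where "\<F> = {F. F \<subseteq> Pow P \<and> {} \<notin> F \<and> (\<forall>A. finite A \<longrightarrow> P - A \<in> F) \<and>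
     (\<forall>A B. A \<in> F \<and> A \<subseteq> B \<and> B \<subseteq> P \<longrightarrow> B \<in> F) \<and> (\<forall>A B. A \<in> F \<and> B \<in> F \<longrightarrow> A \<inter> B \<in> F)}"
  define N where "N = {B. B \<subseteq> P \<and> finite (P - B)}"
  have cof: "N \<in> \<F>"
    unfolding \<F>_def mem_Collect_eq
  proof (intro conjI allI impI)
    fix A B assume "A \<in> N \<and> B \<in> N"
    then show "A \<inter> B \<in> N" by (auto simp: N_def Diff_Int)
  next
    fix A B assume "A \<in> N \<and> A \<subseteq> B \<and> B \<subseteq> P"
    then show "B \<in> N" by (auto simp: N_def intro: finite_subset[of "P - B" "P - A"])
  qed (use inf in \<open>auto simp: N_def Diff_Diff_Int\<close>)
  have F1: "F \<subseteq> Pow P" and F2: "{} \<notin> F" and F3: "finite A \<Longrightarrow> P - A \<in> F"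
    and F4: "A \<in> F \<Longrightarrow> A \<subseteq> B \<Longrightarrow> B \<subseteq> P \<Longrightarrow> B \<in> F" and F5: "A \<in> F \<Longrightarrow> B \<in> F \<Longrightarrow> A \<inter> B \<in> F"
    if "F \<in> \<F>" for F A B
    using that unfolding \<F>_def mem_Collect_eq by (simp, simp, simp, metis, metis)
  have "\<exists>M\<in>\<F>. \<forall>Y\<in>\<F>. M \<subseteq> Y \<longrightarrow> Y = M"
  proof (rule subset_Zorn_nonempty)
    show "\<F> \<noteq> {}" using cof by blast
    fix \<C> assume ne: "\<C> \<noteq> {}" and ch: "subset.chain \<F> \<C>"
    then have sub: "\<And>F. F \<in> \<C> \<Longrightarrow> F \<in> \<F>" by (auto simp: subset.chain_def)
    have tot: "\<And>F G. F \<in> \<C> \<Longrightarrow> G \<in> \<C> \<Longrightarrow> F \<subseteq> G \<or> G \<subseteq> F" using ch by (auto simp: subset.chain_def)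
    show "\<Union> \<C> \<in> \<F>"
      unfolding \<F>_def mem_Collect_eq
    proof (intro conjI allI impI)
      show "\<Union> \<C> \<subseteq> Pow P" using F1[OF sub] by blast
      show "{} \<notin> \<Union> \<C>" using F2[OF sub] by blast
      show "P - A \<in> \<Union> \<C>" if "finite A" for A using ne F3[OF sub that] by blast
      show "B \<in> \<Union> \<C>" if AB: "A \<in> \<Union> \<C> \<and> A \<subseteq> B \<and> B \<subseteq> P" for A B
      proof -
        obtain F where F: "A \<in> F" "F \<in> \<C>" using AB by blast
        then have "B \<in> F" using F4[OF sub[OF F(2)] F(1)] AB by blast
        then show ?thesis using F by blast
      qed
      show "A \<inter> B \<in> \<Union> \<C>" if AB: "A \<in> \<Union> \<C> \<and> B \<in> \<Union> \<C>" for A B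
      proof -
        obtain F G where FG: "A \<in> F" "F \<in> \<C>" "B \<in> G" "G \<in> \<C>" using AB by blast
        then obtain H where H: "H \<in> \<C>" "A \<in> H" "B \<in> H" using tot[OF FG(2,4)] by blast
        then have "A \<inter> B \<in> H" using F5[OF sub[OF H(1)]] by blast
        then show ?thesis using H by blast
      qed
    qed
  qed
  then obtain U where U: "U \<in> \<F>" "\<And>Y. Y \<in> \<F> \<Longrightarrow> U \<subseteq> Y \<Longrightarrow> Y = U" by blast
  have props: "U \<subseteq> Pow P" "{} \<notin> U" "\<And>A. finite A \<Longrightarrow> P - A \<in> U"
    "\<And>A B. A \<in> U \<Longrightarrow> A \<subseteq> B \<Longrightarrow> B \<subseteq> P \<Longrightarrow> B \<in> U" "\<And>A B. A \<in> U \<Longrightarrow> B \<in> U \<Longrightarrow> A \<inter> B \<in> U"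
    by (rule F1[OF U(1)], rule F2[OF U(1)], rule F3[OF U(1)], assumption, rule F4[OF U(1)], assumption+, rule F5[OF U(1)], assumption+)
  have PU: "P \<in> U" using props(3)[of "{}"] by simp
  have ultra: "P - A \<in> U" if A: "A \<subseteq> P" "A \<notin> U" for A
  proof -
    \<comment> \<open>The filter generated by \<open>U\<close> and \<open>P - A\<close>. It is
      proper, since a member of \<open>U\<close> inside \<open>A\<close> would force
      \<open>A\<close> into \<open>U\<close>; maximality then gives \<open>G = U\<close>.\<close>
    define G where "G = {B. B \<subseteq> P \<and> (\<exists>C\<in>U. C \<inter> (P - A) \<subseteq> B)}"
    have "G \<in> \<F>"
      unfolding \<F>_def mem_Collect_eq
    proof (intro conjI allI impI)
      show "G \<subseteq> Pow P" by (auto simp: G_def)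
      show "{} \<notin> G"
      proof
        assume "{} \<in> G"
        then obtain C where C: "C \<in> U" "C \<inter> (P - A) \<subseteq> {}" by (auto simp: G_def)
        then have "C \<subseteq> A" using props(1) by blast
        then show False using props(4)[OF C(1)] A by blast
      qed
      show "P - B \<in> G" if "finite B" for B using props(3)[OF that] by (auto simp: G_def)
      show "B \<in> G" if "C \<in> G \<and> C \<subseteq> B \<and> B \<subseteq> P" for B C using that by (auto simp: G_def)
      show "B \<inter> C \<in> G" if BC: "B \<in> G \<and> C \<in> G" for B C
      proof -
        have B: "B \<subseteq> P" "\<exists>B'\<in>U. B' \<inter> (P - A) \<subseteq> B" using BC unfolding G_def by simp_all
        have C: "\<exists>C'\<in>U. C' \<inter> (P - A) \<subseteq> C" using BC unfolding G_def by simp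
        obtain B' where B': "B' \<in> U" "B' \<inter> (P - A) \<subseteq> B" using B(2) by (elim bexE)
        obtain C' where C': "C' \<in> U" "C' \<inter> (P - A) \<subseteq> C" using C by (elim bexE)
        have "(B' \<inter> C') \<inter> (P - A) \<subseteq> B \<inter> C" using B'(2) C'(2) by fast
        then show ?thesis using props(5)[OF B'(1) C'(1)] B(1) unfolding G_def by blast
      qed
    qed
    moreover have "U \<subseteq> G" using props(1) by (auto simp: G_def)
    ultimately have "G = U" by (rule U(2))
    moreover have "P - A \<in> G" using PU by (auto simp: G_def)
    ultimately show ?thesis by simp
  qed
  have sing: "{p} \<notin> U" for p
  proof
    assume p: "{p} \<in> U"
    have "P - {p} \<in> U" by (rule props(3)) simp
    then have "{p} \<inter> (P - {p}) \<in> U" by (rule props(5)[OF p])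
    then show False using props(2) by simp
  qed
  have "nonprincipal_ultrafilter_on P U"
    unfolding nonprincipal_ultrafilter_on_def
  proof (intro conjI allI impI)
    show "B \<in> U" if "A \<in> U \<and> A \<subseteq> B \<and> B \<subseteq> P" for A B using props(4)[of A B] that by simp
    show "A \<inter> B \<in> U" if "A \<in> U \<and> B \<in> U" for A B using props(5)[of A B] that by simp
    show "A \<in> U \<or> P - A \<in> U" if "A \<subseteq> P" for A using ultra[OF that] by (cases "A \<in> U") simp_all
  qed (use props(1,2) PU sing in simp_all)
  then show ?thesis ..
qed

section \<open>Field structure of the ultraproduct\<close>

locale field_ultraproduct =
  fixes K :: "nat \<Rightarrow> nat ring" and U :: "nat set set"
  assumes U: "nonprincipal_ultrafilter_on Primes U"
    and K_field: "Factorial_Ring.prime p \<Longrightarrow> field (K p)"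
    and K_fin: "Factorial_Ring.prime p \<Longrightarrow> finite (carrier (K p))"
    and K_char: "Factorial_Ring.prime p \<Longrightarrow> int_emb (K p) (int p) = \<zero>\<^bsub>K p\<^esub>"
begin

lemma K_ring: "Factorial_Ring.prime p \<Longrightarrow> ring (K p)"
  and K_cring: "Factorial_Ring.prime p \<Longrightarrow> cring (K p)"
  and K_domain: "Factorial_Ring.prime p \<Longrightarrow> domain (K p)"
  using K_field by (auto simp: field_def domain_def cring_def)

text \<open>The ultrafilter read as a quantifier "for almost all primes". Its axioms become rules
  for implication, conjunction and negation.\<close>

definition ae :: "(nat \<Rightarrow> bool) \<Rightarrow> bool" where
  "ae Q \<longleftrightarrow> {p \<in> Primes. Q p} \<in> U"

lemma ae_mono: "ae Q \<Longrightarrow> (\<And>p. Factorial_Ring.prime p \<Longrightarrow> Q p \<Longrightarrow> Q' p) \<Longrightarrow> ae Q'"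
proof -
  assume Q: "ae Q" "\<And>p. Factorial_Ring.prime p \<Longrightarrow> Q p \<Longrightarrow> Q' p"
  have "{p \<in> Primes. Q p} \<subseteq> {p \<in> Primes. Q' p}" "{p \<in> Primes. Q' p} \<subseteq> Primes" using Q(2) by auto
  then show ?thesis using Q(1) U unfolding ae_def nonprincipal_ultrafilter_on_def by blast
qed

lemma ae_conj: "ae Q \<Longrightarrow> ae Q' \<Longrightarrow> ae (\<lambda>p. Q p \<and> Q' p)"
proof -
  assume "ae Q" "ae Q'"
  then have "{p \<in> Primes. Q p} \<inter> {p \<in> Primes. Q' p} \<in> U"
    using U unfolding ae_def nonprincipal_ultrafilter_on_def by blast
  moreover have "{p \<in> Primes. Q p} \<inter> {p \<in> Primes. Q' p} = {p \<in> Primes. Q p \<and> Q' p}" by auto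
  ultimately show ?thesis unfolding ae_def by simp
qed

lemma ae_all: "(\<And>p. Factorial_Ring.prime p \<Longrightarrow> Q p) \<Longrightarrow> ae Q"
proof -
  assume "\<And>p. Factorial_Ring.prime p \<Longrightarrow> Q p"
  then have "{p \<in> Primes. Q p} = Primes" by auto
  then show ?thesis using U unfolding ae_def nonprincipal_ultrafilter_on_def by simp
qed

lemma ae_not: "\<not> ae Q \<Longrightarrow> ae (\<lambda>p. \<not> Q p)"
proof -
  assume "\<not> ae Q"
  moreover have "{p \<in> Primes. Q p} \<subseteq> Primes" by auto
  ultimately have "Primes - {p \<in> Primes. Q p} \<in> U"
    using U unfolding ae_def nonprincipal_ultrafilter_on_def by blast
  moreover have "Primes - {p \<in> Primes. Q p} = {p \<in> Primes. \<not> Q p}" by auto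
  ultimately show ?thesis unfolding ae_def by simp
qed

lemma ae_False: "\<not> ae (\<lambda>p. False)"
  using U unfolding ae_def nonprincipal_ultrafilter_on_def by simp

text \<open>Nonprincipality in the form in which it is used: every single prime, hence every finite
  set of primes, may be discarded.\<close>

lemma ae_ge: "ae (\<lambda>p. p > N)"
proof (induct N)
  case 0 show ?case by (rule ae_all) (simp add: prime_gt_0_nat)
next
  case (Suc N)
  have "\<not> ae (\<lambda>p. p = Suc N)"
  proof
    assume a: "ae (\<lambda>p. p = Suc N)"
    have "{p \<in> Primes. p = Suc N} = {} \<or> {p \<in> Primes. p = Suc N} = {Suc N}" by auto
    then show False using a U unfolding ae_def nonprincipal_ultrafilter_on_def by metis
  qed
  then have "ae (\<lambda>p. p \<noteq> Suc N)" by (rule ae_not)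
  from ae_conj[OF Suc this] show ?case by (rule ae_mono) auto
qed

text \<open>Unlike \<open>urep_set\<close>, this prescribes no value outside the primes, so
  unrestricted lambda terms can serve as representatives; \<open>cl_restrict\<close> shows that the
  class does not notice.\<close>

definition fam :: "(nat \<Rightarrow> nat) \<Rightarrow> bool" where
  "fam g \<longleftrightarrow> (\<forall>p. Factorial_Ring.prime p \<longrightarrow> g p \<in> carrier (K p))"

abbreviation "cl \<equiv> uclass K U"
abbreviation "F \<equiv> ultraprod K U"
abbreviation "\<sigma> \<equiv> ufrob K U"

lemma famD: "fam g \<Longrightarrow> Factorial_Ring.prime p \<Longrightarrow> g p \<in> carrier (K p)" by (simp add: fam_def)

lemma cl_restrict: "cl (restrict g Primes) = cl g"
proof -
  have "{p \<in> Primes. restrict g Primes p = h p} = {p \<in> Primes. g p = h p}" for h by auto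
  then show ?thesis unfolding uclass_def by simp
qed

lemma restrict_urep_set: "fam g \<Longrightarrow> restrict g Primes \<in> urep_set K"
  by (auto simp: fam_def urep_set_def)

lemma urep_set_fam: "g \<in> urep_set K \<Longrightarrow> fam g"
  by (auto simp: fam_def urep_set_def)

lemma in_cl: "h \<in> cl g \<longleftrightarrow> h \<in> urep_set K \<and> ae (\<lambda>p. g p = h p)"
  by (simp add: uclass_def ae_def)

lemma cl_eqI: "ae (\<lambda>p. g p = h p) \<Longrightarrow> cl g = cl h"
proof -
  assume a: "ae (\<lambda>p. g p = h p)"
  have "ae (\<lambda>p. g p = f p) \<longleftrightarrow> ae (\<lambda>p. h p = f p)" for f
  proof
    assume "ae (\<lambda>p. g p = f p)"
    from ae_conj[OF this a] show "ae (\<lambda>p. h p = f p)" by (rule ae_mono) auto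
  next
    assume "ae (\<lambda>p. h p = f p)"
    from ae_conj[OF this a] show "ae (\<lambda>p. g p = f p)" by (rule ae_mono) auto
  qed
  then show ?thesis by (auto simp: in_cl)
qed

lemma cl_cong: "(\<And>p. Factorial_Ring.prime p \<Longrightarrow> g p = h p) \<Longrightarrow> cl g = cl h"
  by (intro cl_eqI ae_all) simp

text \<open>The hypothesis on \<open>g\<close> guarantees that its class is inhabited; equality of
  two empty classes would say nothing about the functions.\<close>

lemma cl_eqD: "fam g \<Longrightarrow> cl g = cl h \<Longrightarrow> ae (\<lambda>p. g p = h p)"
proof -
  assume g: "fam g" "cl g = cl h"
  have "restrict g Primes \<in> cl g"
    unfolding in_cl using restrict_urep_set[OF g(1)] by (auto intro: ae_all)
  then have "ae (\<lambda>p. h p = restrict g Primes p)" using g(2) by (simp add: in_cl)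
  then show ?thesis by (rule ae_mono) simp
qed

text \<open>The operations of \<open>ultraprod\<close> act on chosen representatives. That the
  choice agrees with \<open>g\<close> almost everywhere makes them computable on any
  representative.\<close>

lemma urep_cl:
  assumes "fam g" shows "fam (urep (cl g))" "ae (\<lambda>p. urep (cl g) p = g p)"
proof -
  have "restrict g Primes \<in> cl g"
    unfolding in_cl using restrict_urep_set[OF assms(1)] by (auto intro: ae_all)
  then have "urep (cl g) \<in> cl g" unfolding urep_def by (rule someI[of "\<lambda>h. h \<in> cl g"])
  then show "fam (urep (cl g))" "ae (\<lambda>p. urep (cl g) p = g p)"
    using urep_set_fam by (auto simp: in_cl intro: ae_mono)
qed

lemma carrier_F: "carrier F = cl ` Collect fam"
proof -
  have "cl ` urep_set K = cl ` Collect fam"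
  proof
    show "cl ` urep_set K \<subseteq> cl ` Collect fam" using urep_set_fam by blast
    show "cl ` Collect fam \<subseteq> cl ` urep_set K"
      using restrict_urep_set cl_restrict by (metis image_subsetI imageI mem_Collect_eq)
  qed
  then show ?thesis by (simp add: ultraprod_def)
qed

lemma cl_closed: "fam g \<Longrightarrow> cl g \<in> carrier F" by (auto simp: carrier_F)

lemma carrier_FE: "x \<in> carrier F \<Longrightarrow> (\<And>g. fam g \<Longrightarrow> x = cl g \<Longrightarrow> thesis) \<Longrightarrow> thesis"
  by (auto simp: carrier_F)

lemma one_F: "\<one>\<^bsub>F\<^esub> = cl (\<lambda>p. \<one>\<^bsub>K p\<^esub>)" by (simp add: ultraprod_def cl_restrict)
lemma zero_F: "\<zero>\<^bsub>F\<^esub> = cl (\<lambda>p. \<zero>\<^bsub>K p\<^esub>)" by (simp add: ultraprod_def cl_restrict)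

lemma mult_F:
  assumes "fam g" "fam h" shows "cl g \<otimes>\<^bsub>F\<^esub> cl h = cl (\<lambda>p. g p \<otimes>\<^bsub>K p\<^esub> h p)"
proof -
  have "cl g \<otimes>\<^bsub>F\<^esub> cl h = cl (\<lambda>p. urep (cl g) p \<otimes>\<^bsub>K p\<^esub> urep (cl h) p)"
    by (simp add: ultraprod_def cl_restrict)
  also have "\<dots> = cl (\<lambda>p. g p \<otimes>\<^bsub>K p\<^esub> h p)"
    by (rule cl_eqI, rule ae_mono[OF ae_conj[OF urep_cl(2)[OF assms(1)] urep_cl(2)[OF assms(2)]]]) simp
  finally show ?thesis .
qed

lemma add_F:
  assumes "fam g" "fam h" shows "cl g \<oplus>\<^bsub>F\<^esub> cl h = cl (\<lambda>p. g p \<oplus>\<^bsub>K p\<^esub> h p)"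
proof -
  have "cl g \<oplus>\<^bsub>F\<^esub> cl h = cl (\<lambda>p. urep (cl g) p \<oplus>\<^bsub>K p\<^esub> urep (cl h) p)"
    by (simp add: ultraprod_def cl_restrict)
  also have "\<dots> = cl (\<lambda>p. g p \<oplus>\<^bsub>K p\<^esub> h p)"
    by (rule cl_eqI, rule ae_mono[OF ae_conj[OF urep_cl(2)[OF assms(1)] urep_cl(2)[OF assms(2)]]]) simp
  finally show ?thesis .
qed

lemma frob_F:
  assumes "fam g" shows "\<sigma> (cl g) = cl (\<lambda>p. g p [^]\<^bsub>K p\<^esub> p)"
proof -
  have "\<sigma> (cl g) = cl (\<lambda>p. urep (cl g) p [^]\<^bsub>K p\<^esub> p)"
    by (simp add: ufrob_def cl_restrict)
  also have "\<dots> = cl (\<lambda>p. g p [^]\<^bsub>K p\<^esub> p)"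
    by (rule cl_eqI, rule ae_mono[OF urep_cl(2)[OF assms]]) simp
  finally show ?thesis .
qed

lemmas K_closed = ring.ring_simprules(1-3,5,6)[OF K_ring]

lemma fam_one: "fam (\<lambda>p. \<one>\<^bsub>K p\<^esub>)" and fam_zero: "fam (\<lambda>p. \<zero>\<^bsub>K p\<^esub>)"
  by (simp_all add: fam_def K_closed)

lemma fam_add: "fam g \<Longrightarrow> fam h \<Longrightarrow> fam (\<lambda>p. g p \<oplus>\<^bsub>K p\<^esub> h p)"
  and fam_mult: "fam g \<Longrightarrow> fam h \<Longrightarrow> fam (\<lambda>p. g p \<otimes>\<^bsub>K p\<^esub> h p)"
  and fam_minus: "fam g \<Longrightarrow> fam (\<lambda>p. \<ominus>\<^bsub>K p\<^esub> g p)"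
  by (simp_all add: fam_def K_closed)

lemma fam_pow: "fam g \<Longrightarrow> fam (\<lambda>p. g p [^]\<^bsub>K p\<^esub> (e p :: nat))"
  unfolding fam_def using monoid.nat_pow_closed[OF ring.is_monoid[OF K_ring]] by blast

lemma F_cring: "cring F"
proof (rule cringI)
  show "abelian_group F"
  proof (rule abelian_groupI)
    show "\<zero>\<^bsub>F\<^esub> \<in> carrier F" unfolding zero_F by (intro cl_closed fam_zero)
    fix x assume x: "x \<in> carrier F"
    then obtain g where g: "fam g" "x = cl g" by (rule carrier_FE)
    show "\<zero>\<^bsub>F\<^esub> \<oplus>\<^bsub>F\<^esub> x = x"
      unfolding zero_F g(2) add_F[OF fam_zero g(1)]
      by (rule cl_cong) (simp add: ring.ring_simprules(8)[OF K_ring] famD[OF g(1)])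
    show "\<exists>y\<in>carrier F. y \<oplus>\<^bsub>F\<^esub> x = \<zero>\<^bsub>F\<^esub>"
    proof
      show "cl (\<lambda>p. \<ominus>\<^bsub>K p\<^esub> g p) \<in> carrier F" by (intro cl_closed fam_minus g)
      show "cl (\<lambda>p. \<ominus>\<^bsub>K p\<^esub> g p) \<oplus>\<^bsub>F\<^esub> x = \<zero>\<^bsub>F\<^esub>"
        unfolding zero_F g(2) add_F[OF fam_minus[OF g(1)] g(1)]
        by (rule cl_cong) (simp add: ring.ring_simprules(9)[OF K_ring] famD[OF g(1)])
    qed
    fix y assume "y \<in> carrier F"
    then obtain h where h: "fam h" "y = cl h" by (rule carrier_FE)
    show "x \<oplus>\<^bsub>F\<^esub> y \<in> carrier F" unfolding g(2) h(2) add_F[OF g(1) h(1)] by (intro cl_closed fam_add g h)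
    show "x \<oplus>\<^bsub>F\<^esub> y = y \<oplus>\<^bsub>F\<^esub> x" unfolding g(2) h(2) add_F[OF g(1) h(1)] add_F[OF h(1) g(1)]
      by (rule cl_cong) (intro ring.ring_simprules(10) K_ring famD[OF g(1)] famD[OF h(1)])
    fix z assume "z \<in> carrier F"
    then obtain f where f: "fam f" "z = cl f" by (rule carrier_FE)
    show "x \<oplus>\<^bsub>F\<^esub> y \<oplus>\<^bsub>F\<^esub> z = x \<oplus>\<^bsub>F\<^esub> (y \<oplus>\<^bsub>F\<^esub> z)"
      unfolding g(2) h(2) f(2) add_F[OF g(1) h(1)] add_F[OF h(1) f(1)] add_F[OF fam_add[OF g(1) h(1)] f(1)]
        add_F[OF g(1) fam_add[OF h(1) f(1)]]
      by (rule cl_cong) (simp add: ring.ring_simprules(7)[OF K_ring] famD[OF g(1)] famD[OF h(1)] famD[OF f(1)])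
  qed
  show "comm_monoid F"
  proof (rule comm_monoidI)
    show "\<one>\<^bsub>F\<^esub> \<in> carrier F" unfolding one_F by (intro cl_closed fam_one)
    fix x assume x: "x \<in> carrier F"
    then obtain g where g: "fam g" "x = cl g" by (rule carrier_FE)
    show "\<one>\<^bsub>F\<^esub> \<otimes>\<^bsub>F\<^esub> x = x"
      unfolding one_F g(2) mult_F[OF fam_one g(1)]
      by (rule cl_cong) (simp add: monoid.l_one[OF ring.is_monoid[OF K_ring]] famD[OF g(1)])
    fix y assume "y \<in> carrier F"
    then obtain h where h: "fam h" "y = cl h" by (rule carrier_FE)
    show "x \<otimes>\<^bsub>F\<^esub> y \<in> carrier F" unfolding g(2) h(2) mult_F[OF g(1) h(1)] by (intro cl_closed fam_mult g h)
    show "x \<otimes>\<^bsub>F\<^esub> y = y \<otimes>\<^bsub>F\<^esub> x" unfolding g(2) h(2) mult_F[OF g(1) h(1)] mult_F[OF h(1) g(1)]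
      by (rule cl_cong) (intro cring.cring_simprules(14) K_cring famD[OF g(1)] famD[OF h(1)])
    fix z assume "z \<in> carrier F"
    then obtain f where f: "fam f" "z = cl f" by (rule carrier_FE)
    show "x \<otimes>\<^bsub>F\<^esub> y \<otimes>\<^bsub>F\<^esub> z = x \<otimes>\<^bsub>F\<^esub> (y \<otimes>\<^bsub>F\<^esub> z)"
      unfolding g(2) h(2) f(2) mult_F[OF g(1) h(1)] mult_F[OF h(1) f(1)] mult_F[OF fam_mult[OF g(1) h(1)] f(1)]
        mult_F[OF g(1) fam_mult[OF h(1) f(1)]]
      by (rule cl_cong) (simp add: monoid.m_assoc[OF ring.is_monoid[OF K_ring]] famD[OF g(1)] famD[OF h(1)] famD[OF f(1)])
  qed
  fix x y z assume x: "x \<in> carrier F" and y: "y \<in> carrier F" and z: "z \<in> carrier F"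
  obtain g where g: "fam g" "x = cl g" using x by (rule carrier_FE)
  obtain h where h: "fam h" "y = cl h" using y by (rule carrier_FE)
  obtain f where f: "fam f" "z = cl f" using z by (rule carrier_FE)
  show "(x \<oplus>\<^bsub>F\<^esub> y) \<otimes>\<^bsub>F\<^esub> z = x \<otimes>\<^bsub>F\<^esub> z \<oplus>\<^bsub>F\<^esub> y \<otimes>\<^bsub>F\<^esub> z"
    unfolding g(2) h(2) f(2) add_F[OF g(1) h(1)] mult_F[OF g(1) f(1)] mult_F[OF h(1) f(1)]
      mult_F[OF fam_add[OF g(1) h(1)] f(1)] add_F[OF fam_mult[OF g(1) f(1)] fam_mult[OF h(1) f(1)]]
    by (rule cl_cong) (simp add: ring.ring_simprules(13)[OF K_ring] famD[OF g(1)] famD[OF h(1)] famD[OF f(1)])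
qed

lemma F_field: "field F"
proof (rule cring.cring_fieldI2[OF F_cring])
  show "\<zero>\<^bsub>F\<^esub> \<noteq> \<one>\<^bsub>F\<^esub>"
  proof
    assume "\<zero>\<^bsub>F\<^esub> = \<one>\<^bsub>F\<^esub>"
    then have "ae (\<lambda>p. \<zero>\<^bsub>K p\<^esub> = \<one>\<^bsub>K p\<^esub>)" unfolding zero_F one_F by (rule cl_eqD[OF fam_zero])
    then have "ae (\<lambda>p. False)" by (rule ae_mono) (simp add: domain.one_not_zero[OF K_domain, symmetric])
    with ae_False show False by (rule notE)
  qed
  fix x assume x: "x \<in> carrier F" "x \<noteq> \<zero>\<^bsub>F\<^esub>"
  then obtain g where g: "fam g" "x = cl g" by (elim carrier_FE)
  have "\<not> ae (\<lambda>p. g p = \<zero>\<^bsub>K p\<^esub>)" using x(2) cl_eqI[of g "\<lambda>p. \<zero>\<^bsub>K p\<^esub>"] unfolding g(2) zero_F by (rule contrapos_nn)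
  then have nz: "ae (\<lambda>p. g p \<noteq> \<zero>\<^bsub>K p\<^esub>)" by (rule ae_not)
  \<comment> \<open>The default at primes where \<open>g p\<close> vanishes only keeps
    \<open>h\<close> inside the carriers; such primes are negligible.\<close>
  define h where "h p = (if g p = \<zero>\<^bsub>K p\<^esub> then \<zero>\<^bsub>K p\<^esub> else inv\<^bsub>K p\<^esub> (g p))" for p
  have u: "inv\<^bsub>K p\<^esub> (g p) \<in> carrier (K p)" "g p \<otimes>\<^bsub>K p\<^esub> inv\<^bsub>K p\<^esub> (g p) = \<one>\<^bsub>K p\<^esub>"
    if "Factorial_Ring.prime p" "g p \<noteq> \<zero>\<^bsub>K p\<^esub>" for p
  proof -
    have u: "g p \<in> Units (K p)"
      using field.field_Units[OF K_field[OF that(1)]] that(2) famD[OF g(1) that(1)] by simp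
    note M = ring.is_monoid[OF K_ring[OF that(1)]]
    show "inv\<^bsub>K p\<^esub> (g p) \<in> carrier (K p)" by (rule monoid.Units_inv_closed[OF M u])
    show "g p \<otimes>\<^bsub>K p\<^esub> inv\<^bsub>K p\<^esub> (g p) = \<one>\<^bsub>K p\<^esub>" by (rule monoid.Units_r_inv[OF M u])
  qed
  have h: "fam h" unfolding fam_def h_def using u(1) famD[OF fam_zero] by simp
  have "x \<otimes>\<^bsub>F\<^esub> cl h = \<one>\<^bsub>F\<^esub>"
    unfolding g(2) mult_F[OF g(1) h] one_F
    by (rule cl_eqI, rule ae_mono[OF nz]) (simp add: h_def u(2))
  then show "\<exists>y\<in>carrier F. x \<otimes>\<^bsub>F\<^esub> y = \<one>\<^bsub>F\<^esub>" using cl_closed[OF h] by blast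
qed

lemma minus_F:
  assumes g: "fam g" shows "\<ominus>\<^bsub>F\<^esub> cl g = cl (\<lambda>p. \<ominus>\<^bsub>K p\<^esub> g p)"
proof (rule abelian_group.minus_equality)
  show "abelian_group F" using F_cring by (intro ring.is_abelian_group cring.axioms(1))
  show "cl (\<lambda>p. \<ominus>\<^bsub>K p\<^esub> g p) \<oplus>\<^bsub>F\<^esub> cl g = \<zero>\<^bsub>F\<^esub>"
    unfolding zero_F add_F[OF fam_minus[OF g] g]
    by (rule cl_cong) (simp add: ring.ring_simprules(9)[OF K_ring] famD[OF g])
qed (intro cl_closed fam_minus g)+

end

section \<open>Generic elements of ultraproducts of finite fields\<close>

lemma (in field) finite_field_pow_card:
  assumes fin: "finite (carrier R)" and x: "x \<in> carrier R"
  shows "x [^] card (carrier R) = x"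
proof -
  have c: "card (carrier R) = Suc (card (carrier R) - 1)"
    using fin zero_closed card_gt_0_iff[of "carrier R"] by auto
  show ?thesis
  proof (cases "x = \<zero>")
    case True then show ?thesis by (subst c) simp
  next
    case False
    then have xm: "x \<in> carrier (Multiplicative_Group.mult_of R)" using x by simp
    have "x [^] (card (carrier R) - 1) = \<one>"
      using group.pow_order_eq_1[OF field_mult_group xm] order_mult_of[OF fin]
      by (simp add: Multiplicative_Group.nat_pow_mult_of Coset.order_def)
    then show ?thesis using x by (subst c) simp
  qed
qed

lemma (in cring) frobenius_pow_hom:
  assumes p: "Factorial_Ring.prime p" and ch: "int_emb R (int p) = \<zero>"
  shows "ring_hom_cring R R (\<lambda>x. x [^] (p ^ j))"
  by (rule ring_hom_cring_of_hom[OF is_cring is_cring], rule ring_hom_memI)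
    (simp_all add: nat_pow_distrib frobenius_pow_add[OF p ch])

text \<open>Frobenius fixes the prime field, so a polynomial value at the power of \<open>g\<close>
  is the same power of its value at \<open>g\<close>; and a power is zero only if its base
  is.\<close>

lemma (in field) generic_elt_frobenius:
  assumes p: "Factorial_Ring.prime p" and ch: "int_emb R (int p) = \<zero>" and g: "generic_elt R p k g"
  shows "generic_elt R p k (g [^] (p ^ j))"
  unfolding generic_elt_def
proof (intro conjI allI impI)
  have gc: "g \<in> carrier R" using g by (simp add: generic_elt_def)
  then show "g [^] (p ^ j) \<in> carrier R" by simp
  fix P :: "int poly" and i
  assume P: "Polynomial.degree P < k \<and> hom_eval R (int_emb R) (g [^] p ^ j) P = \<zero>"
  note H = frobenius_pow_hom[OF p ch, of j]
  have e: "(\<lambda>x. x [^] (p ^ j)) \<circ> int_emb R = int_emb R"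
    using ring_hom_cring.hom_int_emb[OF H] by (auto simp: fun_eq_iff)
  have "hom_eval R (int_emb R) g P [^] (p ^ j) = \<zero>"
    using ring_hom_cring.hom_eval_image[OF H int_emb_hom gc, of P] P unfolding e by simp
  then have "hom_eval R (int_emb R) g P = \<zero>"
    by (rule nat_pow_eq_zero_imp[OF hom_eval_closed[OF int_emb_hom gc]])
  then show "int p dvd Polynomial.coeff P i" using g P by (simp add: generic_elt_def)
qed

lemma (in field) frobenius_plus_id_inj:
  assumes p: "Factorial_Ring.prime p" "p > 2" and ch: "int_emb R (int p) = \<zero>"
    and per: "\<And>x. x \<in> carrier R \<Longrightarrow> x [^] (p ^ (2 * n * m + 1)) = x"
    and x: "x \<in> carrier R" and y: "y \<in> carrier R"
    and eq: "x [^] (p ^ n) \<oplus> x = y [^] (p ^ n) \<oplus> y"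
  shows "x = y"
proof -
  define z where "z = x \<oplus> \<ominus> y"
  have zc: "z \<in> carrier R" unfolding z_def using x y by simp
  have pp: "w [^] (p ^ (i + j)) = (w [^] (p ^ i)) [^] (p ^ j)" if "w \<in> carrier R" for w i j
    using that by (simp add: nat_pow_pow power_add)
  have aux: "a \<oplus> \<ominus> b = \<ominus> (c \<oplus> \<ominus> d)" if "a \<oplus> c = b \<oplus> d"
    "a \<in> carrier R" "b \<in> carrier R" "c \<in> carrier R" "d \<in> carrier R" for a b c d
  proof -
    have "a \<oplus> \<ominus> b = (a \<oplus> c) \<oplus> \<ominus> c \<oplus> \<ominus> b" using that(2-) by algebra
    also have "\<dots> = \<ominus> (c \<oplus> \<ominus> d)" unfolding that(1) using that(2-) by algebra
    finally show ?thesis .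
  qed
  have zn: "z [^] (p ^ n) = \<ominus> z"
  proof -
    have "z [^] (p ^ n) = x [^] (p ^ n) \<oplus> \<ominus> (y [^] (p ^ n))"
      unfolding z_def using x y frobenius_pow_add[OF p(1) ch] frobenius_pow_minus[OF p(1) ch] by simp
    also have "\<dots> = \<ominus> z" unfolding z_def using aux[OF eq] x y by simp
    finally show ?thesis .
  qed
  have z2n: "z [^] (p ^ (2 * n)) = z"
    unfolding mult_2 pp[OF zc] zn using frobenius_pow_minus[OF p(1) ch zc] zn zc by simp
  have z2nj: "z [^] (p ^ (2 * n * j)) = z" for j
  proof (induct j)
    case 0 show ?case using zc by simp
  next
    case (Suc j)
    have "2 * n * Suc j = 2 * n * j + 2 * n" by simp
    then show ?case using pp[OF zc, of "2 * n * j" "2 * n"] Suc z2n by (simp only:)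
  qed
  \<comment> \<open>Of the \<open>2 * n * m + 1\<close> applications of Frobenius that fix
    \<open>z\<close>, the first \<open>2 * n * m\<close> fix it already, so the last one does
    too.\<close>
  have z1: "z [^] p = z"
    using per[OF zc] pp[OF zc, of "2 * n * m" 1] z2nj[of m] by simp
  have "z [^] (p ^ j) = z" for j
  proof (induct j)
    case 0 show ?case using zc by simp
  next
    case (Suc j) then show ?case using pp[OF zc, of j 1] z1 by simp
  qed
  then have "\<ominus> z = z" using zn by simp
  then have zz: "z \<oplus> z = \<zero>" using zc by (metis l_neg)
  \<comment> \<open>Both 2 and the odd number \<open>p\<close> annihilate \<open>z\<close>, hence so
    does 1.\<close>
  have "odd p" using p primes_dvd_imp_eq two_is_prime_nat by blast
  then obtain r where r: "p = 2 * r + 1" by (rule oddE)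
  have two: "int_emb R 2 = \<one> \<oplus> \<one>"
    using type_homD(4)[OF int_emb_hom, of 1 1] type_homD(3)[OF int_emb_hom] by simp
  have "int p = int r * 2 + 1" using r by simp
  then have "int_emb R (int p) = int_emb R (int r) \<otimes> (\<one> \<oplus> \<one>) \<oplus> \<one>"
    by (simp only: type_homD(3,4,5)[OF int_emb_hom] two)
  then have e0: "int_emb R (int r) \<otimes> (\<one> \<oplus> \<one>) \<oplus> \<one> = \<zero>" using ch by simp
  have "(int_emb R (int r) \<otimes> (\<one> \<oplus> \<one>) \<oplus> \<one>) \<otimes> z = \<zero>" unfolding e0 using zc by simp
  moreover have "(int_emb R (int r) \<otimes> (\<one> \<oplus> \<one>) \<oplus> \<one>) \<otimes> z = int_emb R (int r) \<otimes> (z \<oplus> z) \<oplus> z"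
    using zc type_homD(1)[OF int_emb_hom, of "int r"] by algebra
  ultimately have "z = \<zero>" using zz zc type_homD(1)[OF int_emb_hom, of "int r"] by simp
  then show ?thesis unfolding z_def using x y by (metis add.inv_closed minus_equality minus_minus)
qed

section \<open>The Frobenius automorphism and polynomial degree bounds\<close>

text \<open>The family \<open>\<alpha>\<close> picks a generic element in every factor. The bound
  \<open>p ^ p\<close> serves as one function that eventually exceeds every polynomial in
  \<open>p\<close>.\<close>

locale generic_ultraproduct = field_ultraproduct +
  fixes k :: "nat \<Rightarrow> nat" and \<alpha> :: "nat \<Rightarrow> nat"
  assumes K_card: "Factorial_Ring.prime p \<Longrightarrow> card (carrier (K p)) = p ^ k p"
    and k_large: "Factorial_Ring.prime p \<Longrightarrow> p ^ p \<le> k p"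
    and generic: "Factorial_Ring.prime p \<Longrightarrow> generic_elt (K p) p (k p) (\<alpha> p)"
begin

lemma k_pos: "Factorial_Ring.prime p \<Longrightarrow> k p > 0"
  using k_large[of p] prime_gt_0_nat[of p] by (metis le_zero_eq neq0_conv power_eq_0_iff)

lemma K_pow_card: "Factorial_Ring.prime p \<Longrightarrow> x \<in> carrier (K p) \<Longrightarrow> x [^]\<^bsub>K p\<^esub> (p ^ k p) = x"
  using field.finite_field_pow_card[OF K_field K_fin] K_card by metis

lemma K_pow_pow:
  "Factorial_Ring.prime p \<Longrightarrow> x \<in> carrier (K p) \<Longrightarrow> (x [^]\<^bsub>K p\<^esub> (a::nat)) [^]\<^bsub>K p\<^esub> (b::nat) = x [^]\<^bsub>K p\<^esub> (a * b)"
  by (rule monoid.nat_pow_pow[OF ring.is_monoid[OF K_ring]])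

lemma frob_hom: "\<sigma> \<in> ring_hom F F"
proof (rule ring_hom_memI)
  fix x assume "x \<in> carrier F"
  then obtain g where g: "fam g" "x = cl g" by (rule carrier_FE)
  show "\<sigma> x \<in> carrier F" unfolding g(2) frob_F[OF g(1)] by (intro cl_closed fam_pow g)
  fix y assume "y \<in> carrier F"
  then obtain h where h: "fam h" "y = cl h" by (rule carrier_FE)
  show "\<sigma> (x \<otimes>\<^bsub>F\<^esub> y) = \<sigma> x \<otimes>\<^bsub>F\<^esub> \<sigma> y"
    unfolding g(2) h(2) mult_F[OF g(1) h(1)] frob_F[OF g(1)] frob_F[OF h(1)] frob_F[OF fam_mult[OF g(1) h(1)]]
      mult_F[OF fam_pow[OF g(1)] fam_pow[OF h(1)]]
    by (rule cl_cong) (intro comm_monoid.nat_pow_distrib cring.axioms(2)[OF K_cring] famD[OF g(1)] famD[OF h(1)])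
  show "\<sigma> (x \<oplus>\<^bsub>F\<^esub> y) = \<sigma> x \<oplus>\<^bsub>F\<^esub> \<sigma> y"
    unfolding g(2) h(2) add_F[OF g(1) h(1)] frob_F[OF g(1)] frob_F[OF h(1)] frob_F[OF fam_add[OF g(1) h(1)]]
      add_F[OF fam_pow[OF g(1)] fam_pow[OF h(1)]]
    by (rule cl_cong) (intro cring.frobenius_add K_cring K_char famD[OF g(1)] famD[OF h(1)])
next
  show "\<sigma> \<one>\<^bsub>F\<^esub> = \<one>\<^bsub>F\<^esub>"
    unfolding one_F frob_F[OF fam_one]
    by (rule cl_cong) (rule monoid.nat_pow_one[OF ring.is_monoid[OF K_ring]])
qed

lemma frob_bij: "bij_betw \<sigma> (carrier F) (carrier F)"
  unfolding bij_betw_def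
proof
  \<comment> \<open>On a factor with \<open>p ^ k p\<close> elements the power with exponent
    \<open>p ^ (k p - 1)\<close> inverts Frobenius on both sides.\<close>
  have e: "(x [^]\<^bsub>K p\<^esub> p) [^]\<^bsub>K p\<^esub> (p ^ (k p - 1)) = x" "(x [^]\<^bsub>K p\<^esub> (p ^ (k p - 1))) [^]\<^bsub>K p\<^esub> p = x"
    if "Factorial_Ring.prime p" "x \<in> carrier (K p)" for p x
  proof -
    have "p * p ^ (k p - 1) = p ^ k p" using k_pos[OF that(1)] by (metis power_eq_if neq0_conv)
    then show "(x [^]\<^bsub>K p\<^esub> p) [^]\<^bsub>K p\<^esub> (p ^ (k p - 1)) = x" "(x [^]\<^bsub>K p\<^esub> (p ^ (k p - 1))) [^]\<^bsub>K p\<^esub> p = x"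
      using K_pow_card[OF that] by (simp_all add: K_pow_pow[OF that] mult.commute)
  qed
  show "inj_on \<sigma> (carrier F)"
  proof (rule inj_onI)
    fix x y assume x: "x \<in> carrier F" and y: "y \<in> carrier F" and eq: "\<sigma> x = \<sigma> y"
    obtain g where g: "fam g" "x = cl g" using x by (rule carrier_FE)
    obtain h where h: "fam h" "y = cl h" using y by (rule carrier_FE)
    have "ae (\<lambda>p. g p [^]\<^bsub>K p\<^esub> p = h p [^]\<^bsub>K p\<^esub> p)"
      using eq unfolding g(2) h(2) frob_F[OF g(1)] frob_F[OF h(1)] by (rule cl_eqD[OF fam_pow[OF g(1)]])
    then have "ae (\<lambda>p. g p = h p)"
    proof (rule ae_mono)
      fix p assume p: "Factorial_Ring.prime p" "g p [^]\<^bsub>K p\<^esub> p = h p [^]\<^bsub>K p\<^esub> p"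
      show "g p = h p" using e(1)[OF p(1) famD[OF g(1) p(1)]] e(1)[OF p(1) famD[OF h(1) p(1)]] p(2) by simp
    qed
    then show "x = y" unfolding g(2) h(2) by (rule cl_eqI)
  qed
  show "\<sigma> ` carrier F = carrier F"
  proof
    show "\<sigma> ` carrier F \<subseteq> carrier F" using ring_hom_closed[OF frob_hom] by blast
    show "carrier F \<subseteq> \<sigma> ` carrier F"
    proof
      fix x assume "x \<in> carrier F"
      then obtain g where g: "fam g" "x = cl g" by (rule carrier_FE)
      let ?h = "\<lambda>p. g p [^]\<^bsub>K p\<^esub> (p ^ (k p - 1))"
      have eq: "\<sigma> (cl ?h) = x"
        unfolding frob_F[OF fam_pow[OF g(1)]] g(2) by (rule cl_cong) (rule e(2)[OF _ famD[OF g(1)]])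
      show "x \<in> \<sigma> ` carrier F" by (rule image_eqI[where x = "cl ?h"], rule sym[OF eq], intro cl_closed fam_pow g(1))
    qed
  qed
qed

text \<open>The growth of degrees when one fixed algebraic expression in finitely many forward
  translates is written out at every prime: \<open>D\<close> and \<open>M\<close> may not depend on
  \<open>p\<close>.\<close>

definition poly_bounded :: "(nat \<Rightarrow> nat) \<Rightarrow> bool" where
  "poly_bounded d \<longleftrightarrow> (\<exists>D M. \<forall>p. Factorial_Ring.prime p \<longrightarrow> d p \<le> D * p ^ M)"

lemma poly_boundedI: "(\<And>p. Factorial_Ring.prime p \<Longrightarrow> d p \<le> D * p ^ M) \<Longrightarrow> poly_bounded d"
  unfolding poly_bounded_def by blast

lemma poly_bounded_mono: "poly_bounded d \<Longrightarrow> (\<And>p. Factorial_Ring.prime p \<Longrightarrow> e p \<le> d p) \<Longrightarrow> poly_bounded e"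
  unfolding poly_bounded_def by (meson le_trans)

lemma poly_bounded_add:
  assumes "poly_bounded d" "poly_bounded e" shows "poly_bounded (\<lambda>p. d p + e p)"
proof -
  obtain D M D' M' where *: "\<And>p. Factorial_Ring.prime p \<Longrightarrow> d p \<le> D * p ^ M"
    "\<And>p. Factorial_Ring.prime p \<Longrightarrow> e p \<le> D' * p ^ M'"
    using assms unfolding poly_bounded_def by auto
  show ?thesis
  proof (rule poly_boundedI)
    fix p :: nat assume p: "Factorial_Ring.prime p"
    then have "p \<ge> 1" using prime_ge_1_nat by blast
    then have "p ^ M \<le> p ^ (M + M')" "p ^ M' \<le> p ^ (M + M')" by (auto intro: power_increasing)
    then have "D * p ^ M \<le> D * p ^ (M + M')" "D' * p ^ M' \<le> D' * p ^ (M + M')" by simp_all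
    then have "d p + e p \<le> D * p ^ (M + M') + D' * p ^ (M + M')" using *[OF p] by linarith
    then show "d p + e p \<le> (D + D') * p ^ (M + M')" by (simp add: add_mult_distrib)
  qed
qed

text \<open>As soon as \<open>p\<close> exceeds \<open>D + M\<close>, the bound
  \<open>D * p ^ M\<close> is below \<open>p ^ Suc M\<close>, which is at most
  \<open>p ^ p\<close>.\<close>

lemma poly_bounded_less_k:
  assumes "poly_bounded d" shows "ae (\<lambda>p. d p < k p)"
proof -
  obtain D M where *: "\<And>p. Factorial_Ring.prime p \<Longrightarrow> d p \<le> D * p ^ M"
    using assms unfolding poly_bounded_def by auto
  show ?thesis
  proof (rule ae_mono[OF ae_ge[of "D + M"]])
    fix p :: nat assume p: "Factorial_Ring.prime p" "D + M < p"
    then have p0: "p > 0" by simp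
    have "d p \<le> D * p ^ M" using * p by blast
    also have "\<dots> < p * p ^ M" using p(2) p0 by simp
    also have "\<dots> = p ^ Suc M" by simp
    also have "\<dots> \<le> p ^ p" using p(2) p0 by (intro power_increasing) auto
    also have "\<dots> \<le> k p" by (rule k_large[OF p(1)])
    finally show "d p < k p" .
  qed
qed

section \<open>Integer polynomials in a generic family\<close>

context
  fixes z
  assumes z: "\<And>p. Factorial_Ring.prime p \<Longrightarrow> generic_elt (K p) p (k p) (z p)"
begin

lemma fam_z: "fam z" using z by (simp add: fam_def generic_elt_def)

text \<open>The family \<open>z\<close> stays arbitrary because it is instantiated by different
  translates of \<open>\<alpha>\<close>. The polynomial may change with \<open>p\<close>, since the
  translates themselves become monomials of degree \<open>p ^ i\<close>.\<close>

definition poly_class :: "(nat \<Rightarrow> int poly) \<Rightarrow> (nat \<Rightarrow> nat) set" where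
  "poly_class T = cl (\<lambda>p. hom_eval (K p) (int_emb (K p)) (z p) (T p))"

lemma hom_eval_z_hom: "Factorial_Ring.prime p \<Longrightarrow> type_hom (K p) (hom_eval (K p) (int_emb (K p)) (z p))"
  by (rule cring.hom_eval_hom[OF K_cring cring.int_emb_hom[OF K_cring] famD[OF fam_z]])

lemma fam_hom_eval: "fam (\<lambda>p. hom_eval (K p) (int_emb (K p)) (z p) (T p))"
  unfolding fam_def using type_homD(1)[OF hom_eval_z_hom] by blast

lemma poly_class_add: "poly_class S \<oplus>\<^bsub>F\<^esub> poly_class T = poly_class (\<lambda>p. S p + T p)"
  unfolding poly_class_def add_F[OF fam_hom_eval fam_hom_eval]
  by (rule cl_cong) (simp add: type_homD(4)[OF hom_eval_z_hom])

lemma poly_class_mult: "poly_class S \<otimes>\<^bsub>F\<^esub> poly_class T = poly_class (\<lambda>p. S p * T p)"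
  unfolding poly_class_def mult_F[OF fam_hom_eval fam_hom_eval]
  by (rule cl_cong) (simp add: type_homD(5)[OF hom_eval_z_hom])

lemma poly_class_minus: "\<ominus>\<^bsub>F\<^esub> poly_class S = poly_class (\<lambda>p. - S p)"
  unfolding poly_class_def minus_F[OF fam_hom_eval]
  by (rule cl_cong) (simp add: cring.type_hom_uminus[OF K_cring hom_eval_z_hom])

lemma poly_class_one: "\<one>\<^bsub>F\<^esub> = poly_class (\<lambda>p. 1)"
  unfolding poly_class_def one_F by (rule cl_cong) (simp add: type_homD(3)[OF hom_eval_z_hom])

lemma poly_class_z_power: "cl (\<lambda>p. z p [^]\<^bsub>K p\<^esub> (p ^ i)) = poly_class (\<lambda>p. Polynomial.monom 1 (p ^ i))"
  unfolding poly_class_def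
proof (rule cl_cong)
  fix p :: nat assume p: "Factorial_Ring.prime p"
  have "Polynomial.monom 1 (p ^ i) = ([:0, 1:] :: int poly) ^ (p ^ i)" by (simp add: monom_altdef)
  then show "z p [^]\<^bsub>K p\<^esub> (p ^ i) = hom_eval (K p) (int_emb (K p)) (z p) (Polynomial.monom 1 (p ^ i))"
    using cring.type_hom_power[OF K_cring[OF p] hom_eval_z_hom[OF p]]
      cring.hom_eval_X[OF K_cring[OF p] cring.int_emb_hom[OF K_cring[OF p]] famD[OF fam_z p]] by simp
qed

lemma poly_class_zeroI:
  assumes "ae (\<lambda>p. \<forall>i. int p dvd Polynomial.coeff (T p) i)" shows "poly_class T = \<zero>\<^bsub>F\<^esub>"
  unfolding poly_class_def zero_F
proof (rule cl_eqI, rule ae_mono[OF assms])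
  fix p :: nat assume p: "Factorial_Ring.prime p" "\<forall>i. int p dvd Polynomial.coeff (T p) i"
  have "hom_eval (K p) (int_emb (K p)) (z p) (T p) = hom_eval (K p) (int_emb (K p)) (z p) 0"
    by (rule cring.hom_eval_cong_mod[OF K_cring K_char famD[OF fam_z]]) (use p in simp_all)
  then show "hom_eval (K p) (int_emb (K p)) (z p) (T p) = \<zero>\<^bsub>K p\<^esub>"
    using type_homD(2)[OF hom_eval_z_hom[OF p(1)]] by simp
qed

text \<open>Here genericity enters: almost everywhere the degree is below \<open>k p\<close>, so the
  polynomial can vanish at \<open>z p\<close> only by being zero modulo \<open>p\<close>.\<close>

lemma poly_class_zeroD:
  assumes "poly_class T = \<zero>\<^bsub>F\<^esub>" "poly_bounded (\<lambda>p. Polynomial.degree (T p))"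
  shows "ae (\<lambda>p. \<forall>i. int p dvd Polynomial.coeff (T p) i)"
proof -
  have "ae (\<lambda>p. hom_eval (K p) (int_emb (K p)) (z p) (T p) = \<zero>\<^bsub>K p\<^esub>)"
    using assms(1) unfolding poly_class_def zero_F by (rule cl_eqD[OF fam_hom_eval])
  from ae_conj[OF this poly_bounded_less_k[OF assms(2)]] show ?thesis
  proof (rule ae_mono)
    fix p :: nat
    assume p: "Factorial_Ring.prime p" and
      "hom_eval (K p) (int_emb (K p)) (z p) (T p) = \<zero>\<^bsub>K p\<^esub> \<and> Polynomial.degree (T p) < k p"
    then show "\<forall>i. int p dvd Polynomial.coeff (T p) i" using z[OF p] unfolding generic_elt_def by simp
  qed
qed

text \<open>The predicate \<open>Q\<close> is any class of polynomial families closed under the ring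
  operations; the two ends of a window require different classes.\<close>

lemma generate_ring_poly_class:
  assumes "v \<in> generate_ring F H"
    and H: "\<And>h. h \<in> H \<Longrightarrow> \<exists>T. Q T \<and> h = poly_class T" and one: "Q (\<lambda>p. 1)"
    and add: "\<And>S T. Q S \<Longrightarrow> Q T \<Longrightarrow> Q (\<lambda>p. S p + T p)"
    and mult: "\<And>S T. Q S \<Longrightarrow> Q T \<Longrightarrow> Q (\<lambda>p. S p * T p)"
    and minus: "\<And>S. Q S \<Longrightarrow> Q (\<lambda>p. - S p)"
  shows "\<exists>T. Q T \<and> v = poly_class T"
  using assms(1)
proof induct
  case one then show ?case using assms(3) poly_class_one by blast
next
  case (incl h) then show ?case by (rule H)
next
  case (a_inv h)
  then obtain T where "Q T" "h = poly_class T" by blast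
  then show ?case using minus[of T] poly_class_minus[of T] by auto
next
  case (eng_add h1 h2)
  then obtain S T where "Q S" "h1 = poly_class S" "Q T" "h2 = poly_class T" by blast
  then show ?case using add[of S T] poly_class_add[of S T] by auto
next
  case (eng_mult h1 h2)
  then obtain S T where "Q S" "h1 = poly_class S" "Q T" "h2 = poly_class T" by blast
  then show ?case using mult[of S T] poly_class_mult[of S T] by auto
qed

text \<open>The scheme shared by both ends of a window. \<open>J d C V\<close> says that
  \<open>V\<close> arises from \<open>d\<close> Horner steps with top coefficient \<open>C\<close>;
  condition \<open>lead\<close> says that \<open>C\<close> can be recovered from the coefficients of
  \<open>V\<close>, so it vanishes modulo \<open>p\<close> whenever \<open>V\<close> does.\<close>

lemma transc_poly_class:
  assumes A: "\<And>v. v \<in> A \<Longrightarrow> \<exists>T. Q T \<and> v = poly_class T"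
    and J0: "\<And>C. Q C \<Longrightarrow> J 0 C C"
    and JS: "\<And>d C V T. J d C V \<Longrightarrow> Q T \<Longrightarrow> J (Suc d) C (\<lambda>p. Polynomial.monom 1 (p ^ m) * V p + T p)"
    and bounded: "\<And>d C V. J d C V \<Longrightarrow> poly_bounded (\<lambda>p. Polynomial.degree (V p))"
    and lead: "\<And>d C V. J d C V \<Longrightarrow> ae (\<lambda>p. (\<forall>i. int p dvd Polynomial.coeff (V p) i) \<longrightarrow>
        (\<forall>i. int p dvd Polynomial.coeff (C p) i))"
  shows "transc F A (cl (\<lambda>p. z p [^]\<^bsub>K p\<^esub> (p ^ m)))"
proof -
  let ?x = "cl (\<lambda>p. z p [^]\<^bsub>K p\<^esub> (p ^ m))"
  have rep: "\<exists>C V. c = poly_class C \<and> v = poly_class V \<and> J d C V" if "horner F A ?x d c v" for d c v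
    using that
  proof induct
    case (base c)
    then obtain T where "Q T" "c = poly_class T" using A by blast
    then show ?case using J0 by blast
  next
    case (step d c v a)
    then obtain C V where CV: "c = poly_class C" "v = poly_class V" "J d C V" by blast
    obtain T where T: "Q T" "a = poly_class T" using A step by blast
    have "?x \<otimes>\<^bsub>F\<^esub> v \<oplus>\<^bsub>F\<^esub> a = poly_class (\<lambda>p. Polynomial.monom 1 (p ^ m) * V p + T p)"
      unfolding CV T poly_class_z_power poly_class_mult poly_class_add ..
    then show ?case using CV(1) JS[OF CV(3) T(1)] by blast
  qed
  show ?thesis
    unfolding transc_def
  proof (intro allI impI)
    fix d c assume "horner F A ?x d c \<zero>\<^bsub>F\<^esub>"
    from rep[OF this] obtain C V where CV: "c = poly_class C" "\<zero>\<^bsub>F\<^esub> = poly_class V" "J d C V" by blast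
    have "ae (\<lambda>p. \<forall>i. int p dvd Polynomial.coeff (V p) i)"
      using poly_class_zeroD[OF CV(2)[symmetric] bounded[OF CV(3)]] .
    from ae_conj[OF this lead[OF CV(3)]]
    have "ae (\<lambda>p. \<forall>i. int p dvd Polynomial.coeff (C p) i)" by (rule ae_mono) blast
    then show "c = \<zero>\<^bsub>F\<^esub>" unfolding CV(1) by (rule poly_class_zeroI)
  qed
qed

lemma degree_step_bounded:
  assumes "poly_bounded (\<lambda>p. Polynomial.degree (V p :: int poly))" "poly_bounded (\<lambda>p. Polynomial.degree (T p))"
  shows "poly_bounded (\<lambda>p. Polynomial.degree (Polynomial.monom 1 (p ^ m) * V p + T p))"
proof -
  have "poly_bounded (\<lambda>p. p ^ m)" by (rule poly_boundedI[of _ 1 m]) simp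
  from poly_bounded_add[OF poly_bounded_add[OF this assms(1)] assms(2)] show ?thesis
  proof (rule poly_bounded_mono)
    fix p :: nat
    have "Polynomial.degree (Polynomial.monom 1 (p ^ m) * V p) \<le> p ^ m + Polynomial.degree (V p)"
      using degree_mult_le[of "Polynomial.monom 1 (p ^ m)" "V p"] degree_monom_le[of "1::int" "p ^ m"] by linarith
    then show "Polynomial.degree (Polynomial.monom 1 (p ^ m) * V p + T p)
      \<le> p ^ m + Polynomial.degree (V p) + Polynomial.degree (T p)"
      by (intro degree_add_le) auto
  qed
qed

text \<open>Substituting the \<open>p\<close>-powers of \<open>z\<close> turns the coefficients of a relation into polynomials of degree
  below \<open>p ^ m\<close> for large \<open>p\<close>, so that their multiples by powers of \<open>X^(p ^ m)\<close> cannot cancel.\<close>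

lemma transc_top:
  "transc F (generate_ring F ((\<lambda>i. cl (\<lambda>p. z p [^]\<^bsub>K p\<^esub> (p ^ i))) ` {..<m})) (cl (\<lambda>p. z p [^]\<^bsub>K p\<^esub> (p ^ m)))"
proof -
  \<comment> \<open>A degree bound of the form D * p^(m-1), written multiplicatively so that
    \<open>m = 0\<close> needs no separate treatment. It places the degree below
    \<open>p ^ m\<close> once \<open>p > D\<close>.\<close>
  define Q :: "(nat \<Rightarrow> int poly) \<Rightarrow> bool" where
    "Q T \<longleftrightarrow> (\<exists>D. \<forall>p. Factorial_Ring.prime p \<longrightarrow> p * Polynomial.degree (T p) \<le> D * p ^ m)" for T
  \<comment> \<open>The coefficients of \<open>C\<close> reappear in \<open>V\<close> shifted by
    \<open>p ^ m * d\<close>, and everything added later stays below them.\<close>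
  define J :: "nat \<Rightarrow> (nat \<Rightarrow> int poly) \<Rightarrow> (nat \<Rightarrow> int poly) \<Rightarrow> bool" where
    "J d C V \<longleftrightarrow> poly_bounded (\<lambda>p. Polynomial.degree (V p)) \<and>
       ae (\<lambda>p. \<forall>i. Polynomial.coeff (V p) (p ^ m * d + i) = Polynomial.coeff (C p) i)" for d C V
  have QI: "Q T" if "\<And>p. Factorial_Ring.prime p \<Longrightarrow> p * Polynomial.degree (T p) \<le> D * p ^ m" for T D
    using that unfolding Q_def by blast
  have Qb: "poly_bounded (\<lambda>p. Polynomial.degree (T p))" if QT: "Q T" for T
  proof -
    obtain D where D: "\<And>p. Factorial_Ring.prime p \<Longrightarrow> p * Polynomial.degree (T p) \<le> D * p ^ m"
      using QT unfolding Q_def by blast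
    show ?thesis
    proof (rule poly_boundedI)
      fix p :: nat assume p: "Factorial_Ring.prime p"
      have "1 * Polynomial.degree (T p) \<le> p * Polynomial.degree (T p)"
        using prime_ge_1_nat[OF p] by (intro mult_le_mono1) simp
      then show "Polynomial.degree (T p) \<le> D * p ^ m" using D[OF p] by linarith
    qed
  qed
  have Qd: "ae (\<lambda>p. Polynomial.degree (T p) < p ^ m)" if QT: "Q T" for T
  proof -
    obtain D where D: "\<And>p. Factorial_Ring.prime p \<Longrightarrow> p * Polynomial.degree (T p) \<le> D * p ^ m"
      using QT unfolding Q_def by blast
    show ?thesis
    proof (rule ae_mono[OF ae_ge[of D]])
      fix p :: nat assume p: "Factorial_Ring.prime p" "D < p"
      have "p * Polynomial.degree (T p) < p * p ^ m"
        by (rule le_less_trans[OF D[OF p(1)]]) (use p(2) in simp)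
      then show "Polynomial.degree (T p) < p ^ m" by simp
    qed
  qed
  show ?thesis
  proof (rule transc_poly_class[where Q = Q and J = J])
    fix v assume "v \<in> generate_ring F ((\<lambda>i. cl (\<lambda>p. z p [^]\<^bsub>K p\<^esub> (p ^ i))) ` {..<m})"
    then show "\<exists>T. Q T \<and> v = poly_class T"
    proof (rule generate_ring_poly_class)
      fix h assume "h \<in> (\<lambda>i. cl (\<lambda>p. z p [^]\<^bsub>K p\<^esub> (p ^ i))) ` {..<m}"
      then obtain i where i: "i < m" "h = poly_class (\<lambda>p. Polynomial.monom 1 (p ^ i))" by (auto simp: poly_class_z_power)
      have "Q (\<lambda>p. Polynomial.monom 1 (p ^ i))"
      proof (rule QI[of _ 1])
        fix p :: nat assume p: "Factorial_Ring.prime p"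
        have "p ^ Suc i \<le> p ^ m" using i(1) prime_ge_1_nat[OF p] by (intro power_increasing) auto
        then show "p * Polynomial.degree (Polynomial.monom (1::int) (p ^ i)) \<le> 1 * p ^ m"
          by (simp add: degree_monom_eq)
      qed
      then show "\<exists>T. Q T \<and> h = poly_class T" using i(2) by blast
    next
      show "Q (\<lambda>p. 1)" by (rule QI[of _ 0]) simp
    next
      fix S T assume "Q S" "Q T"
      then obtain D E where DE: "\<And>p. Factorial_Ring.prime p \<Longrightarrow> p * Polynomial.degree (S p) \<le> D * p ^ m"
        "\<And>p. Factorial_Ring.prime p \<Longrightarrow> p * Polynomial.degree (T p) \<le> E * p ^ m" unfolding Q_def by blast
      have b: "p * (Polynomial.degree (S p) + Polynomial.degree (T p)) \<le> (D + E) * p ^ m"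
        if "Factorial_Ring.prime p" for p
        using DE[OF that] by (simp add: add_mult_distrib add_mult_distrib2)
      show "Q (\<lambda>p. S p + T p)"
      proof (rule QI)
        fix p :: nat assume p: "Factorial_Ring.prime p"
        have "Polynomial.degree (S p + T p) \<le> Polynomial.degree (S p) + Polynomial.degree (T p)"
          by (intro degree_add_le) auto
        then show "p * Polynomial.degree (S p + T p) \<le> (D + E) * p ^ m"
          using b[OF p] mult_le_mono2[of _ _ p] le_trans by blast
      qed
      show "Q (\<lambda>p. S p * T p)"
      proof (rule QI)
        fix p :: nat assume p: "Factorial_Ring.prime p"
        show "p * Polynomial.degree (S p * T p) \<le> (D + E) * p ^ m"
          using b[OF p] mult_le_mono2[OF degree_mult_le[of "S p" "T p"], of p] by (rule le_trans[rotated])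
      qed
    next
      fix S assume "Q S" then show "Q (\<lambda>p. - S p)" by (simp add: Q_def)
    qed
  next
    fix C assume "Q C" then show "J 0 C C" unfolding J_def using Qb by (auto intro: ae_all)
  next
    fix d C V T assume J: "J d C V" and T: "Q T"
    show "J (Suc d) C (\<lambda>p. Polynomial.monom 1 (p ^ m) * V p + T p)"
      unfolding J_def
    proof
      show "poly_bounded (\<lambda>p. Polynomial.degree (Polynomial.monom 1 (p ^ m) * V p + T p))"
        using J Qb[OF T] unfolding J_def by (intro degree_step_bounded) auto
      have "ae (\<lambda>p. \<forall>i. Polynomial.coeff (V p) (p ^ m * d + i) = Polynomial.coeff (C p) i)"
        using J unfolding J_def by simp
      from ae_conj[OF this Qd[OF T]]
      show "ae (\<lambda>p. \<forall>i. Polynomial.coeff (Polynomial.monom 1 (p ^ m) * V p + T p) (p ^ m * Suc d + i) = Polynomial.coeff (C p) i)"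
      proof (rule ae_mono)
        fix p :: nat
        assume *: "(\<forall>i. Polynomial.coeff (V p) (p ^ m * d + i) = Polynomial.coeff (C p) i) \<and> Polynomial.degree (T p) < p ^ m"
        show "\<forall>i. Polynomial.coeff (Polynomial.monom 1 (p ^ m) * V p + T p) (p ^ m * Suc d + i) = Polynomial.coeff (C p) i"
        proof
          fix i
          have "Polynomial.coeff (T p) (p ^ m * Suc d + i) = 0" using * by (intro coeff_eq_0) simp
          moreover have "Polynomial.coeff (Polynomial.monom 1 (p ^ m) * V p) (p ^ m * Suc d + i) = Polynomial.coeff (V p) (p ^ m * d + i)"
            by (simp add: coeff_monom_mult)
          ultimately show "Polynomial.coeff (Polynomial.monom 1 (p ^ m) * V p + T p) (p ^ m * Suc d + i) = Polynomial.coeff (C p) i"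
            using * by simp
        qed
      qed
    qed
  next
    fix d C V assume "J d C V"
    then show "poly_bounded (\<lambda>p. Polynomial.degree (V p))" by (simp add: J_def)
  next
    fix d C V assume "J d C V"
    then have "ae (\<lambda>p. \<forall>i. Polynomial.coeff (V p) (p ^ m * d + i) = Polynomial.coeff (C p) i)" by (simp add: J_def)
    then show "ae (\<lambda>p. (\<forall>i. int p dvd Polynomial.coeff (V p) i) \<longrightarrow> (\<forall>i. int p dvd Polynomial.coeff (C p) i))"
    proof (rule ae_mono, intro impI allI)
      fix p i
      assume *: "\<forall>i. Polynomial.coeff (V p) (p ^ m * d + i) = Polynomial.coeff (C p) i"
        and V: "\<forall>i. int p dvd Polynomial.coeff (V p) i"
      show "int p dvd Polynomial.coeff (C p) i" using spec[OF V, of "p ^ m * d + i"] * by simp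
    qed
  qed
qed

text \<open>Here the coefficients become polynomials in \<open>X^p\<close>, and degrees below \<open>p\<close> in \<open>X\<close> are separated by
  residues modulo \<open>p\<close>.\<close>

lemma transc_bottom:
  "transc F (generate_ring F ((\<lambda>i. cl (\<lambda>p. z p [^]\<^bsub>K p\<^esub> (p ^ i))) ` {0<..m})) (cl (\<lambda>p. z p [^]\<^bsub>K p\<^esub> (p ^ 0)))"
proof -
  \<comment> \<open>Polynomials in X^p: only exponents divisible by \<open>p\<close> occur.\<close>
  define Q :: "(nat \<Rightarrow> int poly) \<Rightarrow> bool" where
    "Q T \<longleftrightarrow> poly_bounded (\<lambda>p. Polynomial.degree (T p)) \<and>
      (\<forall>p i. Factorial_Ring.prime p \<longrightarrow> Polynomial.coeff (T p) i \<noteq> 0 \<longrightarrow> p dvd i)" for T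
  \<comment> \<open>The coefficients of \<open>C\<close> are found in \<open>V\<close> at exponents
    congruent to \<open>d\<close> modulo \<open>p\<close>. Recording \<open>Q C\<close> ensures that
    the positions \<open>p * i\<close> account for all of \<open>C\<close>.\<close>
  define J :: "nat \<Rightarrow> (nat \<Rightarrow> int poly) \<Rightarrow> (nat \<Rightarrow> int poly) \<Rightarrow> bool" where
    "J d C V \<longleftrightarrow> Q C \<and> poly_bounded (\<lambda>p. Polynomial.degree (V p)) \<and>
       ae (\<lambda>p. \<forall>i. Polynomial.coeff (V p) (p * i + d) = Polynomial.coeff (C p) (p * i))" for d C V
  show ?thesis
  proof (rule transc_poly_class[where Q = Q and J = J])
    fix v assume "v \<in> generate_ring F ((\<lambda>i. cl (\<lambda>p. z p [^]\<^bsub>K p\<^esub> (p ^ i))) ` {0<..m})"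
    then show "\<exists>T. Q T \<and> v = poly_class T"
    proof (rule generate_ring_poly_class)
      fix h assume "h \<in> (\<lambda>i. cl (\<lambda>p. z p [^]\<^bsub>K p\<^esub> (p ^ i))) ` {0<..m}"
      then obtain i where i: "0 < i" "h = poly_class (\<lambda>p. Polynomial.monom 1 (p ^ i))" by (auto simp: poly_class_z_power)
      have "poly_bounded (\<lambda>p. Polynomial.degree (Polynomial.monom (1::int) (p ^ i)))"
        by (rule poly_boundedI[of _ 1 i]) (simp add: degree_monom_eq)
      then have "Q (\<lambda>p. Polynomial.monom 1 (p ^ i))" using i(1) by (auto simp: Q_def split: if_splits)
      then show "\<exists>T. Q T \<and> h = poly_class T" using i(2) by blast
    next
      show "Q (\<lambda>p. 1)" unfolding Q_def by (auto intro: poly_boundedI[of _ 0 0] split: if_splits)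
    next
      fix S T assume ST: "Q S" "Q T"
      then have b: "poly_bounded (\<lambda>p. Polynomial.degree (S p) + Polynomial.degree (T p))"
        by (intro poly_bounded_add) (simp_all add: Q_def)
      have "poly_bounded (\<lambda>p. Polynomial.degree (S p + T p))"
        by (rule poly_bounded_mono[OF b]) (intro degree_add_le, auto)
      moreover have "p dvd i" if p: "Factorial_Ring.prime p" and i: "Polynomial.coeff (S p + T p) i \<noteq> 0" for p i
      proof -
        have "Polynomial.coeff (S p) i \<noteq> 0 \<or> Polynomial.coeff (T p) i \<noteq> 0" using i by auto
        then show ?thesis using ST p unfolding Q_def by auto
      qed
      ultimately show "Q (\<lambda>p. S p + T p)" unfolding Q_def by simp
      have "poly_bounded (\<lambda>p. Polynomial.degree (S p * T p))"
        by (rule poly_bounded_mono[OF b]) (rule degree_mult_le)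
      moreover have "p dvd j" if p: "Factorial_Ring.prime p" and j: "Polynomial.coeff (S p * T p) j \<noteq> 0" for p j
      proof -
        have "(\<Sum>i\<le>j. Polynomial.coeff (S p) i * Polynomial.coeff (T p) (j - i)) \<noteq> 0"
          using j by (simp add: coeff_mult)
        then obtain i where i: "i \<le> j" "Polynomial.coeff (S p) i * Polynomial.coeff (T p) (j - i) \<noteq> 0"
          by (metis (no_types, lifting) atMost_iff sum.neutral)
        then have "p dvd i" "p dvd j - i" using ST p unfolding Q_def by auto
        then have "p dvd i + (j - i)" by (rule dvd_add)
        then show ?thesis using i(1) by simp
      qed
      ultimately show "Q (\<lambda>p. S p * T p)" unfolding Q_def by simp
    next
      fix S assume "Q S" then show "Q (\<lambda>p. - S p)" by (simp add: Q_def)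
    qed
  next
    fix C assume "Q C" then show "J 0 C C" unfolding J_def by (auto simp: Q_def intro: ae_all)
  next
    fix d C V T assume J: "J d C V" and T: "Q T"
    show "J (Suc d) C (\<lambda>p. Polynomial.monom 1 (p ^ 0) * V p + T p)"
      unfolding J_def
    proof (intro conjI)
      show "Q C" using J by (simp add: J_def)
      show "poly_bounded (\<lambda>p. Polynomial.degree (Polynomial.monom 1 (p ^ 0) * V p + T p))"
        using J T unfolding J_def Q_def by (intro degree_step_bounded) auto
      have "ae (\<lambda>p. \<forall>i. Polynomial.coeff (V p) (p * i + d) = Polynomial.coeff (C p) (p * i))"
        using J unfolding J_def by simp
      from ae_conj[OF this ae_ge[of "Suc d"]]
      show "ae (\<lambda>p. \<forall>i. Polynomial.coeff (Polynomial.monom 1 (p ^ 0) * V p + T p) (p * i + Suc d) = Polynomial.coeff (C p) (p * i))"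
      proof (rule ae_mono)
        fix p :: nat
        assume p: "Factorial_Ring.prime p" and
          *: "(\<forall>i. Polynomial.coeff (V p) (p * i + d) = Polynomial.coeff (C p) (p * i)) \<and> Suc d < p"
        show "\<forall>i. Polynomial.coeff (Polynomial.monom 1 (p ^ 0) * V p + T p) (p * i + Suc d) = Polynomial.coeff (C p) (p * i)"
        proof
          fix i
          \<comment> \<open>For \<open>p > Suc d\<close> the residue \<open>Suc d\<close> is nonzero
            modulo \<open>p\<close>, so the newly added \<open>T\<close> contributes nothing at
            these positions.\<close>
          have "\<not> p dvd Suc d" using * by (auto dest: dvd_imp_le)
          then have "\<not> p dvd p * i + Suc d" using dvd_add_right_iff[of p "p * i" "Suc d"] by simp
          then have "Polynomial.coeff (T p) (p * i + Suc d) = 0" using T p unfolding Q_def by blast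
          moreover have "Polynomial.coeff (Polynomial.monom 1 (p ^ 0) * V p) (p * i + Suc d) = Polynomial.coeff (V p) (p * i + d)"
            by (simp add: coeff_monom_mult)
          ultimately show "Polynomial.coeff (Polynomial.monom 1 (p ^ 0) * V p + T p) (p * i + Suc d) = Polynomial.coeff (C p) (p * i)"
            using * by simp
        qed
      qed
    qed
  next
    fix d C V assume "J d C V"
    then show "poly_bounded (\<lambda>p. Polynomial.degree (V p))" by (simp add: J_def)
  next
    fix d C V assume J: "J d C V"
    then have "ae (\<lambda>p. \<forall>i. Polynomial.coeff (V p) (p * i + d) = Polynomial.coeff (C p) (p * i))" by (simp add: J_def)
    then show "ae (\<lambda>p. (\<forall>i. int p dvd Polynomial.coeff (V p) i) \<longrightarrow> (\<forall>i. int p dvd Polynomial.coeff (C p) i))"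
    proof (rule ae_mono, intro impI allI)
      fix p i assume p: "Factorial_Ring.prime p"
        and *: "\<forall>i. Polynomial.coeff (V p) (p * i + d) = Polynomial.coeff (C p) (p * i)"
        and V: "\<forall>i. int p dvd Polynomial.coeff (V p) i"
      show "int p dvd Polynomial.coeff (C p) i"
      proof (cases "Polynomial.coeff (C p) i = 0")
        case False
        then have "p dvd i" using J p unfolding J_def Q_def by blast
        then obtain j where "i = p * j" by (elim dvdE)
        then show ?thesis using * V by metis
      qed simp
    qed
  qed
qed

end
end

section \<open>The orbit of the class of generators\<close>

context generic_ultraproduct begin

text \<open>On a field with \<open>p ^ k\<close> elements the inverse of Frobenius is its power with exponent \<open>k - 1\<close>.\<close>

definition twist :: "int \<Rightarrow> nat \<Rightarrow> nat" where
  "twist i p = (if i \<ge> 0 then nat i else (k p - 1) * nat (- i))"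

definition orb :: "int \<Rightarrow> (nat \<Rightarrow> nat) set" where
  "orb i = cl (\<lambda>p. \<alpha> p [^]\<^bsub>K p\<^esub> (p ^ twist i p))"

lemma fam_\<alpha>: "fam \<alpha>"
  using generic by (simp add: fam_def generic_elt_def)

lemma generic_twist: "Factorial_Ring.prime p \<Longrightarrow> generic_elt (K p) p (k p) (\<alpha> p [^]\<^bsub>K p\<^esub> (p ^ twist i p))"
  by (rule field.generic_elt_frobenius[OF K_field _ K_char generic])

text \<open>For negative \<open>i\<close> the two exponents of \<open>p\<close> differ by
  \<open>k p\<close> after the application of Frobenius, and the \<open>p ^ k p\<close>-th power is
  the identity.\<close>

lemma frob_orb: "\<sigma> (orb i) = orb (i + 1)"
  unfolding orb_def frob_F[OF fam_pow[OF fam_\<alpha>]]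
proof (rule cl_cong)
  fix p :: nat assume p: "Factorial_Ring.prime p"
  note ap = famD[OF fam_\<alpha> p]
  have l: "(\<alpha> p [^]\<^bsub>K p\<^esub> (p ^ twist i p)) [^]\<^bsub>K p\<^esub> p = \<alpha> p [^]\<^bsub>K p\<^esub> (p ^ (twist i p + 1))"
    by (simp add: K_pow_pow[OF p ap] mult.commute)
  show "(\<alpha> p [^]\<^bsub>K p\<^esub> (p ^ twist i p)) [^]\<^bsub>K p\<^esub> p = \<alpha> p [^]\<^bsub>K p\<^esub> (p ^ twist (i + 1) p)"
  proof (cases "i \<ge> 0")
    case True
    then have "twist (i + 1) p = twist i p + 1" by (simp add: twist_def nat_add_distrib)
    then show ?thesis using l by simp
  next
    case False
    then obtain m where m: "nat (- i) = Suc m" by (cases "nat (- i)") auto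
    then have i: "i = - int m - 1" by linarith
    have "twist i p + 1 = k p + twist (i + 1) p"
      using k_pos[OF p] unfolding i twist_def by (auto simp: nat_add_distrib)
    then show ?thesis unfolding l
      using K_pow_pow[OF p ap, of "p ^ k p" "p ^ twist (i + 1) p"] K_pow_card[OF p ap]
      by (simp add: power_add)
  qed
qed

text \<open>For negative indices the exponents \<open>p ^ twist l p\<close> are too large for the
  degree bounds. Taking the element of index \<open>l\<close> as new base leaves only the powers
  \<open>p ^ j\<close>, with \<open>j\<close> independent of \<open>p\<close>.\<close>

lemma orb_shift: "orb (l + int j) = cl (\<lambda>p. (\<alpha> p [^]\<^bsub>K p\<^esub> (p ^ twist l p)) [^]\<^bsub>K p\<^esub> (p ^ j))"
proof (induct j)
  case 0
  show ?case unfolding orb_def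
    by (rule cl_cong) (simp add: monoid.l_one[OF ring.is_monoid[OF K_ring]] monoid.nat_pow_closed[OF ring.is_monoid[OF K_ring]] famD[OF fam_\<alpha>])
next
  case (Suc j)
  have "orb (l + int (Suc j)) = \<sigma> (orb (l + int j))" unfolding frob_orb by (simp add: algebra_simps)
  also have "\<dots> = cl (\<lambda>p. ((\<alpha> p [^]\<^bsub>K p\<^esub> (p ^ twist l p)) [^]\<^bsub>K p\<^esub> (p ^ j)) [^]\<^bsub>K p\<^esub> p)"
    unfolding Suc by (rule frob_F[OF fam_pow[OF fam_pow[OF fam_\<alpha>]]])
  also have "\<dots> = cl (\<lambda>p. (\<alpha> p [^]\<^bsub>K p\<^esub> (p ^ twist l p)) [^]\<^bsub>K p\<^esub> (p ^ Suc j))"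
    by (rule cl_cong) (simp add: K_pow_pow monoid.nat_pow_closed[OF ring.is_monoid[OF K_ring]] famD[OF fam_\<alpha>] ac_simps)
  finally show ?case .
qed

lemma orb_window:
  assumes "l \<le> u"
  shows "orb ` {l..<u} = (\<lambda>j. orb (l + int j)) ` {..<nat (u - l)}"
proof -
  have "{l..<u} = (\<lambda>j. l + int j) ` {..<nat (u - l)}"
  proof (intro equalityI subsetI)
    fix x assume "x \<in> {l..<u}"
    then have "x = l + int (nat (x - l))" "nat (x - l) \<in> {..<nat (u - l)}" by auto
    then show "x \<in> (\<lambda>j. l + int j) ` {..<nat (u - l)}" by (rule image_eqI)
  qed auto
  then show ?thesis by (simp add: image_image)
qed

text \<open>The base is one step below the window, because the element of index \<open>l - 1\<close>
  is itself the variable whose transcendence is claimed; the window then occupies the positive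
  shifts.\<close>

lemma orb_window':
  assumes "l \<le> u"
  shows "orb ` {l..<u} = (\<lambda>j. orb (l - 1 + int j)) ` {0<..nat (u - l)}"
proof -
  have "{l..<u} = (\<lambda>j. l - 1 + int j) ` {0<..nat (u - l)}"
  proof (intro equalityI subsetI)
    fix x assume "x \<in> {l..<u}"
    then have "x = l - 1 + int (nat (x - l + 1))" "nat (x - l + 1) \<in> {0<..nat (u - l)}" by auto
    then show "x \<in> (\<lambda>j. l - 1 + int j) ` {0<..nat (u - l)}" by (rule image_eqI)
  qed auto
  then show ?thesis by (simp add: image_image)
qed

lemma orbit: "generic_orbit F \<sigma> orb"
proof -
  have d: "difference_field F \<sigma>"
    using F_field frob_hom frob_bij by (simp add: difference_field_def difference_field_axioms_def)
  show ?thesis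
  proof (rule generic_orbit.intro[OF d], unfold_locales)
    show "orb i \<in> carrier F" for i unfolding orb_def by (intro cl_closed fam_pow fam_\<alpha>)
    show "\<sigma> (orb i) = orb (i + 1)" for i by (rule frob_orb)
    fix l u :: int assume lu: "l \<le> u"
    have u: "orb u = orb (l + int (nat (u - l)))" using lu by simp
    show "transc F (generate_ring F (orb ` {l..<u})) (orb u)"
      unfolding orb_window[OF lu] u unfolding orb_shift by (rule transc_top[OF generic_twist])
    have l: "orb (l - 1) = orb (l - 1 + int 0)" by simp
    show "transc F (generate_ring F (orb ` {l..<u})) (orb (l - 1))"
      unfolding orb_window'[OF lu] l unfolding orb_shift by (rule transc_bottom[OF generic_twist])
  qed
qed

lemma frob_pow_F: "fam g \<Longrightarrow> (\<sigma> ^^ n) (cl g) = cl (\<lambda>p. g p [^]\<^bsub>K p\<^esub> (p ^ n))"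
proof (induct n)
  case 0
  show ?case
    by (simp, rule cl_cong) (simp add: monoid.l_one[OF ring.is_monoid[OF K_ring]] famD[OF 0])
next
  case (Suc n)
  have "(\<sigma> ^^ Suc n) (cl g) = cl (\<lambda>p. (g p [^]\<^bsub>K p\<^esub> (p ^ n)) [^]\<^bsub>K p\<^esub> p)"
    using Suc frob_F[OF fam_pow[OF Suc(2)]] by simp
  also have "\<dots> = cl (\<lambda>p. g p [^]\<^bsub>K p\<^esub> (p ^ Suc n))"
    by (rule cl_cong) (simp add: K_pow_pow[OF _ famD[OF Suc(2)]] mult.commute)
  finally show ?case .
qed

text \<open>Injectivity is inherited from the factors with odd \<open>p\<close>; the single prime 2
  is negligible for the ultrafilter.\<close>

lemma frob_pow_plus_id_inj:
  assumes km: "\<And>p. Factorial_Ring.prime p \<Longrightarrow> k p = 2 * n * m p + 1"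
    and x: "x \<in> carrier F" and y: "y \<in> carrier F"
    and eq: "(\<sigma> ^^ n) x \<oplus>\<^bsub>F\<^esub> x = (\<sigma> ^^ n) y \<oplus>\<^bsub>F\<^esub> y"
  shows "x = y"
proof -
  obtain g where g: "fam g" "x = cl g" using x by (rule carrier_FE)
  obtain h where h: "fam h" "y = cl h" using y by (rule carrier_FE)
  have "ae (\<lambda>p. g p [^]\<^bsub>K p\<^esub> (p ^ n) \<oplus>\<^bsub>K p\<^esub> g p = h p [^]\<^bsub>K p\<^esub> (p ^ n) \<oplus>\<^bsub>K p\<^esub> h p)"
    using eq unfolding g(2) h(2) frob_pow_F[OF g(1)] frob_pow_F[OF h(1)]
      add_F[OF fam_pow[OF g(1)] g(1)] add_F[OF fam_pow[OF h(1)] h(1)]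
    by (rule cl_eqD[OF fam_add[OF fam_pow[OF g(1)] g(1)]])
  from ae_conj[OF this ae_ge[of 2]] have "ae (\<lambda>p. g p = h p)"
  proof (rule ae_mono, elim conjE)
    fix p :: nat assume p: "Factorial_Ring.prime p" "p > 2"
      and e: "g p [^]\<^bsub>K p\<^esub> (p ^ n) \<oplus>\<^bsub>K p\<^esub> g p = h p [^]\<^bsub>K p\<^esub> (p ^ n) \<oplus>\<^bsub>K p\<^esub> h p"
    have per: "x [^]\<^bsub>K p\<^esub> (p ^ (2 * n * m p + 1)) = x" if "x \<in> carrier (K p)" for x
      using K_pow_card[OF p(1) that] km[OF p(1)] by simp
    show "g p = h p"
      by (rule field.frobenius_plus_id_inj[OF K_field[OF p(1)] p K_char[OF p(1)] per
            famD[OF g(1) p(1)] famD[OF h(1) p(1)] e])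
  qed
  then show "x = y" unfolding g(2) h(2) by (rule cl_eqI)
qed

end

section \<open>The defining formula and the choice of the finite fields\<close>

lemma teval_TSig_funpow: "teval R s e ((TSig ^^ n) t) = (s ^^ n) (teval R s e t)"
  by (induct n) auto

lemma tfv_TSig_funpow: "tfv ((TSig ^^ n) t) = tfv t"
  by (induct n) auto

theorem theorem4p6:
  fixes C :: "fml \<Rightarrow> nat set \<Rightarrow> real"
    and D :: "fml \<Rightarrow> nat set \<Rightarrow> (nat \<times> real) set"
  assumes "good_counting C D"
  shows "\<forall>n::nat. n > 0 \<longrightarrow>
    (\<exists>(k :: nat \<Rightarrow> nat) (U :: nat set set) (K :: nat \<Rightarrow> nat ring).
       nonprincipal_ultrafilter_on Primes U \<and>
       (\<forall>p. Factorial_Ring.prime p \<longrightarrow> field (K p) \<and> card (carrier (K p)) = p ^ k p \<and>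
                           real (k p) \<ge> fbound C D p p) \<and>
       (\<exists>a \<in> carrier (ultraprod K U). \<exists>bs. set bs \<subseteq> carrier (ultraprod K U) \<and>
          dcl_mem (ultraprod K U) (ufrob K U) bs a \<and>
          deg_sigma_eq (ultraprod K U) (ufrob K U) a bs n))"
proof (intro allI impI)
  fix n :: nat assume n: "n > 0"
  \<comment> \<open>The two summands take care of the prescribed lower bound and of the growth
    needed for independence; passing from \<open>m p\<close> to \<open>k p\<close> preserves both
    lower bounds.\<close>
  define m where "m p = nat \<lceil>fbound C D p p\<rceil> + p ^ p" for p
  define k where "k p = 2 * n * m p + 1" for p
  have "1 * m p \<le> 2 * n * m p" for p using n by (intro mult_le_mono1) simp
  then have km: "m p \<le> k p" for p unfolding k_def by (simp add: le_SucI)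
  have "\<forall>p. \<exists>K :: nat ring. Factorial_Ring.prime p \<longrightarrow>
      field K \<and> card (carrier K) = p ^ k p \<and> int_emb K (int p) = \<zero>\<^bsub>K\<^esub>"
    using finite_field_exists unfolding k_def by (metis add_gr_0 zero_less_one)
  then obtain K :: "nat \<Rightarrow> nat ring" where K: "\<And>p. Factorial_Ring.prime p \<Longrightarrow>
      field (K p) \<and> card (carrier (K p)) = p ^ k p \<and> int_emb (K p) (int p) = \<zero>\<^bsub>K p\<^esub>"
    by metis
  have "\<forall>p. \<exists>g. Factorial_Ring.prime p \<longrightarrow> generic_elt (K p) p (k p) g"
    using field.finite_field_generic_elt K by metis
  then obtain \<alpha> where \<alpha>: "\<And>p. Factorial_Ring.prime p \<Longrightarrow> generic_elt (K p) p (k p) (\<alpha> p)"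
    by metis
  obtain U where U: "nonprincipal_ultrafilter_on Primes U"
    using nonprincipal_ultrafilter_exists[OF primes_infinite] by blast
  have fin: "finite (carrier (K p))" if "Factorial_Ring.prime p" for p
  proof -
    have "card (carrier (K p)) > 0" using K[OF that] prime_gt_0_nat[OF that] by simp
    then show ?thesis by (rule card_ge_0_finite)
  qed
  interpret G: generic_ultraproduct K U k \<alpha>
  proof (intro generic_ultraproduct.intro field_ultraproduct.intro generic_ultraproduct_axioms.intro)
    show "p ^ p \<le> k p" for p using km[of p] by (simp add: m_def)
  qed (simp_all add: U K fin \<alpha>)
  interpret O: generic_orbit "ultraprod K U" "ufrob K U" G.orb by (rule G.orbit)
  let ?F = "ultraprod K U" and ?s = "ufrob K U"
  let ?a = "G.orb 0" and ?b = "O.param n 0"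
  have sa: "(?s ^^ j) ?a = G.orb (int j)" for j
    by (induct j) (simp_all add: G.frob_orb add.commute)
  have b: "?b = (?s ^^ n) ?a \<oplus>\<^bsub>?F\<^esub> ?a" unfolding O.param_def sa by simp
  \<comment> \<open>The formula sigma^n(x) + x = b: variable 0 stands for the defined element and
    variable 1 for the single entry of the tuple, as fixed in \<open>dcl_mem\<close>.\<close>
  define phi where "phi = FEq (TAdd ((TSig ^^ n) (TVar 0)) (TVar 0)) (TVar 1)"
  have "dcl_mem ?F ?s [?b] ?a"
    unfolding dcl_mem_def
  proof (intro exI[of _ phi] conjI)
    show "ffv phi \<subseteq> {..length [?b]}" by (auto simp: phi_def tfv_TSig_funpow)
    have s: "sat ?F ?s (\<lambda>i. if i = 0 then x else [?b] ! (i - 1)) phi \<longleftrightarrow> (?s ^^ n) x \<oplus>\<^bsub>?F\<^esub> x = ?b" for x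
      by (simp add: phi_def teval_TSig_funpow)
    have u: "x = ?a" if "x \<in> carrier ?F" "(?s ^^ n) x \<oplus>\<^bsub>?F\<^esub> x = ?b" for x
      by (rule G.frob_pow_plus_id_inj[of n m, OF _ that(1) O.orb_closed])
        (use that(2) b in \<open>simp_all add: k_def\<close>)
    show "{x \<in> carrier ?F. sat ?F ?s (\<lambda>i. if i = 0 then x else [?b] ! (i - 1)) phi} = {?a}"
      unfolding s
    proof (intro equalityI subsetI)
      fix x assume "x \<in> {x \<in> carrier ?F. (?s ^^ n) x \<oplus>\<^bsub>?F\<^esub> x = ?b}"
      then show "x \<in> {?a}" using u[of x] by simp
    next
      fix x assume "x \<in> {?a}"
      then have "x = ?a" by simp
      then show "x \<in> {x \<in> carrier ?F. (?s ^^ n) x \<oplus>\<^bsub>?F\<^esub> x = ?b}"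
        using O.orb_closed[of 0] b[symmetric] by (simp only: mem_Collect_eq)
    qed
  qed
  moreover have "deg_sigma_eq ?F ?s ?a [?b] n" by (rule O.deg_sigma_orbit[OF n])
  moreover have "real (k p) \<ge> fbound C D p p" for p
  proof -
    have "fbound C D p p \<le> real (nat \<lceil>fbound C D p p\<rceil>)" by linarith
    also have "\<dots> \<le> real (k p)"
      by (rule of_nat_mono) (use km[of p] in \<open>unfold m_def, linarith\<close>)
    finally show ?thesis .
  qed
  ultimately show "\<exists>(k :: nat \<Rightarrow> nat) (U :: nat set set) (K :: nat \<Rightarrow> nat ring).
       nonprincipal_ultrafilter_on Primes U \<and>
       (\<forall>p. Factorial_Ring.prime p \<longrightarrow> field (K p) \<and> card (carrier (K p)) = p ^ k p \<and>
                           real (k p) \<ge> fbound C D p p) \<and>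
       (\<exists>a \<in> carrier (ultraprod K U). \<exists>bs. set bs \<subseteq> carrier (ultraprod K U) \<and>
          dcl_mem (ultraprod K U) (ufrob K U) bs a \<and>
          deg_sigma_eq (ultraprod K U) (ufrob K U) a bs n)"
    by (intro exI[of _ k] exI[of _ U] exI[of _ K] conjI bexI[of _ ?a] exI[of _ "[?b]"])
      (simp_all add: U K O.orb_closed O.param_closed)
qed

end
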